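(* There is an isomorphism of categories $$\mathsf{St}(\mathbf{Cospan}(\mathbf{Set})) \;\cong\; \mathbf{Cospan}(\mathbf{Graph})_{\ast},$$ where $\mathbf{Cospan}(\mathbf{Graph})_{\ast}$ is the full subcategory of $\mathbf{Cospan}(\mathbf{Graph})$ on the discrete graphs, i.e. graphs with an empty set of edges.
   Context: Composition $f ; g$ is written in diagrammatic order; associators and unitors are suppressed. **Cospans.** For a category $\mathbf{C}$ with finite colimits, $\mathbf{Cospan}(\mathbf{C})=\mathbf{Span}(\mathbf{C}^{op})$: it has the objects of $\mathbf{C}$; a morphism $A\to B$ is an isomorphism class of cospans $A\to E\leftarrow B$ (isomorphisms of apexes commuting with both legs). Composition is by pushout. It is symmetric monoidal with tensor given by the coproduct of $\mathbf{C}$. **Graphs.** An object of $\mathbf{Graph}$ is a pair of functions $s,t\colon E\rightrightarrows V$ (source and target); a morphism $(e,v)$ consists of functions $e\colon E\to E'$, $v\colon V\to V'$ with $e;s'=s;v$ and $e;t'=t;v$. The discrete graph on a set $A$ is $(\emptyset\rightrightarrows A)$. **Stateful processes.** For a symmetric monoidal category $(\mathbf{C},\otimes,I)$ with symmetry $\sigma$, $\mathsf{St}(\mathbf{C})$ has the objects of $\mathbf{C}$; a morphism $A\to B$ is a pair $(S\mid f)$ with $S\in\mathbf{C}$ and $f\colon S\otimes A\to S\otimes B$, modulo $(S\mid f) = (T\mid (h^{-1}\otimes \mathrm{id});f;(h\otimes \mathrm{id}))$ for every isomorphism $h\colon S\cong T$ of $\mathbf{C}$. The identity on $A$ is $(I\mid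 \mathrm{id}_{I\otimes A})$. Sequential composition of $(S\mid f)\colon A\to B$ and $(T\mid g)\colon B\to C$ is $(S\otimes T\mid (\sigma_{S,T}\otimes \mathrm{id}_A);(\mathrm{id}_T\otimes f);(\sigma_{T,S}\otimes \mathrm{id}_B);(\mathrm{id}_S\otimes g))$. The tensor of $(S\mid f)\colon A\to B$ and $(S'\mid f')\colon A'\to B'$ is $(S\otimes S'\mid (\mathrm{id}\otimes\sigma\otimes \mathrm{id});(f\otimes f');(\mathrm{id}\otimes\sigma\otimes \mathrm{id}))$. **Isomorphism of categories.** An isomorphism between symmetric monoidal categories means a symmetric strong monoidal functor that is fully faithful and bijective on objects. *)

theory Defs
  imports "HOL-Library.FuncSet"
begin

section \<open>Categories\<close>

text \<open>Composition \<open>f \<Zsemi> g\<close> is in diagrammatic order: first \<open>f\<close>, then \<open>g\<close>.\<close>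

record ('o, 'm) cat =
  Ob :: "'o set"
  Ar :: "'m set"
  Dom :: "'m \<Rightarrow> 'o"
  Cod :: "'m \<Rightarrow> 'o"
  Ide :: "'o \<Rightarrow> 'm"
  Comp :: "'m \<Rightarrow> 'm \<Rightarrow> 'm"  (infixl "\<Zsemi>\<index>" 55)

definition hom :: "('o, 'm, 'x) cat_scheme \<Rightarrow> 'o \<Rightarrow> 'o \<Rightarrow> 'm set" where
  "hom C A B = {f \<in> Ar C. Dom C f = A \<and> Cod C f = B}"

locale category =
  fixes C :: "('o, 'm, 'x) cat_scheme" (structure)
  assumes Dom_in_Ob: "f \<in> Ar C \<Longrightarrow> Dom C f \<in> Ob C"
    and Cod_in_Ob: "f \<in> Ar C \<Longrightarrow> Cod C f \<in> Ob C"
    and Ide_in_hom: "A \<in> Ob C \<Longrightarrow> Ide C A \<in> hom C A A"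
    and Comp_in_hom: "\<lbrakk>f \<in> hom C A B; g \<in> hom C B D\<rbrakk> \<Longrightarrow> f \<Zsemi> g \<in> hom C A D"
    and Ide_Comp: "f \<in> hom C A B \<Longrightarrow> Ide C A \<Zsemi> f = f"
    and Comp_Ide: "f \<in> hom C A B \<Longrightarrow> f \<Zsemi> Ide C B = f"
    and Comp_assoc: "\<lbrakk>f \<in> hom C A B; g \<in> hom C B D; h \<in> hom C D E\<rbrakk>
                      \<Longrightarrow> (f \<Zsemi> g) \<Zsemi> h = f \<Zsemi> (g \<Zsemi> h)"

definition full_subcategory ::
    "('o, 'm, 'x) cat_scheme \<Rightarrow> ('o \<Rightarrow> bool) \<Rightarrow> ('o, 'm, 'x) cat_scheme" where
  "full_subcategory C P =
     C\<lparr>Ob := {A \<in> Ob C. P A}, Ar := {f \<in> Ar C. P (Dom C f) \<and> P (Cod C f)}\<rparr>"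

context
  fixes C :: "('o, 'm, 'x) cat_scheme" (structure)
begin

definition inverse_arrows :: "'m \<Rightarrow> 'm \<Rightarrow> bool" where
  "inverse_arrows f g \<longleftrightarrow>
     f \<in> Ar C \<and> g \<in> hom C (Cod C f) (Dom C f) \<and>
     f \<Zsemi> g = Ide C (Dom C f) \<and> g \<Zsemi> f = Ide C (Cod C f)"

definition iso :: "'m \<Rightarrow> bool" where
  "iso f \<longleftrightarrow> (\<exists>g. inverse_arrows f g)"

definition inv_arrow :: "'m \<Rightarrow> 'm" where
  "inv_arrow f = (THE g. inverse_arrows f g)"

definition is_initial :: "'o \<Rightarrow> bool" where
  "is_initial Z \<longleftrightarrow> Z \<in> Ob C \<and> (\<forall>A\<in>Ob C. \<exists>!f. f \<in> hom C Z A)"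

definition is_coproduct :: "'o \<Rightarrow> 'o \<Rightarrow> 'o \<Rightarrow> 'm \<Rightarrow> 'm \<Rightarrow> bool" where
  "is_coproduct A B P i j \<longleftrightarrow>
     i \<in> hom C A P \<and> j \<in> hom C B P \<and>
     (\<forall>X\<in>Ob C. \<forall>f\<in>hom C A X. \<forall>g\<in>hom C B X.
        \<exists>!h. h \<in> hom C P X \<and> i \<Zsemi> h = f \<and> j \<Zsemi> h = g)"

text \<open>Pushout \<open>p, q\<close> of the span \<open>f, g\<close>.\<close>

definition is_pushout :: "'m \<Rightarrow> 'm \<Rightarrow> 'm \<Rightarrow> 'm \<Rightarrow> bool" where
  "is_pushout f g p q \<longleftrightarrow>
     f \<in> Ar C \<and> g \<in> Ar C \<and> Dom C f = Dom C g \<and>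
     p \<in> hom C (Cod C f) (Cod C p) \<and> q \<in> hom C (Cod C g) (Cod C p) \<and>
     f \<Zsemi> p = g \<Zsemi> q \<and>
     (\<forall>X\<in>Ob C. \<forall>u\<in>hom C (Cod C f) X. \<forall>v\<in>hom C (Cod C g) X. f \<Zsemi> u = g \<Zsemi> v \<longrightarrow>
        (\<exists>!h. h \<in> hom C (Cod C p) X \<and> p \<Zsemi> h = u \<and> q \<Zsemi> h = v))"

text \<open>An arbitrary but fixed choice of initial object and binary coproducts.\<close>

definition initial_ob :: 'o where
  "initial_ob = (SOME Z. is_initial Z)"

definition from_initial :: "'o \<Rightarrow> 'm" where
  "from_initial A = (THE f. f \<in> hom C initial_ob A)"

definition coproduct :: "'o \<Rightarrow> 'o \<Rightarrow> 'o \<times> 'm \<times> 'm" where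
  "coproduct A B = (SOME (P, i, j). is_coproduct A B P i j)"

definition coprod_ob :: "'o \<Rightarrow> 'o \<Rightarrow> 'o" where
  "coprod_ob A B = fst (coproduct A B)"

definition inj1 :: "'o \<Rightarrow> 'o \<Rightarrow> 'm" where
  "inj1 A B = fst (snd (coproduct A B))"

definition inj2 :: "'o \<Rightarrow> 'o \<Rightarrow> 'm" where
  "inj2 A B = snd (snd (coproduct A B))"

definition copair :: "'m \<Rightarrow> 'm \<Rightarrow> 'm" where
  "copair f g =
     (THE h. h \<in> hom C (coprod_ob (Dom C f) (Dom C g)) (Cod C f) \<and>
             inj1 (Dom C f) (Dom C g) \<Zsemi> h = f \<and> inj2 (Dom C f) (Dom C g) \<Zsemi> h = g)"

definition coprod_ar :: "'m \<Rightarrow> 'm \<Rightarrow> 'm" where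
  "coprod_ar f g = copair (f \<Zsemi> inj1 (Cod C f) (Cod C g)) (g \<Zsemi> inj2 (Cod C f) (Cod C g))"

definition coprod_assoc :: "'o \<Rightarrow> 'o \<Rightarrow> 'o \<Rightarrow> 'm" where
  "coprod_assoc A B D =
     copair (copair (inj1 A (coprod_ob B D)) (inj1 B D \<Zsemi> inj2 A (coprod_ob B D)))
            (inj2 B D \<Zsemi> inj2 A (coprod_ob B D))"

end

section \<open>Symmetric monoidal categories and functors\<close>

record ('o, 'm) smcat = "('o, 'm) cat" +
  Unit :: 'o
  TensorOb :: "'o \<Rightarrow> 'o \<Rightarrow> 'o"  (infixl "\<odot>\<index>" 70)
  TensorAr :: "'m \<Rightarrow> 'm \<Rightarrow> 'm"  (infixl "\<otimes>\<index>" 70)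
  Assoc :: "'o \<Rightarrow> 'o \<Rightarrow> 'o \<Rightarrow> 'm"  \<comment> \<open>\<open>(A \<odot> B) \<odot> D \<rightarrow> A \<odot> (B \<odot> D)\<close>\<close>
  LUnit :: "'o \<Rightarrow> 'm"              \<comment> \<open>\<open>Unit \<odot> A \<rightarrow> A\<close>\<close>
  RUnit :: "'o \<Rightarrow> 'm"              \<comment> \<open>\<open>A \<odot> Unit \<rightarrow> A\<close>\<close>
  Sym :: "'o \<Rightarrow> 'o \<Rightarrow> 'm"          \<comment> \<open>\<open>A \<odot> B \<rightarrow> B \<odot> A\<close>\<close>

locale symmetric_monoidal_category = category C
  for C :: "('o, 'm, 'x) smcat_scheme" (structure) +
  assumes Unit_in_Ob: "Unit C \<in> Ob C"
    and TensorOb_in_Ob: "\<lbrakk>A \<in> Ob C; B \<in> Ob C\<rbrakk> \<Longrightarrow> A \<odot> B \<in> Ob C"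
    and TensorAr_in_hom:
      "\<lbrakk>f \<in> hom C A B; f' \<in> hom C A' B'\<rbrakk> \<Longrightarrow> f \<otimes> f' \<in> hom C (A \<odot> A') (B \<odot> B')"
    and Tensor_Ide:
      "\<lbrakk>A \<in> Ob C; B \<in> Ob C\<rbrakk> \<Longrightarrow> Ide C A \<otimes> Ide C B = Ide C (A \<odot> B)"
    and Tensor_Comp:
      "\<lbrakk>f \<in> hom C A B; g \<in> hom C B D; f' \<in> hom C A' B'; g' \<in> hom C B' D'\<rbrakk>
        \<Longrightarrow> (f \<Zsemi> g) \<otimes> (f' \<Zsemi> g') = f \<otimes> f' \<Zsemi> g \<otimes> g'"
    and Assoc_in_hom:
      "\<lbrakk>A \<in> Ob C; B \<in> Ob C; D \<in> Ob C\<rbrakk>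
        \<Longrightarrow> Assoc C A B D \<in> hom C (A \<odot> B \<odot> D) (A \<odot> (B \<odot> D))"
    and Assoc_iso:
      "\<lbrakk>A \<in> Ob C; B \<in> Ob C; D \<in> Ob C\<rbrakk> \<Longrightarrow> iso C (Assoc C A B D)"
    and Assoc_natural:
      "\<lbrakk>f \<in> hom C A A'; g \<in> hom C B B'; h \<in> hom C D D'\<rbrakk>
        \<Longrightarrow> f \<otimes> g \<otimes> h \<Zsemi> Assoc C A' B' D' = Assoc C A B D \<Zsemi> f \<otimes> (g \<otimes> h)"
    and LUnit_in_hom: "A \<in> Ob C \<Longrightarrow> LUnit C A \<in> hom C (Unit C \<odot> A) A"
    and LUnit_iso: "A \<in> Ob C \<Longrightarrow> iso C (LUnit C A)"
    and LUnit_natural: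
      "f \<in> hom C A B \<Longrightarrow> Ide C (Unit C) \<otimes> f \<Zsemi> LUnit C B = LUnit C A \<Zsemi> f"
    and RUnit_in_hom: "A \<in> Ob C \<Longrightarrow> RUnit C A \<in> hom C (A \<odot> Unit C) A"
    and RUnit_iso: "A \<in> Ob C \<Longrightarrow> iso C (RUnit C A)"
    and RUnit_natural:
      "f \<in> hom C A B \<Longrightarrow> f \<otimes> Ide C (Unit C) \<Zsemi> RUnit C B = RUnit C A \<Zsemi> f"
    and Sym_in_hom: "\<lbrakk>A \<in> Ob C; B \<in> Ob C\<rbrakk> \<Longrightarrow> Sym C A B \<in> hom C (A \<odot> B) (B \<odot> A)"
    and Sym_natural:
      "\<lbrakk>f \<in> hom C A A'; g \<in> hom C B B'\<rbrakk> \<Longrightarrow> f \<otimes> g \<Zsemi> Sym C A' B' = Sym C A B \<Zsemi> g \<otimes> f"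
    and Sym_Sym: "\<lbrakk>A \<in> Ob C; B \<in> Ob C\<rbrakk> \<Longrightarrow> Sym C A B \<Zsemi> Sym C B A = Ide C (A \<odot> B)"
    and pentagon:
      "\<lbrakk>A \<in> Ob C; B \<in> Ob C; D \<in> Ob C; E \<in> Ob C\<rbrakk>
        \<Longrightarrow> Assoc C A B D \<otimes> Ide C E \<Zsemi> Assoc C A (B \<odot> D) E \<Zsemi> Ide C A \<otimes> Assoc C B D E
          = Assoc C (A \<odot> B) D E \<Zsemi> Assoc C A B (D \<odot> E)"
    and triangle:
      "\<lbrakk>A \<in> Ob C; B \<in> Ob C\<rbrakk>
        \<Longrightarrow> Assoc C A (Unit C) B \<Zsemi> Ide C A \<otimes> LUnit C B = RUnit C A \<otimes> Ide C B"
    and hexagon: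
      "\<lbrakk>A \<in> Ob C; B \<in> Ob C; D \<in> Ob C\<rbrakk>
        \<Longrightarrow> Assoc C A B D \<Zsemi> Sym C A (B \<odot> D) \<Zsemi> Assoc C B D A
          = Sym C A B \<otimes> Ide C D \<Zsemi> Assoc C B A D \<Zsemi> Ide C B \<otimes> Sym C A D"

text \<open>The structure isomorphisms of the functor are
  \<open>\<mu> A B : Fo A \<odot> Fo B \<rightarrow> Fo (A \<odot> B)\<close> and \<open>\<epsilon> : Unit \<rightarrow> Fo Unit\<close>.\<close>

locale symmetric_strong_monoidal_functor =
  C: symmetric_monoidal_category C + D: symmetric_monoidal_category D
  for C :: "('o1, 'm1, 'x1) smcat_scheme" (structure)
    and D :: "('o2, 'm2, 'x2) smcat_scheme" (structure) +
  fixes Fo :: "'o1 \<Rightarrow> 'o2"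
    and Fa :: "'m1 \<Rightarrow> 'm2"
    and \<mu> :: "'o1 \<Rightarrow> 'o1 \<Rightarrow> 'm2"
    and \<epsilon> :: 'm2
  assumes F_Ob: "A \<in> Ob C \<Longrightarrow> Fo A \<in> Ob D"
    and F_hom: "f \<in> hom C A B \<Longrightarrow> Fa f \<in> hom D (Fo A) (Fo B)"
    and F_Ide: "A \<in> Ob C \<Longrightarrow> Fa (Ide C A) = Ide D (Fo A)"
    and F_Comp:
      "\<lbrakk>f \<in> hom C A B; g \<in> hom C B E\<rbrakk> \<Longrightarrow> Fa (f \<Zsemi>\<^bsub>C\<^esub> g) = Fa f \<Zsemi>\<^bsub>D\<^esub> Fa g"
    and \<mu>_in_hom:
      "\<lbrakk>A \<in> Ob C; B \<in> Ob C\<rbrakk> \<Longrightarrow> \<mu> A B \<in> hom D (Fo A \<odot>\<^bsub>D\<^esub> Fo B) (Fo (A \<odot>\<^bsub>C\<^esub> B))"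
    and \<mu>_iso: "\<lbrakk>A \<in> Ob C; B \<in> Ob C\<rbrakk> \<Longrightarrow> iso D (\<mu> A B)"
    and \<mu>_natural:
      "\<lbrakk>f \<in> hom C A A'; g \<in> hom C B B'\<rbrakk>
        \<Longrightarrow> Fa f \<otimes>\<^bsub>D\<^esub> Fa g \<Zsemi>\<^bsub>D\<^esub> \<mu> A' B' = \<mu> A B \<Zsemi>\<^bsub>D\<^esub> Fa (f \<otimes>\<^bsub>C\<^esub> g)"
    and \<epsilon>_in_hom: "\<epsilon> \<in> hom D (Unit D) (Fo (Unit C))"
    and \<epsilon>_iso: "iso D \<epsilon>"
    and F_Assoc:
      "\<lbrakk>A \<in> Ob C; B \<in> Ob C; E \<in> Ob C\<rbrakk>
        \<Longrightarrow> \<mu> A B \<otimes>\<^bsub>D\<^esub> Ide D (Fo E) \<Zsemi>\<^bsub>D\<^esub> \<mu> (A \<odot>\<^bsub>C\<^esub> B) E \<Zsemi>\<^bsub>D\<^esub> Fa (Assoc C A B E)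
          = Assoc D (Fo A) (Fo B) (Fo E) \<Zsemi>\<^bsub>D\<^esub> Ide D (Fo A) \<otimes>\<^bsub>D\<^esub> \<mu> B E \<Zsemi>\<^bsub>D\<^esub> \<mu> A (B \<odot>\<^bsub>C\<^esub> E)"
    and F_LUnit:
      "A \<in> Ob C \<Longrightarrow>
        \<epsilon> \<otimes>\<^bsub>D\<^esub> Ide D (Fo A) \<Zsemi>\<^bsub>D\<^esub> \<mu> (Unit C) A \<Zsemi>\<^bsub>D\<^esub> Fa (LUnit C A) = LUnit D (Fo A)"
    and F_RUnit:
      "A \<in> Ob C \<Longrightarrow>
        Ide D (Fo A) \<otimes>\<^bsub>D\<^esub> \<epsilon> \<Zsemi>\<^bsub>D\<^esub> \<mu> A (Unit C) \<Zsemi>\<^bsub>D\<^esub> Fa (RUnit C A) = RUnit D (Fo A)"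
    and F_Sym:
      "\<lbrakk>A \<in> Ob C; B \<in> Ob C\<rbrakk>
        \<Longrightarrow> \<mu> A B \<Zsemi>\<^bsub>D\<^esub> Fa (Sym C A B) = Sym D (Fo A) (Fo B) \<Zsemi>\<^bsub>D\<^esub> \<mu> B A"

locale symmetric_monoidal_isomorphism = symmetric_strong_monoidal_functor +
  assumes fully_faithful:
      "\<lbrakk>A \<in> Ob C; B \<in> Ob C\<rbrakk> \<Longrightarrow> bij_betw Fa (hom C A B) (hom D (Fo A) (Fo B))"
    and bijective_on_objects: "bij_betw Fo (Ob C) (Ob D)"

definition isomorphic_smcat ::
    "('o1, 'm1, 'x1) smcat_scheme \<Rightarrow> ('o2, 'm2, 'x2) smcat_scheme \<Rightarrow> bool" where
  "isomorphic_smcat C D \<longleftrightarrow> (\<exists>Fo Fa \<mu> \<epsilon>. symmetric_monoidal_isomorphism C D Fo Fa \<mu> \<epsilon>)"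

section \<open>Cospans\<close>

text \<open>A cospan \<open>A \<rightarrow> E \<leftarrow> B\<close> is the pair \<open>(l, r)\<close> of its legs; a morphism \<open>A \<rightarrow> B\<close> is
  \<open>(A, X, B)\<close> with \<open>X\<close> an isomorphism class of such cospans, i.e. a set of pairs.\<close>

type_synonym ('o, 'm) cospan_arrow = "'o \<times> ('m \<times> 'm) set \<times> 'o"

context
  fixes C :: "('o, 'm, 'x) cat_scheme" (structure)
begin

definition cospans :: "'o \<Rightarrow> 'o \<Rightarrow> ('m \<times> 'm) set" where
  "cospans A B = {(l, r). \<exists>E. l \<in> hom C A E \<and> r \<in> hom C B E}"

definition cospan_class :: "'m \<Rightarrow> 'm \<Rightarrow> ('m \<times> 'm) set" where
  "cospan_class l r = {(l \<Zsemi> h, r \<Zsemi> h) | h. iso C h \<and> Dom C h = Cod C l}"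

definition cospan_arrow :: "'m \<Rightarrow> 'm \<Rightarrow> ('o, 'm) cospan_arrow" where
  "cospan_arrow l r = (Dom C l, cospan_class l r, Dom C r)"

definition cospan_of :: "'m \<Rightarrow> ('o, 'm) cospan_arrow" where
  "cospan_of f = cospan_arrow f (Ide C (Cod C f))"

text \<open>Composition and tensor of classes are the union of the classes obtained from all
  representatives (and all pushouts).\<close>

definition cospan_comp ::
    "('o, 'm) cospan_arrow \<Rightarrow> ('o, 'm) cospan_arrow \<Rightarrow> ('o, 'm) cospan_arrow" where
  "cospan_comp = (\<lambda>(A, X, B) (B', Y, D).
     (A, \<Union>{cospan_class (l \<Zsemi> p) (r' \<Zsemi> q) | l r l' r' p q.
              (l, r) \<in> X \<and> (l', r') \<in> Y \<and> is_pushout C r l' p q}, D))"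

definition cospan_tensor ::
    "('o, 'm) cospan_arrow \<Rightarrow> ('o, 'm) cospan_arrow \<Rightarrow> ('o, 'm) cospan_arrow" where
  "cospan_tensor = (\<lambda>(A, X, B) (A', Y, B').
     (coprod_ob C A A',
      \<Union>{cospan_class (coprod_ar C l l') (coprod_ar C r r') | l r l' r'.
           (l, r) \<in> X \<and> (l', r') \<in> Y},
      coprod_ob C B B'))"

text \<open>Intended for \<open>C\<close> with finite colimits. The coherence isomorphisms are those of the
  coproduct in \<open>C\<close>, seen as cospans with an identity right leg.\<close>

definition Cospan :: "('o, ('o, 'm) cospan_arrow) smcat" where
  "Cospan =
     \<lparr>Ob = Ob C,
      Ar = {cospan_arrow l r | l r A B. A \<in> Ob C \<and> B \<in> Ob C \<and> (l, r) \<in> cospans A B},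
      Dom = (\<lambda>(A, X, B). A),
      Cod = (\<lambda>(A, X, B). B),
      Ide = (\<lambda>A. cospan_of (Ide C A)),
      Comp = cospan_comp,
      Unit = initial_ob C,
      TensorOb = coprod_ob C,
      TensorAr = cospan_tensor,
      Assoc = (\<lambda>A B D. cospan_of (coprod_assoc C A B D)),
      LUnit = (\<lambda>A. cospan_of (copair C (from_initial C A) (Ide C A))),
      RUnit = (\<lambda>A. cospan_of (copair C (Ide C A) (from_initial C A))),
      Sym = (\<lambda>A B. cospan_of (copair C (inj2 C B A) (inj1 C B A)))\<rparr>"

end

section \<open>Stateful processes\<close>

text \<open>A morphism \<open>A \<rightarrow> B\<close> is \<open>(A, X, B)\<close> with \<open>X\<close> an equivalence class of pairs \<open>(S, f)\<close>,
  \<open>f : S \<odot> A \<rightarrow> S \<odot> B\<close>.\<close>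

type_synonym ('o, 'm) st_arrow = "'o \<times> ('o \<times> 'm) set \<times> 'o"

context
  fixes C :: "('o, 'm, 'x) smcat_scheme" (structure)
begin

definition st_class :: "'o \<Rightarrow> 'o \<Rightarrow> 'o \<Rightarrow> 'm \<Rightarrow> ('o \<times> 'm) set" where
  "st_class A B S f =
     {(T, k \<otimes> Ide C A \<Zsemi> f \<Zsemi> h \<otimes> Ide C B) | T h k. h \<in> hom C S T \<and> inverse_arrows C h k}"

definition st_arrow :: "'o \<Rightarrow> 'o \<Rightarrow> 'o \<Rightarrow> 'm \<Rightarrow> ('o, 'm) st_arrow" where
  "st_arrow A B S f = (A, st_class A B S f, B)"

text \<open>The stateless process on \<open>f : A \<rightarrow> B\<close>.\<close>

definition st_of :: "'m \<Rightarrow> ('o, 'm) st_arrow" where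
  "st_of f = st_arrow (Dom C f) (Cod C f) (Unit C) (Ide C (Unit C) \<otimes> f)"

text \<open>\<open>(S \<odot> T) \<odot> A \<rightarrow> (S \<odot> T) \<odot> D\<close>: first \<open>f : S \<odot> A \<rightarrow> S \<odot> B\<close>, then \<open>g : T \<odot> B \<rightarrow> T \<odot> D\<close>.\<close>

definition st_seq :: "'o \<Rightarrow> 'o \<Rightarrow> 'o \<Rightarrow> 'o \<Rightarrow> 'o \<Rightarrow> 'm \<Rightarrow> 'm \<Rightarrow> 'm" where
  "st_seq A B D S T f g =
     Sym C S T \<otimes> Ide C A \<Zsemi> Assoc C T S A
     \<Zsemi> Ide C T \<otimes> f
     \<Zsemi> inv_arrow C (Assoc C T S B) \<Zsemi> Sym C T S \<otimes> Ide C B \<Zsemi> Assoc C S T B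
     \<Zsemi> Ide C S \<otimes> g
     \<Zsemi> inv_arrow C (Assoc C S T D)"

definition st_comp ::
    "('o, 'm) st_arrow \<Rightarrow> ('o, 'm) st_arrow \<Rightarrow> ('o, 'm) st_arrow" where
  "st_comp = (\<lambda>(A, X, B) (B', Y, D).
     (A, \<Union>{st_class A D (S \<odot> T) (st_seq A B D S T f g) | S f T g. (S, f) \<in> X \<and> (T, g) \<in> Y}, D))"

text \<open>The interchange \<open>id \<otimes> \<sigma> \<otimes> id : (P \<odot> Q) \<odot> (R \<odot> T) \<rightarrow> (P \<odot> R) \<odot> (Q \<odot> T)\<close>.\<close>

definition middle_swap :: "'o \<Rightarrow> 'o \<Rightarrow> 'o \<Rightarrow> 'o \<Rightarrow> 'm" where
  "middle_swap P Q R T =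
     Assoc C P Q (R \<odot> T)
     \<Zsemi> Ide C P \<otimes> (inv_arrow C (Assoc C Q R T) \<Zsemi> Sym C Q R \<otimes> Ide C T \<Zsemi> Assoc C R Q T)
     \<Zsemi> inv_arrow C (Assoc C P R (Q \<odot> T))"

definition st_tensor ::
    "('o, 'm) st_arrow \<Rightarrow> ('o, 'm) st_arrow \<Rightarrow> ('o, 'm) st_arrow" where
  "st_tensor = (\<lambda>(A, X, B) (A', Y, B').
     (A \<odot> A',
      \<Union>{st_class (A \<odot> A') (B \<odot> B') (S \<odot> S')
           (middle_swap S S' A A' \<Zsemi> f \<otimes> f' \<Zsemi> middle_swap S B S' B') | S f S' f'.
           (S, f) \<in> X \<and> (S', f') \<in> Y},
      B \<odot> B'))"

definition St :: "('o, ('o, 'm) st_arrow) smcat" where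
  "St =
     \<lparr>Ob = Ob C,
      Ar = {st_arrow A B S f | A B S f.
              A \<in> Ob C \<and> B \<in> Ob C \<and> S \<in> Ob C \<and> f \<in> hom C (S \<odot> A) (S \<odot> B)},
      Dom = (\<lambda>(A, X, B). A),
      Cod = (\<lambda>(A, X, B). B),
      Ide = (\<lambda>A. st_arrow A A (Unit C) (Ide C (Unit C \<odot> A))),
      Comp = st_comp,
      Unit = Unit C,
      TensorOb = TensorOb C,
      TensorAr = st_tensor,
      Assoc = (\<lambda>A B D. st_of (Assoc C A B D)),
      LUnit = (\<lambda>A. st_of (LUnit C A)),
      RUnit = (\<lambda>A. st_of (RUnit C A)),
      Sym = (\<lambda>A B. st_of (Sym C A B))\<rparr>"

end

section \<open>Sets and graphs\<close>

text \<open>HOL has no type of all sets, so \<open>Set\<close> is taken relative to a collection of small sets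
  closed under subsets and, up to bijection, under binary disjoint unions; hence it has
  all finite colimits. Besides the power set of an infinite type (see below), the extensions of
  the elements of a type of ZF sets form such a collection.\<close>

definition set_universe :: "'a set set \<Rightarrow> bool" where
  "set_universe U \<longleftrightarrow>
     U \<noteq> {} \<and>
     (\<forall>X\<in>U. \<forall>Y. Y \<subseteq> X \<longrightarrow> Y \<in> U) \<and>
     (\<forall>X\<in>U. \<forall>Y\<in>U. \<exists>Z\<in>U. \<exists>\<phi>. bij_betw \<phi> (X <+> Y) Z)"

lemma set_universe_UNIV:
  assumes "infinite (UNIV :: 'a set)"
  shows "set_universe (UNIV :: 'a set set)"
proof -
  have "(card_of (UNIV <+> UNIV :: ('a + 'a) set), card_of (UNIV :: 'a set)) \<in> ordLeq"
    using card_of_Plus_infinite1[OF assms card_of_refl[THEN ordIso_imp_ordLeq]]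
    by (rule ordIso_imp_ordLeq)
  then obtain \<phi> :: "'a + 'a \<Rightarrow> 'a" where "inj \<phi>"
    unfolding card_of_ordLeq[symmetric] by auto
  then have "bij_betw \<phi> (X <+> Y) (\<phi> ` (X <+> Y))" for X Y
    by (meson bij_betw_imageI inj_on_subset subset_UNIV)
  then show ?thesis
    unfolding set_universe_def by blast
qed

text \<open>Functions are extensional, so that arrows are determined by their values on the domain.\<close>

type_synonym 'a set_arrow = "'a set \<times> ('a \<Rightarrow> 'a) \<times> 'a set"

definition Set_cat :: "'a set set \<Rightarrow> ('a set, 'a set_arrow) cat" where
  "Set_cat U =
     \<lparr>Ob = U,
      Ar = {(A, f, B). A \<in> U \<and> B \<in> U \<and> f \<in> A \<rightarrow>\<^sub>E B},
      Dom = (\<lambda>(A, f, B). A),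
      Cod = (\<lambda>(A, f, B). B),
      Ide = (\<lambda>A. (A, \<lambda>x\<in>A. x, A)),
      Comp = (\<lambda>(A, f, B) (B', g, D). (A, compose A g f, D))\<rparr>"

record 'a graph =
  edges :: "'a set"
  verts :: "'a set"
  src :: "'a \<Rightarrow> 'a"
  tgt :: "'a \<Rightarrow> 'a"

type_synonym 'a graph_arrow = "'a graph \<times> (('a \<Rightarrow> 'a) \<times> ('a \<Rightarrow> 'a)) \<times> 'a graph"

definition graphs :: "'a set set \<Rightarrow> 'a graph set" where
  "graphs U = {G. edges G \<in> U \<and> verts G \<in> U \<and>
                  src G \<in> edges G \<rightarrow>\<^sub>E verts G \<and> tgt G \<in> edges G \<rightarrow>\<^sub>E verts G}"

definition graph_morphisms :: "'a graph \<Rightarrow> 'a graph \<Rightarrow> (('a \<Rightarrow> 'a) \<times> ('a \<Rightarrow> 'a)) set" where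
  "graph_morphisms G H =
     {(e, v). e \<in> edges G \<rightarrow>\<^sub>E edges H \<and> v \<in> verts G \<rightarrow>\<^sub>E verts H \<and>
              (\<forall>x\<in>edges G. src H (e x) = v (src G x) \<and> tgt H (e x) = v (tgt G x))}"

definition Graph_cat :: "'a set set \<Rightarrow> ('a graph, 'a graph_arrow) cat" where
  "Graph_cat U =
     \<lparr>Ob = graphs U,
      Ar = {(G, m, H). G \<in> graphs U \<and> H \<in> graphs U \<and> m \<in> graph_morphisms G H},
      Dom = (\<lambda>(G, m, H). G),
      Cod = (\<lambda>(G, m, H). H),
      Ide = (\<lambda>G. (G, (\<lambda>x\<in>edges G. x, \<lambda>x\<in>verts G. x), G)),
      Comp = (\<lambda>(G, (e, v), H) (H', (e', v'), K).
                (G, (compose (edges G) e' e, compose (verts G) v' v), K))\<rparr>"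

definition discrete :: "'a graph \<Rightarrow> bool" where
  "discrete G \<longleftrightarrow> edges G = {}"

end

theory Submission
  imports Defs
begin

text \<open>
  A stateful process \<open>S \<odot> A \<rightarrow> S \<odot> B\<close> in cospans of sets is a cospan \<open>S + A \<rightarrow> V \<leftarrow> S + B\<close>, that is, a
  quadruple of functions \<open>s, t : S \<rightarrow> V\<close>, \<open>a : A \<rightarrow> V\<close>, \<open>b : B \<rightarrow> V\<close>. Read \<open>s, t\<close> as a graph with
  edges \<open>S\<close>; since a morphism from a discrete graph is a function into the vertices, \<open>a\<close> and \<open>b\<close> are the
  legs of a cospan of graphs between the discrete graphs on \<open>A\<close> and \<open>B\<close>. An isomorphism in the category of
  cospans is an isomorphism of the base category, so both hom-sets are the set of these quadruples modulo
  renaming of \<open>S\<close> and \<open>V\<close>. Both compositions take the pushout of \<open>V\<close> and \<open>V'\<close> over \<open>B\<close> and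
  the coproduct of the state spaces, because the pushout of graphs over a discrete one is the coproduct on
  edges; both tensors are componentwise coproducts. Only finite colimits of the base category are used.
\<close>

section \<open>Categories\<close>

text \<open>No tensor here is strict, so \<open>st_comp\<close> and \<open>st_tensor\<close> are
  full of associators and inverse associators. They are eliminated once, by computing composition
  and tensor of processes directly on quadruples (\<open>st_comp_process\<close>,
  \<open>st_tensor_process\<close>); later laws are then checked in \<open>C\<close>, by naming a
  renaming of states and a renaming of apexes.

  The second obstacle is that the coproducts of the base category and those of graphs are picked
  independently. The functor is therefore strong and not strict, and even the closure of discrete
  graphs under the tensor of graphs needs an argument: the chosen coproduct of two discrete graphs
  is only known up to isomorphism, so discreteness must be invariant under isomorphism. Bijectivity
  on objects, on the other hand, asks for an edge object equal, and not just isomorphic, to the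
  chosen initial object. The two demands are reconciled by \<open>initial_unique\<close>, which
  holds for sets because the empty set is the only initial one.\<close>

context category
begin

lemma in_homD:
  assumes "f \<in> hom C A B"
  shows "f \<in> Ar C" "Dom C f = A" "Cod C f = B" "A \<in> Ob C" "B \<in> Ob C"
  using assms Dom_in_Ob Cod_in_Ob by (auto simp: hom_def)

lemma hom_iff: "f \<in> hom C A B \<longleftrightarrow> f \<in> Ar C \<and> Dom C f = A \<and> Cod C f = B"
  by (simp add: hom_def)

lemma Dom_Ob [simp]: "f \<in> Ar C \<Longrightarrow> Dom C f \<in> Ob C"
  and Cod_Ob [simp]: "f \<in> Ar C \<Longrightarrow> Cod C f \<in> Ob C"
  by (fact Dom_in_Ob Cod_in_Ob)+

lemma Ide_simps [simp]:
  assumes "A \<in> Ob C"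
  shows "Ide C A \<in> Ar C" "Dom C (Ide C A) = A" "Cod C (Ide C A) = A"
  using Ide_in_hom[OF assms] by (auto simp: hom_def)

lemma Comp_simps [simp]:
  assumes "f \<in> Ar C" "g \<in> Ar C" "Cod C f = Dom C g"
  shows "f \<Zsemi> g \<in> Ar C" "Dom C (f \<Zsemi> g) = Dom C f" "Cod C (f \<Zsemi> g) = Cod C g"
  using Comp_in_hom[of f "Dom C f" "Cod C f" g "Cod C g"] assms by (auto simp: hom_def)

lemma Ide_Comp' [simp]: "\<lbrakk>f \<in> Ar C; Dom C f = A\<rbrakk> \<Longrightarrow> Ide C A \<Zsemi> f = f"
  by (rule Ide_Comp) (simp add: hom_def)

lemma Comp_Ide' [simp]: "\<lbrakk>f \<in> Ar C; Cod C f = B\<rbrakk> \<Longrightarrow> f \<Zsemi> Ide C B = f"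
  by (rule Comp_Ide) (simp add: hom_def)

lemma Comp_assoc' [simp]:
  "\<lbrakk>f \<in> Ar C; g \<in> Ar C; h \<in> Ar C; Cod C f = Dom C g; Cod C g = Dom C h\<rbrakk>
    \<Longrightarrow> (f \<Zsemi> g) \<Zsemi> h = f \<Zsemi> (g \<Zsemi> h)"
  by (rule Comp_assoc) (auto simp: hom_def)

text \<open>Composites are simplified to right-nested form, where a known equation for
  \<open>f \<Zsemi> g\<close> no longer occurs as a subterm of
  \<open>f \<Zsemi> (g \<Zsemi> h)\<close>; this version matches there.\<close>

lemma Comp_reassoc:
  "\<lbrakk>f \<Zsemi> g = k; f \<in> Ar C; g \<in> Ar C; h \<in> Ar C; Cod C f = Dom C g; Cod C g = Dom C h\<rbrakk>
    \<Longrightarrow> f \<Zsemi> (g \<Zsemi> h) = k \<Zsemi> h"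
  using Comp_assoc' by metis

lemma Comp_reassoc2:
  "\<lbrakk>f \<Zsemi> g = k \<Zsemi> l; f \<in> Ar C; g \<in> Ar C; h \<in> Ar C; Cod C f = Dom C g; Cod C g = Dom C h;
    k \<in> Ar C; l \<in> Ar C; Cod C k = Dom C l; Cod C l = Dom C h\<rbrakk>
    \<Longrightarrow> f \<Zsemi> (g \<Zsemi> h) = k \<Zsemi> (l \<Zsemi> h)"
  using Comp_assoc' by metis

lemma inverse_arrows_iff:
  "inverse_arrows C f g \<longleftrightarrow> f \<in> Ar C \<and> g \<in> Ar C \<and> Dom C g = Cod C f \<and> Cod C g = Dom C f \<and>
     f \<Zsemi> g = Ide C (Dom C f) \<and> g \<Zsemi> f = Ide C (Cod C f)"
  by (auto simp: inverse_arrows_def hom_def)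

lemma inverse_arrows_sym: "inverse_arrows C f g \<Longrightarrow> inverse_arrows C g f"
  by (simp add: inverse_arrows_iff)

lemma inverse_arrows_unique:
  assumes "inverse_arrows C f g" "inverse_arrows C f h"
  shows "g = h"
proof -
  have "g = g \<Zsemi> (f \<Zsemi> h)"
    using assms by (simp add: inverse_arrows_iff)
  also have "\<dots> = (g \<Zsemi> f) \<Zsemi> h"
    using assms unfolding inverse_arrows_iff by (intro Comp_assoc'[symmetric]) auto
  also have "\<dots> = h"
    using assms by (simp add: inverse_arrows_iff)
  finally show ?thesis .
qed

lemma inv_arrow_eq: "inverse_arrows C f g \<Longrightarrow> inv_arrow C f = g"
  unfolding inv_arrow_def using inverse_arrows_unique by blast

lemma isoI: "inverse_arrows C f g \<Longrightarrow> iso C f"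
  by (auto simp: iso_def)

lemma iso_inverse_arrows: "iso C f \<Longrightarrow> inverse_arrows C f (inv_arrow C f)"
  using inv_arrow_eq by (auto simp: iso_def)

lemma iso_simps [simp]:
  assumes "iso C f"
  shows "f \<in> Ar C" "inv_arrow C f \<in> Ar C" "Dom C (inv_arrow C f) = Cod C f"
    "Cod C (inv_arrow C f) = Dom C f" "f \<Zsemi> inv_arrow C f = Ide C (Dom C f)"
    "inv_arrow C f \<Zsemi> f = Ide C (Cod C f)" "iso C (inv_arrow C f)"
    "inv_arrow C (inv_arrow C f) = f"
  using iso_inverse_arrows[OF assms] inverse_arrows_sym[OF iso_inverse_arrows[OF assms]]
  by (auto simp: inverse_arrows_iff iso_def intro: inv_arrow_eq)

lemma iso_cancel [simp]:
  assumes "iso C f" "g \<in> Ar C"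
  shows "Dom C g = Dom C f \<Longrightarrow> f \<Zsemi> (inv_arrow C f \<Zsemi> g) = g"
    and "Dom C g = Cod C f \<Longrightarrow> inv_arrow C f \<Zsemi> (f \<Zsemi> g) = g"
  using Comp_reassoc[OF iso_simps(5)[OF assms(1)]] Comp_reassoc[OF iso_simps(6)[OF assms(1)]] assms
  by auto

lemma inverse_arrows_Ide [simp]: "A \<in> Ob C \<Longrightarrow> inverse_arrows C (Ide C A) (Ide C A)"
  by (simp add: inverse_arrows_iff)

lemma iso_Ide [simp]: "A \<in> Ob C \<Longrightarrow> iso C (Ide C A)"
  by (rule isoI[OF inverse_arrows_Ide])

lemma inv_arrow_Ide [simp]: "A \<in> Ob C \<Longrightarrow> inv_arrow C (Ide C A) = Ide C A"
  by (rule inv_arrow_eq) simp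

lemma inverse_arrows_Comp:
  assumes "iso C f" "iso C g" "Cod C f = Dom C g"
  shows "inverse_arrows C (f \<Zsemi> g) (inv_arrow C g \<Zsemi> inv_arrow C f)"
  using assms by (simp add: inverse_arrows_iff)

lemma iso_Comp [simp]: "\<lbrakk>iso C f; iso C g; Cod C f = Dom C g\<rbrakk> \<Longrightarrow> iso C (f \<Zsemi> g)"
  by (rule isoI[OF inverse_arrows_Comp])

lemma iso_cancel_left:
  assumes "iso C f" "f \<Zsemi> g = f \<Zsemi> h" "g \<in> Ar C" "h \<in> Ar C" "Dom C g = Cod C f"
    "Dom C h = Cod C f"
  shows "g = h"
  using iso_cancel(2)[OF assms(1)] assms by metis

text \<open>A one-sided inverse on each side suffices since \<open>h\<close> and \<open>g\<close>
  both equal \<open>h \<Zsemi> f \<Zsemi> g\<close>; the missing types of \<open>g\<close> and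
  \<open>h\<close> are read off from the two equations.\<close>

lemma isoI_split:
  assumes "f \<in> Ar C" "g \<in> Ar C" "h \<in> Ar C" "Dom C g = Cod C f" "Cod C h = Dom C f"
    "f \<Zsemi> g = Ide C (Dom C f)" "h \<Zsemi> f = Ide C (Cod C f)"
  shows "iso C f"
proof -
  have "Cod C (f \<Zsemi> g) = Cod C g" "Dom C (h \<Zsemi> f) = Dom C h"
    using assms(1-5) by simp_all
  then have t: "Cod C g = Dom C f" "Dom C h = Cod C f"
    unfolding assms(6,7) using assms(1) by auto
  have "h = h \<Zsemi> (f \<Zsemi> g)"
    using assms t by simp
  also have "\<dots> = (h \<Zsemi> f) \<Zsemi> g"
    using assms(1-5) t by (intro Comp_assoc'[symmetric]) auto
  also have "\<dots> = g"
    using assms t by simp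
  finally show ?thesis
    using assms t by (intro isoI[of f g]) (simp add: inverse_arrows_iff)
qed

lemma iso_left_factor:
  assumes "iso C (f \<Zsemi> g)" "iso C g" "f \<in> Ar C" "Cod C f = Dom C g"
  shows "iso C f"
proof -
  have "f = (f \<Zsemi> g) \<Zsemi> inv_arrow C g"
    using assms(2-) by simp
  then show ?thesis
    using assms iso_Comp[of "f \<Zsemi> g" "inv_arrow C g"] by simp
qed

section \<open>Colimits\<close>

text \<open>Quantifying over arrows with matching domains and codomains instead of over hom-sets
  lets the simplifier type-check diagrams with the rules for \<open>Dom\<close> and
  \<open>Cod\<close>.\<close>

lemma Ball_cocones:
  "(\<forall>X\<in>Ob C. \<forall>f\<in>hom C A X. \<forall>g\<in>hom C B X. Q X f g) \<longleftrightarrow>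
     (\<forall>f g. f \<in> Ar C \<and> g \<in> Ar C \<and> Dom C f = A \<and> Dom C g = B \<and> Cod C f = Cod C g \<longrightarrow> Q (Cod C f) f g)"
  unfolding Ball_def hom_iff using Cod_Ob by metis

lemma is_coproduct_iff:
  "is_coproduct C A B P i j \<longleftrightarrow>
     i \<in> Ar C \<and> Dom C i = A \<and> Cod C i = P \<and> j \<in> Ar C \<and> Dom C j = B \<and> Cod C j = P \<and>
     (\<forall>f g. f \<in> Ar C \<and> g \<in> Ar C \<and> Dom C f = A \<and> Dom C g = B \<and> Cod C f = Cod C g \<longrightarrow>
        (\<exists>!h. h \<in> Ar C \<and> Dom C h = P \<and> Cod C h = Cod C f \<and> i \<Zsemi> h = f \<and> j \<Zsemi> h = g))"
  unfolding is_coproduct_def Ball_cocones hom_iff by simp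

lemma is_pushout_iff:
  "is_pushout C f g p q \<longleftrightarrow>
     f \<in> Ar C \<and> g \<in> Ar C \<and> Dom C f = Dom C g \<and> p \<in> Ar C \<and> Dom C p = Cod C f \<and>
     q \<in> Ar C \<and> Dom C q = Cod C g \<and> Cod C q = Cod C p \<and> f \<Zsemi> p = g \<Zsemi> q \<and>
     (\<forall>u v. u \<in> Ar C \<and> v \<in> Ar C \<and> Dom C u = Cod C f \<and> Dom C v = Cod C g \<and> Cod C u = Cod C v \<longrightarrow>
        f \<Zsemi> u = g \<Zsemi> v \<longrightarrow>
        (\<exists>!h. h \<in> Ar C \<and> Dom C h = Cod C p \<and> Cod C h = Cod C u \<and> p \<Zsemi> h = u \<and> q \<Zsemi> h = v))"
  unfolding is_pushout_def Ball_cocones hom_iff by simp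

lemma is_pushout_simps:
  assumes "is_pushout C f g p q"
  shows "f \<in> Ar C" "g \<in> Ar C" "p \<in> Ar C" "q \<in> Ar C" "Dom C g = Dom C f"
    "Dom C p = Cod C f" "Dom C q = Cod C g" "Cod C q = Cod C p" "f \<Zsemi> p = g \<Zsemi> q"
  using assms by (auto simp: is_pushout_iff)

lemma is_pushout_ex1:
  assumes "is_pushout C f g p q" "u \<in> Ar C" "v \<in> Ar C" "Dom C u = Cod C f" "Dom C v = Cod C g"
    "Cod C u = Cod C v" "f \<Zsemi> u = g \<Zsemi> v"
  shows "\<exists>!h. h \<in> Ar C \<and> Dom C h = Cod C p \<and> Cod C h = Cod C u \<and> p \<Zsemi> h = u \<and> q \<Zsemi> h = v"
  using assms(1)[unfolded is_pushout_iff] assms(2-) by blast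

lemma is_pushout_ex:
  assumes "is_pushout C f g p q" "u \<in> Ar C" "v \<in> Ar C" "Dom C u = Cod C f" "Dom C v = Cod C g"
    "Cod C u = Cod C v" "f \<Zsemi> u = g \<Zsemi> v"
  obtains h where "h \<in> Ar C" "Dom C h = Cod C p" "Cod C h = Cod C u" "p \<Zsemi> h = u" "q \<Zsemi> h = v"
  using is_pushout_ex1[OF assms] that by blast

text \<open>The legs of a pushout are jointly epic: \<open>h\<close> and \<open>k\<close> both
  mediate the cocone \<open>p \<Zsemi> h\<close>, \<open>q \<Zsemi> h\<close>.\<close>

lemma is_pushout_eqI:
  assumes P: "is_pushout C f g p q" and h: "h \<in> Ar C" "Dom C h = Cod C p" and
    k: "k \<in> Ar C" "Dom C k = Cod C p" and eq: "Cod C h = Cod C k" "p \<Zsemi> h = p \<Zsemi> k"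
      "q \<Zsemi> h = q \<Zsemi> k"
  shows "h = k"
proof -
  note s = is_pushout_simps[OF P]
  have "f \<Zsemi> (p \<Zsemi> h) = g \<Zsemi> (q \<Zsemi> h)"
    using Comp_reassoc2[OF s(9)] s h by simp
  then have "\<exists>!l. l \<in> Ar C \<and> Dom C l = Cod C p \<and> Cod C l = Cod C (p \<Zsemi> h) \<and> p \<Zsemi> l = p \<Zsemi> h \<and> q \<Zsemi> l = q \<Zsemi> h"
    by (intro is_pushout_ex1[OF P]) (use h s in simp_all)
  moreover have "Cod C (p \<Zsemi> h) = Cod C h"
    using s h by simp
  ultimately show ?thesis
    using h k eq by metis
qed

lemma is_pushoutI:
  assumes "f \<in> Ar C" "g \<in> Ar C" "p \<in> Ar C" "q \<in> Ar C" "Dom C g = Dom C f"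
    "Dom C p = Cod C f" "Dom C q = Cod C g" "Cod C q = Cod C p" "f \<Zsemi> p = g \<Zsemi> q"
    and ex: "\<And>u v. \<lbrakk>u \<in> Ar C; v \<in> Ar C; Dom C u = Cod C f; Dom C v = Cod C g; Cod C u = Cod C v;
      f \<Zsemi> u = g \<Zsemi> v\<rbrakk> \<Longrightarrow> \<exists>h. h \<in> Ar C \<and> Dom C h = Cod C p \<and> Cod C h = Cod C u \<and> p \<Zsemi> h = u \<and> q \<Zsemi> h = v"
    and uniq: "\<And>h k. \<lbrakk>h \<in> Ar C; k \<in> Ar C; Dom C h = Cod C p; Dom C k = Cod C p; Cod C h = Cod C k;
      p \<Zsemi> h = p \<Zsemi> k; q \<Zsemi> h = q \<Zsemi> k\<rbrakk> \<Longrightarrow> h = k"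
  shows "is_pushout C f g p q"
  unfolding is_pushout_iff
proof (intro conjI allI impI)
  fix u v
  assume uv: "u \<in> Ar C \<and> v \<in> Ar C \<and> Dom C u = Cod C f \<and> Dom C v = Cod C g \<and> Cod C u = Cod C v"
    "f \<Zsemi> u = g \<Zsemi> v"
  then obtain h where "h \<in> Ar C \<and> Dom C h = Cod C p \<and> Cod C h = Cod C u \<and> p \<Zsemi> h = u \<and> q \<Zsemi> h = v"
    using ex by blast
  then show "\<exists>!h. h \<in> Ar C \<and> Dom C h = Cod C p \<and> Cod C h = Cod C u \<and> p \<Zsemi> h = u \<and> q \<Zsemi> h = v"
    using uniq by (intro ex1I[of _ h]) auto
qed (use assms in auto)

lemma is_pushout_sym:
  assumes "is_pushout C f g p q"
  shows "is_pushout C g f q p"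
proof (rule is_pushoutI)
  fix u v
  assume "u \<in> Ar C" "v \<in> Ar C" "Dom C u = Cod C g" "Dom C v = Cod C f" "Cod C u = Cod C v"
    "g \<Zsemi> u = f \<Zsemi> v"
  then obtain h where "h \<in> Ar C" "Dom C h = Cod C p" "Cod C h = Cod C v" "p \<Zsemi> h = v"
    "q \<Zsemi> h = u"
    using is_pushout_ex[OF assms, of v u] by metis
  then show "\<exists>h. h \<in> Ar C \<and> Dom C h = Cod C q \<and> Cod C h = Cod C u \<and> q \<Zsemi> h = u \<and> p \<Zsemi> h = v"
    using \<open>Cod C u = Cod C v\<close> is_pushout_simps(8)[OF assms] by (intro exI[of _ h]) simp
next
  fix h k
  assume "h \<in> Ar C" "k \<in> Ar C" "Dom C h = Cod C q" "Dom C k = Cod C q" "Cod C h = Cod C k"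
    "q \<Zsemi> h = q \<Zsemi> k" "p \<Zsemi> h = p \<Zsemi> k"
  then show "h = k"
    using is_pushout_simps(8)[OF assms] is_pushout_eqI[OF assms, of h k] by simp
qed (use is_pushout_simps[OF assms] in simp_all)

lemma is_pushout_unique:
  assumes P: "is_pushout C f g p q" and Q: "is_pushout C f g p' q'"
  obtains h where "iso C h" "Dom C h = Cod C p" "Cod C h = Cod C p'" "p \<Zsemi> h = p'" "q \<Zsemi> h = q'"
proof -
  note s = is_pushout_simps[OF P] is_pushout_simps[OF Q]
  obtain h where h: "h \<in> Ar C" "Dom C h = Cod C p" "Cod C h = Cod C p'" "p \<Zsemi> h = p'"
    "q \<Zsemi> h = q'"
    by (rule is_pushout_ex[OF P, of p' q']) (use s in auto)
  obtain k where k: "k \<in> Ar C" "Dom C k = Cod C p'" "Cod C k = Cod C p" "p' \<Zsemi> k = p"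
    "q' \<Zsemi> k = q"
    by (rule is_pushout_ex[OF Q, of p q]) (use s in auto)
  have "h \<Zsemi> k = Ide C (Cod C p)"
    by (rule is_pushout_eqI[OF P])
      (use s h k Comp_reassoc[OF h(4), of k] Comp_reassoc[OF h(5), of k] in auto)
  moreover have "k \<Zsemi> h = Ide C (Cod C p')"
    by (rule is_pushout_eqI[OF Q])
      (use s h k Comp_reassoc[OF k(4), of h] Comp_reassoc[OF k(5), of h] in auto)
  ultimately have "inverse_arrows C h k"
    using h k by (simp add: inverse_arrows_iff)
  then show ?thesis
    using that h isoI by blast
qed

text \<open>Passing to other representatives of two cospans moves their inner legs along apex
  isomorphisms \<open>h\<close> and \<open>k\<close>. A pushout of the moved legs is carried back to
  one of the original legs, so that the two can be compared.\<close>

lemma is_pushout_iso_feet: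
  assumes P: "is_pushout C (f \<Zsemi> h) (g \<Zsemi> k) p q" and fg: "f \<in> Ar C" "g \<in> Ar C" and
    hk: "iso C h" "iso C k" "Dom C h = Cod C f" "Dom C k = Cod C g"
  shows "is_pushout C f g (h \<Zsemi> p) (k \<Zsemi> q)"
proof -
  note s = is_pushout_simps[OF P] hk fg
  have sq: "f \<Zsemi> (h \<Zsemi> p) = g \<Zsemi> (k \<Zsemi> q)"
    using s(9) s by simp
  show ?thesis
  proof (rule is_pushoutI)
    fix u v
    assume a: "u \<in> Ar C" "v \<in> Ar C" "Dom C u = Cod C f" "Dom C v = Cod C g" "Cod C u = Cod C v"
      "f \<Zsemi> u = g \<Zsemi> v"
    obtain l where "l \<in> Ar C" "Dom C l = Cod C p" "Cod C l = Cod C (inv_arrow C h \<Zsemi> u)"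
      "p \<Zsemi> l = inv_arrow C h \<Zsemi> u" "q \<Zsemi> l = inv_arrow C k \<Zsemi> v"
      by (rule is_pushout_ex[OF P, of "inv_arrow C h \<Zsemi> u"
        "inv_arrow C k \<Zsemi> v"]) (use a s in auto)
    then show "\<exists>l. l \<in> Ar C \<and> Dom C l = Cod C (h \<Zsemi> p) \<and> Cod C l = Cod C u \<and> (h \<Zsemi> p) \<Zsemi> l = u \<and> (k \<Zsemi> q) \<Zsemi> l = v"
      using s a by (intro exI[of _ l]) simp
  next
    fix l m
    assume a: "l \<in> Ar C" "m \<in> Ar C" "Dom C l = Cod C (h \<Zsemi> p)"
      "Dom C m = Cod C (h \<Zsemi> p)" "Cod C l = Cod C m"
      "(h \<Zsemi> p) \<Zsemi> l = (h \<Zsemi> p) \<Zsemi> m"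
        "(k \<Zsemi> q) \<Zsemi> l = (k \<Zsemi> q) \<Zsemi> m"
    have "p \<Zsemi> l = p \<Zsemi> m" "q \<Zsemi> l = q \<Zsemi> m"
      using iso_cancel_left[OF hk(1), of "p \<Zsemi> l"
        "p \<Zsemi> m"] iso_cancel_left[OF hk(2), of "q \<Zsemi> l" "q \<Zsemi> m"] a s
      by auto
    then show "l = m"
      using is_pushout_eqI[OF P, of l m] a s by simp
  qed (use s sq in auto)
qed

lemma is_pushout_Ide:
  assumes "f \<in> Ar C"
  shows "is_pushout C f (Ide C (Dom C f)) (Ide C (Cod C f)) f"
  using assms by (intro is_pushoutI) auto

text \<open>Pasting turns an iterated gluing into a single one; it is the source of associativity
  for cospans and for processes.\<close>

lemma is_pushout_paste:
  assumes P: "is_pushout C f g p q" and Q: "is_pushout C q k u v"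
  shows "is_pushout C f (g \<Zsemi> k) (p \<Zsemi> u) v"
proof -
  note s = is_pushout_simps[OF P] is_pushout_simps[OF Q]
  show ?thesis
  proof (rule is_pushoutI)
    show "f \<Zsemi> (p \<Zsemi> u) = (g \<Zsemi> k) \<Zsemi> v"
      using Comp_reassoc2[OF s(9)] s by simp
  next
    fix a b
    assume a: "a \<in> Ar C" "b \<in> Ar C" "Dom C a = Cod C f" "Dom C b = Cod C (g \<Zsemi> k)"
      "Cod C a = Cod C b"
      "f \<Zsemi> a = (g \<Zsemi> k) \<Zsemi> b"
    obtain m where m: "m \<in> Ar C" "Dom C m = Cod C p" "Cod C m = Cod C a" "p \<Zsemi> m = a"
      "q \<Zsemi> m = k \<Zsemi> b"
      by (rule is_pushout_ex[OF P, of a "k \<Zsemi> b"]) (use a s in auto)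
    obtain n where "n \<in> Ar C" "Dom C n = Cod C u" "Cod C n = Cod C m" "u \<Zsemi> n = m"
      "v \<Zsemi> n = b"
      by (rule is_pushout_ex[OF Q, of m b]) (use a s m in auto)
    then show "\<exists>n. n \<in> Ar C \<and> Dom C n = Cod C (p \<Zsemi> u) \<and> Cod C n = Cod C a \<and> (p \<Zsemi> u) \<Zsemi> n = a \<and> v \<Zsemi> n = b"
      using s m by (intro exI[of _ n]) simp
  next
    fix l m
    assume a: "l \<in> Ar C" "m \<in> Ar C" "Dom C l = Cod C (p \<Zsemi> u)"
      "Dom C m = Cod C (p \<Zsemi> u)" "Cod C l = Cod C m"
      "(p \<Zsemi> u) \<Zsemi> l = (p \<Zsemi> u) \<Zsemi> m" "v \<Zsemi> l = v \<Zsemi> m"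
    have "k \<Zsemi> (v \<Zsemi> l) = k \<Zsemi> (v \<Zsemi> m)"
      using a by simp
    then have "q \<Zsemi> (u \<Zsemi> l) = q \<Zsemi> (u \<Zsemi> m)"
      using Comp_reassoc2[OF s(18), of l] Comp_reassoc2[OF s(18), of m] s a by simp
    then have "u \<Zsemi> l = u \<Zsemi> m"
      using is_pushout_eqI[OF P, of "u \<Zsemi> l" "u \<Zsemi> m"] a s by simp
    then show "l = m"
      using is_pushout_eqI[OF Q, of l m] a s by simp
  qed (use s in auto)
qed

lemma is_coproduct_simps:
  assumes "is_coproduct C A B P i j"
  shows "i \<in> Ar C" "Dom C i = A" "Cod C i = P" "j \<in> Ar C" "Dom C j = B" "Cod C j = P"
  using assms by (auto simp: is_coproduct_iff)

lemma is_coproduct_ex1: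
  assumes "is_coproduct C A B P i j" "f \<in> Ar C" "g \<in> Ar C" "Dom C f = A" "Dom C g = B"
    "Cod C f = Cod C g"
  shows "\<exists>!h. h \<in> Ar C \<and> Dom C h = P \<and> Cod C h = Cod C f \<and> i \<Zsemi> h = f \<and> j \<Zsemi> h = g"
  using assms(1)[unfolded is_coproduct_iff] assms(2-) by blast

lemma is_coproduct_eqI:
  assumes P: "is_coproduct C A B P i j" and h: "h \<in> Ar C" "Dom C h = P" and k: "k \<in> Ar C"
    "Dom C k = P"
    and eq: "Cod C h = Cod C k" "i \<Zsemi> h = i \<Zsemi> k" "j \<Zsemi> h = j \<Zsemi> k"
  shows "h = k"
proof -
  have "\<exists>!l. l \<in> Ar C \<and> Dom C l = P \<and> Cod C l = Cod C (i \<Zsemi> h) \<and> i \<Zsemi> l = i \<Zsemi> h \<and> j \<Zsemi> l = j \<Zsemi> h"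
    by (intro is_coproduct_ex1[OF P]) (use h is_coproduct_simps[OF P] in simp_all)
  moreover have "Cod C (i \<Zsemi> h) = Cod C h"
    using h is_coproduct_simps[OF P] by simp
  ultimately show ?thesis
    using h k eq by metis
qed

lemma is_coproductI:
  assumes "i \<in> Ar C" "Dom C i = A" "Cod C i = P" "j \<in> Ar C" "Dom C j = B" "Cod C j = P"
    and ex: "\<And>f g. \<lbrakk>f \<in> Ar C; g \<in> Ar C; Dom C f = A; Dom C g = B; Cod C f = Cod C g\<rbrakk>
      \<Longrightarrow> \<exists>h. h \<in> Ar C \<and> Dom C h = P \<and> Cod C h = Cod C f \<and> i \<Zsemi> h = f \<and> j \<Zsemi> h = g"
    and uniq: "\<And>h k. \<lbrakk>h \<in> Ar C; k \<in> Ar C; Dom C h = P; Dom C k = P; Cod C h = Cod C k;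
      i \<Zsemi> h = i \<Zsemi> k; j \<Zsemi> h = j \<Zsemi> k\<rbrakk> \<Longrightarrow> h = k"
  shows "is_coproduct C A B P i j"
  unfolding is_coproduct_iff
proof (intro conjI allI impI)
  fix f g
  assume "f \<in> Ar C \<and> g \<in> Ar C \<and> Dom C f = A \<and> Dom C g = B \<and> Cod C f = Cod C g"
  then obtain h where "h \<in> Ar C \<and> Dom C h = P \<and> Cod C h = Cod C f \<and> i \<Zsemi> h = f \<and> j \<Zsemi> h = g"
    using ex by blast
  then show "\<exists>!h. h \<in> Ar C \<and> Dom C h = P \<and> Cod C h = Cod C f \<and> i \<Zsemi> h = f \<and> j \<Zsemi> h = g"
    using uniq by (intro ex1I[of _ h]) auto
qed (use assms in auto)

end

section \<open>Chosen finite colimits and the coherence maps of the coproduct\<close>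

locale finitely_cocomplete = category +
  assumes ex_initial: "\<exists>Z. is_initial C Z"
    and ex_coproduct: "\<lbrakk>A \<in> Ob C; B \<in> Ob C\<rbrakk> \<Longrightarrow> \<exists>P i j. is_coproduct C A B P i j"
    and ex_pushout: "\<lbrakk>f \<in> Ar C; g \<in> Ar C; Dom C f = Dom C g\<rbrakk> \<Longrightarrow> \<exists>p q. is_pushout C f g p q"
begin

lemma is_initial_initial_ob: "is_initial C (initial_ob C)"
  unfolding initial_ob_def using someI_ex[OF ex_initial] .

lemma initial_ob_in_Ob [simp]: "initial_ob C \<in> Ob C"
  using is_initial_initial_ob by (simp add: is_initial_def)

lemma from_initial_simps [simp]:
  assumes "A \<in> Ob C"
  shows "from_initial C A \<in> Ar C" "Dom C (from_initial C A) = initial_ob C" "Cod C (from_initial C A) = A"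
proof -
  have "\<exists>!f. f \<in> hom C (initial_ob C) A"
    using is_initial_initial_ob assms by (simp add: is_initial_def)
  then have "from_initial C A \<in> hom C (initial_ob C) A"
    unfolding from_initial_def by (rule theI')
  then show "from_initial C A \<in> Ar C" "Dom C (from_initial C A) = initial_ob C"
    "Cod C (from_initial C A) = A"
    by (simp_all add: hom_def)
qed

lemma from_initial_eqI:
  assumes "f \<in> Ar C" "g \<in> Ar C" "Dom C f = initial_ob C" "Dom C g = initial_ob C" "Cod C f = Cod C g"
  shows "f = g"
proof -
  have "\<exists>!f. f \<in> hom C (initial_ob C) (Cod C g)"
    using is_initial_initial_ob assms(2) by (simp add: is_initial_def)
  then show ?thesis
    using assms by (auto simp: hom_def)
qed

lemma from_initial_Comp [simp]:
  "f \<in> Ar C \<Longrightarrow> Dom C f = A \<Longrightarrow> from_initial C A \<Zsemi> f = from_initial C (Cod C f)"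
  by (rule from_initial_eqI) auto

lemma is_coproduct_coprod:
  assumes "A \<in> Ob C" "B \<in> Ob C"
  shows "is_coproduct C A B (coprod_ob C A B) (inj1 C A B) (inj2 C A B)"
proof -
  have "\<exists>x. case x of (P, i, j) \<Rightarrow> is_coproduct C A B P i j"
    using ex_coproduct[OF assms] by auto
  then have "case coproduct C A B of (P, i, j) \<Rightarrow> is_coproduct C A B P i j"
    unfolding coproduct_def by (rule someI_ex)
  then show ?thesis
    by (simp add: coprod_ob_def inj1_def inj2_def split_beta)
qed

lemma coprod_simps [simp]:
  assumes "A \<in> Ob C" "B \<in> Ob C"
  shows "coprod_ob C A B \<in> Ob C" "inj1 C A B \<in> Ar C" "inj2 C A B \<in> Ar C"
    "Dom C (inj1 C A B) = A" "Dom C (inj2 C A B) = B"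
    "Cod C (inj1 C A B) = coprod_ob C A B" "Cod C (inj2 C A B) = coprod_ob C A B"
  using is_coproduct_simps[OF is_coproduct_coprod[OF assms]] Cod_Ob by metis+

lemma copair_facts:
  assumes "f \<in> Ar C" "g \<in> Ar C" "Cod C f = Cod C g"
  shows "copair C f g \<in> Ar C \<and> Dom C (copair C f g) = coprod_ob C (Dom C f) (Dom C g) \<and>
    Cod C (copair C f g) = Cod C f \<and>
    inj1 C (Dom C f) (Dom C g) \<Zsemi> copair C f g = f \<and> inj2 C (Dom C f) (Dom C g) \<Zsemi> copair C f g = g"
proof -
  have "\<exists>!h. h \<in> Ar C \<and> Dom C h = coprod_ob C (Dom C f) (Dom C g) \<and> Cod C h = Cod C f \<and>
    inj1 C (Dom C f) (Dom C g) \<Zsemi> h = f \<and> inj2 C (Dom C f) (Dom C g) \<Zsemi> h = g"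
    by (rule is_coproduct_ex1[OF is_coproduct_coprod]) (use assms in auto)
  from theI'[OF this] show ?thesis
    unfolding copair_def hom_def by simp
qed

lemma copair_simps [simp]:
  assumes "f \<in> Ar C" "g \<in> Ar C" "Cod C f = Cod C g"
  shows "copair C f g \<in> Ar C" "Dom C (copair C f g) = coprod_ob C (Dom C f) (Dom C g)"
    "Cod C (copair C f g) = Cod C f"
    "\<lbrakk>Dom C f = A; Dom C g = B\<rbrakk> \<Longrightarrow> inj1 C A B \<Zsemi> copair C f g = f"
    "\<lbrakk>Dom C f = A; Dom C g = B\<rbrakk> \<Longrightarrow> inj2 C A B \<Zsemi> copair C f g = g"
  using copair_facts[OF assms] by auto

lemma copair_reassoc [simp]:
  assumes "f \<in> Ar C" "g \<in> Ar C" "Cod C f = Cod C g" "h \<in> Ar C" "Dom C h = Cod C f"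
    "Dom C f = A" "Dom C g = B"
  shows "inj1 C A B \<Zsemi> (copair C f g \<Zsemi> h) = f \<Zsemi> h"
    "inj2 C A B \<Zsemi> (copair C f g \<Zsemi> h) = g \<Zsemi> h"
  using assms Comp_reassoc[of "inj1 C A B" "copair C f g" f h] Comp_reassoc[of "inj2 C A B"
    "copair C f g" g h]
  by auto

lemma coprod_eqI:
  assumes "A \<in> Ob C" "B \<in> Ob C" "h \<in> Ar C" "k \<in> Ar C" "Dom C h = coprod_ob C A B"
    "Dom C k = coprod_ob C A B"
    "Cod C h = Cod C k" "inj1 C A B \<Zsemi> h = inj1 C A B \<Zsemi> k"
      "inj2 C A B \<Zsemi> h = inj2 C A B \<Zsemi> k"
  shows "h = k"
  using is_coproduct_eqI[OF is_coproduct_coprod[OF assms(1,2)]] assms(3-) by blast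

lemma copair_Comp [simp]:
  assumes "f \<in> Ar C" "g \<in> Ar C" "Cod C f = Cod C g" "h \<in> Ar C" "Dom C h = Cod C f"
  shows "copair C f g \<Zsemi> h = copair C (f \<Zsemi> h) (g \<Zsemi> h)"
  by (rule coprod_eqI[of "Dom C f" "Dom C g"]) (use assms in simp_all)

lemma copair_inj [simp]:
  "\<lbrakk>A \<in> Ob C; B \<in> Ob C\<rbrakk> \<Longrightarrow> copair C (inj1 C A B) (inj2 C A B) = Ide C (coprod_ob C A B)"
  by (rule coprod_eqI[of A B]) simp_all

lemma copair_inj_Comp [simp]:
  "\<lbrakk>A \<in> Ob C; B \<in> Ob C; h \<in> Ar C; Dom C h = coprod_ob C A B\<rbrakk>
    \<Longrightarrow> copair C (inj1 C A B \<Zsemi> h) (inj2 C A B \<Zsemi> h) = h"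
  by (rule coprod_eqI[of A B]) simp_all

lemma copair_eq_iff:
  assumes "f \<in> Ar C" "g \<in> Ar C" "Cod C f = Cod C g" "f' \<in> Ar C" "g' \<in> Ar C"
    "Cod C f' = Cod C g'"
    "Dom C f = Dom C f'" "Dom C g = Dom C g'"
  shows "copair C f g = copair C f' g' \<longleftrightarrow> f = f' \<and> g = g'"
  using copair_simps(4,5)[OF assms(1-3) refl refl] copair_simps(4,5)[OF assms(4-6) refl refl] assms(7,8)
  by metis

lemma coprod_ar_simps [simp]:
  assumes "f \<in> Ar C" "g \<in> Ar C"
  shows "coprod_ar C f g \<in> Ar C" "Dom C (coprod_ar C f g) = coprod_ob C (Dom C f) (Dom C g)"
    "Cod C (coprod_ar C f g) = coprod_ob C (Cod C f) (Cod C g)"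
    "\<lbrakk>Dom C f = A; Dom C g = B\<rbrakk> \<Longrightarrow> inj1 C A B \<Zsemi> coprod_ar C f g = f \<Zsemi> inj1 C (Cod C f) (Cod C g)"
    "\<lbrakk>Dom C f = A; Dom C g = B\<rbrakk> \<Longrightarrow> inj2 C A B \<Zsemi> coprod_ar C f g = g \<Zsemi> inj2 C (Cod C f) (Cod C g)"
  using assms by (auto simp: coprod_ar_def)

lemma coprod_ar_reassoc [simp]:
  assumes "f \<in> Ar C" "g \<in> Ar C" "h \<in> Ar C" "Dom C h = coprod_ob C (Cod C f) (Cod C g)"
    "Dom C f = A" "Dom C g = B"
  shows "inj1 C A B \<Zsemi> (coprod_ar C f g \<Zsemi> h) = f \<Zsemi> (inj1 C (Cod C f) (Cod C g) \<Zsemi> h)"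
    "inj2 C A B \<Zsemi> (coprod_ar C f g \<Zsemi> h) = g \<Zsemi> (inj2 C (Cod C f) (Cod C g) \<Zsemi> h)"
  using assms by (auto simp: coprod_ar_def)

lemma coprod_ar_copair [simp]:
  assumes "f \<in> Ar C" "g \<in> Ar C" "h \<in> Ar C" "k \<in> Ar C" "Dom C h = Cod C f"
    "Dom C k = Cod C g" "Cod C h = Cod C k"
  shows "coprod_ar C f g \<Zsemi> copair C h k = copair C (f \<Zsemi> h) (g \<Zsemi> k)"
  using assms by (simp add: coprod_ar_def)

lemma coprod_ar_Ide [simp]:
  "\<lbrakk>A \<in> Ob C; B \<in> Ob C\<rbrakk> \<Longrightarrow> coprod_ar C (Ide C A) (Ide C B) = Ide C (coprod_ob C A B)"
  by (simp add: coprod_ar_def)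

lemma coprod_ar_Comp:
  assumes "f \<in> Ar C" "g \<in> Ar C" "h \<in> Ar C" "k \<in> Ar C" "Dom C h = Cod C f" "Dom C k = Cod C g"
  shows "coprod_ar C f g \<Zsemi> coprod_ar C h k = coprod_ar C (f \<Zsemi> h) (g \<Zsemi> k)"
  using assms by (simp add: coprod_ar_def)

lemma inverse_arrows_coprod_ar:
  assumes "iso C f" "iso C g"
  shows "inverse_arrows C (coprod_ar C f g) (coprod_ar C (inv_arrow C f) (inv_arrow C g))"
  using assms by (simp add: inverse_arrows_iff coprod_ar_Comp)

lemma iso_coprod_ar [simp]: "\<lbrakk>iso C f; iso C g\<rbrakk> \<Longrightarrow> iso C (coprod_ar C f g)"
  by (rule isoI[OF inverse_arrows_coprod_ar])

lemma inv_coprod_ar [simp]: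
  "\<lbrakk>iso C f; iso C g\<rbrakk> \<Longrightarrow> inv_arrow C (coprod_ar C f g) = coprod_ar C (inv_arrow C f) (inv_arrow C g)"
  by (rule inv_arrow_eq[OF inverse_arrows_coprod_ar])

text \<open>Written out because \<open>inv_arrow\<close> is a definite description, whereas
  \<open>st_seq\<close> and \<open>middle_swap\<close> contain inverse associators that have to be
  computed on injections.\<close>

definition coprod_assoc_inv where
  "coprod_assoc_inv A B D =
     copair C (inj1 C A B \<Zsemi> inj1 C (coprod_ob C A B) D)
       (copair C (inj2 C A B \<Zsemi> inj1 C (coprod_ob C A B) D) (inj2 C (coprod_ob C A B) D))"

lemma coprod_assoc_simps [simp]:
  assumes "A \<in> Ob C" "B \<in> Ob C" "D \<in> Ob C"
  shows "coprod_assoc C A B D \<in> Ar C"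
    "Dom C (coprod_assoc C A B D) = coprod_ob C (coprod_ob C A B) D"
    "Cod C (coprod_assoc C A B D) = coprod_ob C A (coprod_ob C B D)"
  using assms by (simp_all add: coprod_assoc_def)

lemma inverse_arrows_coprod_assoc:
  assumes "A \<in> Ob C" "B \<in> Ob C" "D \<in> Ob C"
  shows "inverse_arrows C (coprod_assoc C A B D) (coprod_assoc_inv A B D)"
  using assms by (simp add: inverse_arrows_iff coprod_assoc_def coprod_assoc_inv_def)

lemma iso_coprod_assoc [simp]:
  "\<lbrakk>A \<in> Ob C; B \<in> Ob C; D \<in> Ob C\<rbrakk> \<Longrightarrow> iso C (coprod_assoc C A B D)"
  by (rule isoI[OF inverse_arrows_coprod_assoc])

lemma inv_coprod_assoc:
  "\<lbrakk>A \<in> Ob C; B \<in> Ob C; D \<in> Ob C\<rbrakk> \<Longrightarrow> inv_arrow C (coprod_assoc C A B D) = coprod_assoc_inv A B D"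
  by (rule inv_arrow_eq[OF inverse_arrows_coprod_assoc])

lemma inverse_arrows_left_unit:
  assumes "A \<in> Ob C"
  shows "inverse_arrows C (copair C (from_initial C A) (Ide C A)) (inj2 C (initial_ob C) A)"
proof -
  have "from_initial C (coprod_ob C (initial_ob C) A) = inj1 C (initial_ob C) A"
    by (rule from_initial_eqI) (use assms in simp_all)
  then show ?thesis
    using assms by (simp add: inverse_arrows_iff)
qed

lemma inverse_arrows_right_unit:
  assumes "A \<in> Ob C"
  shows "inverse_arrows C (copair C (Ide C A) (from_initial C A)) (inj1 C A (initial_ob C))"
proof -
  have "from_initial C (coprod_ob C A (initial_ob C)) = inj2 C A (initial_ob C)"
    by (rule from_initial_eqI) (use assms in simp_all)
  then show ?thesis
    using assms by (simp add: inverse_arrows_iff)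
qed

lemma inverse_arrows_coprod_swap:
  "\<lbrakk>A \<in> Ob C; B \<in> Ob C\<rbrakk> \<Longrightarrow>
    inverse_arrows C (copair C (inj2 C B A) (inj1 C B A)) (copair C (inj2 C A B) (inj1 C A B))"
  by (simp add: inverse_arrows_iff)

lemmas iso_structure [simp] =
  isoI[OF inverse_arrows_left_unit] isoI[OF inverse_arrows_right_unit] isoI[OF inverse_arrows_coprod_swap]

lemmas inv_structure =
  inv_arrow_eq[OF inverse_arrows_left_unit] inv_arrow_eq[OF inverse_arrows_right_unit]
  inv_arrow_eq[OF inverse_arrows_coprod_swap] inv_coprod_assoc

lemma coprod_assoc_natural:
  assumes "f \<in> Ar C" "g \<in> Ar C" "h \<in> Ar C"
  shows "coprod_ar C (coprod_ar C f g) h \<Zsemi> coprod_assoc C (Cod C f) (Cod C g) (Cod C h) =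
    coprod_assoc C (Dom C f) (Dom C g) (Dom C h) \<Zsemi> coprod_ar C f (coprod_ar C g h)"
  using assms by (simp add: coprod_assoc_def)

lemma coprod_pentagon:
  assumes "A \<in> Ob C" "B \<in> Ob C" "D \<in> Ob C" "E \<in> Ob C"
  shows "coprod_ar C (coprod_assoc C A B D) (Ide C E) \<Zsemi> (coprod_assoc C A (coprod_ob C B D) E \<Zsemi>
      coprod_ar C (Ide C A) (coprod_assoc C B D E)) =
    coprod_assoc C (coprod_ob C A B) D E \<Zsemi> coprod_assoc C A B (coprod_ob C D E)"
  using assms by (simp add: coprod_assoc_def)

lemma coprod_triangle:
  assumes "A \<in> Ob C" "B \<in> Ob C"
  shows "coprod_assoc C A (initial_ob C) B \<Zsemi> coprod_ar C (Ide C A) (copair C (from_initial C B) (Ide C B)) =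
    coprod_ar C (copair C (Ide C A) (from_initial C A)) (Ide C B)"
  using assms by (simp add: coprod_assoc_def coprod_ar_def)

lemma coprod_hexagon:
  assumes "A \<in> Ob C" "B \<in> Ob C" "D \<in> Ob C"
  shows "coprod_assoc C A B D \<Zsemi> (copair C (inj2 C (coprod_ob C B D) A) (inj1 C (coprod_ob C B D) A) \<Zsemi>
      coprod_assoc C B D A) =
    coprod_ar C (copair C (inj2 C B A) (inj1 C B A)) (Ide C D) \<Zsemi> (coprod_assoc C B A D \<Zsemi>
      coprod_ar C (Ide C B) (copair C (inj2 C D A) (inj1 C D A)))"
  using assms by (simp add: coprod_assoc_def)

text \<open>Colimits commute: a cocone on the summed span restricts along the injections to a cocone
  on each span, and the two mediating arrows are copaired. This yields the interchange law for the
  tensor.\<close>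

lemma is_pushout_coprod:
  assumes P: "is_pushout C f g p q" and Q: "is_pushout C f' g' p' q'"
  shows "is_pushout C (coprod_ar C f f') (coprod_ar C g g') (coprod_ar C p p') (coprod_ar C q q')"
proof -
  note s = is_pushout_simps[OF P] is_pushout_simps[OF Q]
  show ?thesis
  proof (rule is_pushoutI)
    show "coprod_ar C f f' \<Zsemi> coprod_ar C p p' = coprod_ar C g g' \<Zsemi> coprod_ar C q q'"
      using s by (simp add: coprod_ar_Comp)
  next
    fix u v
    assume a: "u \<in> Ar C" "v \<in> Ar C" "Dom C u = Cod C (coprod_ar C f f')"
      "Dom C v = Cod C (coprod_ar C g g')"
      "Cod C u = Cod C v" and e: "coprod_ar C f f' \<Zsemi> u = coprod_ar C g g' \<Zsemi> v"
    let ?u = "inj1 C (Cod C f) (Cod C f') \<Zsemi> u" and ?v = "inj1 C (Cod C g) (Cod C g') \<Zsemi> v"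
    let ?u' = "inj2 C (Cod C f) (Cod C f') \<Zsemi> u" and ?v' = "inj2 C (Cod C g) (Cod C g') \<Zsemi> v"
    have "f \<Zsemi> ?u = g \<Zsemi> ?v" (is ?e1)
      using arg_cong[OF e, of "\<lambda>x. inj1 C (Dom C f) (Dom C f') \<Zsemi> x"] a s by simp
    obtain h where h: "h \<in> Ar C" "Dom C h = Cod C p" "Cod C h = Cod C ?u" "p \<Zsemi> h = ?u"
      "q \<Zsemi> h = ?v"
      by (rule is_pushout_ex[OF P _ _ _ _ _ \<open>?e1\<close>]) (use a s in simp_all)
    have "f' \<Zsemi> ?u' = g' \<Zsemi> ?v'" (is ?e2)
      using arg_cong[OF e, of "\<lambda>x. inj2 C (Dom C f) (Dom C f') \<Zsemi> x"] a s by simp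
    obtain k where k: "k \<in> Ar C" "Dom C k = Cod C p'" "Cod C k = Cod C ?u'" "p' \<Zsemi> k = ?u'"
      "q' \<Zsemi> k = ?v'"
      by (rule is_pushout_ex[OF Q _ _ _ _ _ \<open>?e2\<close>]) (use a s in simp_all)
    show "\<exists>l. l \<in> Ar C \<and> Dom C l = Cod C (coprod_ar C p p') \<and> Cod C l = Cod C u \<and>
      coprod_ar C p p' \<Zsemi> l = u \<and> coprod_ar C q q' \<Zsemi> l = v"
      using a s h k by (intro exI[of _ "copair C h k"]) simp
  next
    fix l m
    assume a: "l \<in> Ar C" "m \<in> Ar C" "Dom C l = Cod C (coprod_ar C p p')"
      "Dom C m = Cod C (coprod_ar C p p')"
      "Cod C l = Cod C m" and
      e: "coprod_ar C p p' \<Zsemi> l = coprod_ar C p p' \<Zsemi> m"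
        "coprod_ar C q q' \<Zsemi> l = coprod_ar C q q' \<Zsemi> m"
    have "inj1 C (Cod C p) (Cod C p') \<Zsemi> l = inj1 C (Cod C p) (Cod C p') \<Zsemi> m"
      by (rule is_pushout_eqI[OF P])
        (use a s arg_cong[OF e(1), of "\<lambda>x. inj1 C (Dom C p) (Dom C p') \<Zsemi> x"]
          arg_cong[OF e(2), of "\<lambda>x. inj1 C (Dom C q) (Dom C q') \<Zsemi> x"] in simp_all)
    moreover have "inj2 C (Cod C p) (Cod C p') \<Zsemi> l = inj2 C (Cod C p) (Cod C p') \<Zsemi> m"
      by (rule is_pushout_eqI[OF Q])
        (use a s arg_cong[OF e(1), of "\<lambda>x. inj2 C (Dom C p) (Dom C p') \<Zsemi> x"]
          arg_cong[OF e(2), of "\<lambda>x. inj2 C (Dom C q) (Dom C q') \<Zsemi> x"] in simp_all)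
    ultimately show "l = m"
      using coprod_eqI[of "Cod C p" "Cod C p'" l m] a s by simp
  qed (use s in simp_all)
qed

end

section \<open>Cospans\<close>

lemma Cospan_simps [simp]:
  "Ob (Cospan C) = Ob C"
  "Dom (Cospan C) = fst"
  "Cod (Cospan C) = (\<lambda>x. snd (snd x))"
  "Ide (Cospan C) = (\<lambda>A. cospan_of C (Ide C A))"
  "Comp (Cospan C) = cospan_comp C"
  "Unit (Cospan C) = initial_ob C"
  "TensorOb (Cospan C) = coprod_ob C"
  "TensorAr (Cospan C) = cospan_tensor C"
  "Assoc (Cospan C) = (\<lambda>A B D. cospan_of C (coprod_assoc C A B D))"
  "LUnit (Cospan C) = (\<lambda>A. cospan_of C (copair C (from_initial C A) (Ide C A)))"
  "RUnit (Cospan C) = (\<lambda>A. cospan_of C (copair C (Ide C A) (from_initial C A)))"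
  "Sym (Cospan C) = (\<lambda>A B. cospan_of C (copair C (inj2 C B A) (inj1 C B A)))"
  by (auto simp: Cospan_def fun_eq_iff)

lemma Dom_Cod_cospan_arrow [simp]:
  "fst (cospan_arrow C l r) = Dom C l" "snd (snd (cospan_arrow C l r)) = Dom C r"
  by (simp_all add: cospan_arrow_def)

context category
begin

lemma in_Ar_Cospan_iff:
  "x \<in> Ar (Cospan C) \<longleftrightarrow> (\<exists>l r. l \<in> Ar C \<and> r \<in> Ar C \<and> Cod C l = Cod C r \<and> x = cospan_arrow C l r)"
proof -
  have "x \<in> Ar (Cospan C) \<longleftrightarrow>
      (\<exists>l r A B. x = cospan_arrow C l r \<and> A \<in> Ob C \<and> B \<in> Ob C \<and> (\<exists>E. l \<in> hom C A E \<and> r \<in> hom C B E))"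
    by (simp add: Cospan_def cospans_def)
  then show ?thesis
    unfolding hom_iff by (metis Dom_Ob)
qed

lemma cospan_arrow_in_Ar [simp]:
  "\<lbrakk>l \<in> Ar C; r \<in> Ar C; Cod C l = Cod C r\<rbrakk> \<Longrightarrow> cospan_arrow C l r \<in> Ar (Cospan C)"
  using in_Ar_Cospan_iff by blast

lemma in_hom_Cospan_iff:
  "x \<in> hom (Cospan C) A B \<longleftrightarrow>
     (\<exists>l r. l \<in> Ar C \<and> r \<in> Ar C \<and> Cod C l = Cod C r \<and> Dom C l = A \<and> Dom C r = B \<and> x = cospan_arrow C l r)"
  unfolding hom_def mem_Collect_eq in_Ar_Cospan_iff Cospan_simps by (metis Dom_Cod_cospan_arrow)

lemma in_cospan_class_iff:
  "(l', r') \<in> cospan_class C l r \<longleftrightarrow> (\<exists>h. iso C h \<and> Dom C h = Cod C l \<and> l' = l \<Zsemi> h \<and> r' = r \<Zsemi> h)"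
  unfolding cospan_class_def by auto

lemma cospan_class_refl:
  "\<lbrakk>l \<in> Ar C; r \<in> Ar C; Cod C l = Cod C r\<rbrakk> \<Longrightarrow> (l, r) \<in> cospan_class C l r"
  unfolding in_cospan_class_iff by (rule exI[of _ "Ide C (Cod C l)"]) simp

text \<open>The isomorphisms out of the old apex are exactly the composites
  \<open>h \<Zsemi> k\<close> with \<open>k\<close> an isomorphism out of the new one.\<close>

lemma cospan_class_iso:
  assumes "l \<in> Ar C" "r \<in> Ar C" "Cod C l = Cod C r" "iso C h" "Dom C h = Cod C l"
  shows "cospan_class C (l \<Zsemi> h) (r \<Zsemi> h) = cospan_class C l r"
proof (rule set_eqI, clarify)
  fix l' r'
  have "(\<exists>k. iso C k \<and> Dom C k = Cod C h \<and> l' = l \<Zsemi> (h \<Zsemi> k) \<and> r' = r \<Zsemi> (h \<Zsemi> k)) \<longleftrightarrow>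
    (\<exists>k. iso C k \<and> Dom C k = Cod C l \<and> l' = l \<Zsemi> k \<and> r' = r \<Zsemi> k)"
  proof (intro iffI; elim exE conjE)
    fix k
    assume "iso C k" "Dom C k = Cod C h" "l' = l \<Zsemi> (h \<Zsemi> k)" "r' = r \<Zsemi> (h \<Zsemi> k)"
    then show "\<exists>k. iso C k \<and> Dom C k = Cod C l \<and> l' = l \<Zsemi> k \<and> r' = r \<Zsemi> k"
      using assms by (intro exI[of _ "h \<Zsemi> k"]) simp
  next
    fix k
    assume "iso C k" "Dom C k = Cod C l" "l' = l \<Zsemi> k" "r' = r \<Zsemi> k"
    then show "\<exists>k. iso C k \<and> Dom C k = Cod C h \<and> l' = l \<Zsemi> (h \<Zsemi> k) \<and> r' = r \<Zsemi> (h \<Zsemi> k)"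
      using assms by (intro exI[of _ "inv_arrow C h \<Zsemi> k"]) simp
  qed
  moreover have "(l \<Zsemi> h) \<Zsemi> k = l \<Zsemi> (h \<Zsemi> k)"
    "(r \<Zsemi> h) \<Zsemi> k = r \<Zsemi> (h \<Zsemi> k)"
    if "iso C k" "Dom C k = Cod C h" for k
    using assms that by simp_all
  moreover have "Cod C (l \<Zsemi> h) = Cod C h"
    using assms by simp
  ultimately show "(l', r') \<in> cospan_class C (l \<Zsemi> h) (r \<Zsemi> h) \<longleftrightarrow> (l', r') \<in> cospan_class C l r"
    unfolding in_cospan_class_iff by (metis (no_types, lifting))
qed

lemma cospan_arrow_iso:
  assumes "l \<in> Ar C" "r \<in> Ar C" "Cod C l = Cod C r" "iso C h" "Dom C h = Cod C l"
  shows "cospan_arrow C (l \<Zsemi> h) (r \<Zsemi> h) = cospan_arrow C l r"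
  using assms by (simp add: cospan_arrow_def cospan_class_iso)

lemma cospan_arrow_eqI:
  assumes "iso C h" "l \<in> Ar C" "r \<in> Ar C" "Cod C l = Cod C r" "Dom C h = Cod C l"
    "l \<Zsemi> h = l'" "r \<Zsemi> h = r'"
  shows "cospan_arrow C l r = cospan_arrow C l' r'"
  using cospan_arrow_iso[OF assms(2-4,1,5)] assms by simp

lemma cospan_arrow_eqE:
  assumes "cospan_arrow C l r = cospan_arrow C l' r'" "l' \<in> Ar C" "r' \<in> Ar C" "Cod C l' = Cod C r'"
  obtains h where "iso C h" "Dom C h = Cod C l" "l' = l \<Zsemi> h" "r' = r \<Zsemi> h"
proof -
  have "(l', r') \<in> cospan_class C l r"
    using assms(1) cospan_class_refl[OF assms(2-)] by (simp add: cospan_arrow_def)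
  then show ?thesis
    unfolding in_cospan_class_iff using that by blast
qed

text \<open>Well-definedness. The union in \<open>cospan_comp\<close> ranges over all
  representatives and all pushouts, but each such pushout can be carried back to the span
  \<open>r\<close>, \<open>l'\<close>, whose pushouts are isomorphic. So all classes in the union
  coincide, and any convenient pushout computes the composite.\<close>

lemma cospan_comp_cospan_arrow:
  assumes P: "is_pushout C r l' p q" and lr: "l \<in> Ar C" "r' \<in> Ar C" "Cod C l = Cod C r"
    "Cod C r' = Cod C l'"
  shows "cospan_comp C (cospan_arrow C l r) (cospan_arrow C l' r') = cospan_arrow C (l \<Zsemi> p) (r' \<Zsemi> q)"
proof -
  note s = is_pushout_simps[OF P] lr
  let ?S = "{cospan_class C (a \<Zsemi> p) (b' \<Zsemi> q) | a b a' b' p q.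
    (a, b) \<in> cospan_class C l r \<and> (a', b') \<in> cospan_class C l' r' \<and> is_pushout C b a' p q}"
  have "cospan_class C (a \<Zsemi> p') (b' \<Zsemi> q') = cospan_class C (l \<Zsemi> p) (r' \<Zsemi> q)"
    if X: "(a, b) \<in> cospan_class C l r" and Y: "(a', b') \<in> cospan_class C l' r'" and Q: "is_pushout C b a' p' q'" for a b a' b' p' q'
  proof -
    obtain h where h: "iso C h" "Dom C h = Cod C l" "a = l \<Zsemi> h" "b = r \<Zsemi> h"
      using X unfolding in_cospan_class_iff by blast
    obtain k where k: "iso C k" "Dom C k = Cod C l'" "a' = l' \<Zsemi> k" "b' = r' \<Zsemi> k"
      using Y unfolding in_cospan_class_iff by blast
    note s' = is_pushout_simps[OF Q]
    have t: "Dom C p' = Cod C h" "Dom C q' = Cod C k"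
      using s' s h k by simp_all
    have "is_pushout C r l' (h \<Zsemi> p') (k \<Zsemi> q')"
      by (rule is_pushout_iso_feet) (use Q h k s in simp_all)
    then obtain m where "iso C m" "Dom C m = Cod C p" "Cod C m = Cod C (h \<Zsemi> p')"
      "p \<Zsemi> m = h \<Zsemi> p'" "q \<Zsemi> m = k \<Zsemi> q'"
      by (rule is_pushout_unique[OF P])
    then show ?thesis
      using cospan_class_iso[of "l \<Zsemi> p" "r' \<Zsemi> q" m] s h k s' t by simp
  qed
  moreover have "(l, r) \<in> cospan_class C l r" "(l', r') \<in> cospan_class C l' r'"
    using s by (simp_all add: cospan_class_refl)
  then have "cospan_class C (l \<Zsemi> p) (r' \<Zsemi> q) \<in> ?S"
    using P by blast
  ultimately have "?S = {cospan_class C (l \<Zsemi> p) (r' \<Zsemi> q)}"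
    by blast
  then show ?thesis
    using s by (simp add: cospan_arrow_def cospan_comp_def)
qed

lemma cospan_of_simps [simp]:
  assumes "f \<in> Ar C"
  shows "cospan_of C f \<in> Ar (Cospan C)" "fst (cospan_of C f) = Dom C f"
    "snd (snd (cospan_of C f)) = Cod C f"
  using assms by (simp_all add: cospan_of_def)

lemma cospan_of_comp_cospan_arrow [simp]:
  assumes "f \<in> Ar C" "l \<in> Ar C" "r \<in> Ar C" "Cod C f = Dom C l" "Cod C l = Cod C r"
  shows "cospan_comp C (cospan_of C f) (cospan_arrow C l r) = cospan_arrow C (f \<Zsemi> l) r"
  using cospan_comp_cospan_arrow[OF is_pushout_sym[OF is_pushout_Ide[of l]], of f r] assms
  by (simp add: cospan_of_def)

lemma cospan_of_comp [simp]:
  assumes "f \<in> Ar C" "g \<in> Ar C" "Cod C f = Dom C g"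
  shows "cospan_comp C (cospan_of C f) (cospan_of C g) = cospan_of C (f \<Zsemi> g)"
  using cospan_of_comp_cospan_arrow[of f g "Ide C (Cod C g)"] assms by (simp add: cospan_of_def[of C g] cospan_of_def[of C "f \<Zsemi> g"])

text \<open>Pushing out along an isomorphism changes nothing, so the apex of \<open>r\<close> is
  kept and a cocone is mediated by its own first arrow \<open>u\<close>.\<close>

lemma is_pushout_iso:
  assumes "iso C k" "r \<in> Ar C" "Dom C k = Dom C r"
  shows "is_pushout C r k (Ide C (Cod C r)) (inv_arrow C k \<Zsemi> r)"
proof (rule is_pushoutI)
  fix u v
  assume "u \<in> Ar C" "v \<in> Ar C" "Dom C u = Cod C r" "Dom C v = Cod C k" "Cod C u = Cod C v"
    "r \<Zsemi> u = k \<Zsemi> v"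
  then show "\<exists>h. h \<in> Ar C \<and> Dom C h = Cod C (Ide C (Cod C r)) \<and> Cod C h = Cod C u \<and>
      Ide C (Cod C r) \<Zsemi> h = u \<and> (inv_arrow C k \<Zsemi> r) \<Zsemi> h = v"
    using assms by (intro exI[of _ u]) simp
qed (use assms in simp_all)

text \<open>Isomorphisms suffice on the right, as every coherence cospan is one. Together with the
  rule for precomposition, composites with coherence cospans simplify without naming a
  pushout.\<close>

lemma cospan_arrow_comp_cospan_of [simp]:
  assumes "iso C k" "l \<in> Ar C" "r \<in> Ar C" "Dom C k = Dom C r" "Cod C l = Cod C r"
  shows "cospan_comp C (cospan_arrow C l r) (cospan_of C k) = cospan_arrow C l (inv_arrow C k \<Zsemi> r)"
proof -
  have "is_pushout C r k (Ide C (Cod C r)) (inv_arrow C k \<Zsemi> r)"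
    by (rule is_pushout_iso) (use assms in simp_all)
  from cospan_comp_cospan_arrow[OF this, of l "Ide C (Cod C k)"] show ?thesis
    using assms by (simp add: cospan_of_def)
qed

lemma inverse_arrows_cospan_of:
  assumes "iso C f"
  shows "inverse_arrows (Cospan C) (cospan_of C f) (cospan_of C (inv_arrow C f))"
  using assms by (simp add: inverse_arrows_def hom_def)

lemma iso_cospan_of: "iso C f \<Longrightarrow> iso (Cospan C) (cospan_of C f)"
  using inverse_arrows_cospan_of unfolding iso_def by blast

end

section \<open>The symmetric monoidal category of cospans and its isomorphisms\<close>

context finitely_cocomplete
begin

text \<open>The union collapses as for composition: apex isomorphisms \<open>h\<close> and
  \<open>k\<close> of the factors combine to the apex isomorphism
  \<open>coprod_ar C h k\<close>.\<close>

lemma cospan_tensor_cospan_arrow [simp]: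
  assumes "l \<in> Ar C" "r \<in> Ar C" "Cod C l = Cod C r" "l' \<in> Ar C" "r' \<in> Ar C"
    "Cod C l' = Cod C r'"
  shows "cospan_tensor C (cospan_arrow C l r) (cospan_arrow C l' r') =
    cospan_arrow C (coprod_ar C l l') (coprod_ar C r r')"
proof -
  let ?S = "{cospan_class C (coprod_ar C a a') (coprod_ar C b b') | a b a' b'.
    (a, b) \<in> cospan_class C l r \<and> (a', b') \<in> cospan_class C l' r'}"
  have "cospan_class C (coprod_ar C a a') (coprod_ar C b b') = cospan_class C (coprod_ar C l l') (coprod_ar C r r')"
    if X: "(a, b) \<in> cospan_class C l r" and Y: "(a', b') \<in> cospan_class C l' r'" for a b a' b'
  proof -
    obtain h where h: "iso C h" "Dom C h = Cod C l" "a = l \<Zsemi> h" "b = r \<Zsemi> h"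
      using X unfolding in_cospan_class_iff by blast
    obtain k where k: "iso C k" "Dom C k = Cod C l'" "a' = l' \<Zsemi> k" "b' = r' \<Zsemi> k"
      using Y unfolding in_cospan_class_iff by blast
    show ?thesis
      using cospan_class_iso[of "coprod_ar C l l'" "coprod_ar C r r'" "coprod_ar C h k"] h k assms
      by (simp add: coprod_ar_Comp)
  qed
  moreover have "cospan_class C (coprod_ar C l l') (coprod_ar C r r') \<in> ?S"
    using cospan_class_refl[of l r] cospan_class_refl[of l' r'] assms by blast
  ultimately have "?S = {cospan_class C (coprod_ar C l l') (coprod_ar C r r')}"
    by blast
  then show ?thesis
    using assms by (simp add: cospan_arrow_def cospan_tensor_def)
qed

lemma cospan_tensor_cospan_of [simp]:
  "\<lbrakk>f \<in> Ar C; g \<in> Ar C\<rbrakk> \<Longrightarrow> cospan_tensor C (cospan_of C f) (cospan_of C g) = cospan_of C (coprod_ar C f g)"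
  by (simp add: cospan_of_def)

text \<open>Reduces naturality of a structure isomorphism of cospans to naturality in \<open>C\<close> on both legs.\<close>

lemma cospan_natural:
  assumes "iso C a" "iso C b" "iso C e" "l \<in> Ar C" "r \<in> Ar C" "l' \<in> Ar C" "r' \<in> Ar C"
    "Cod C l = Cod C r" "Cod C l' = Cod C r'" "Dom C a = Dom C l" "Cod C a = Dom C l'"
    "Dom C b = Dom C r" "Cod C b = Dom C r'" "Dom C e = Cod C l" "Cod C e = Cod C l'"
    "l \<Zsemi> e = a \<Zsemi> l'" "r \<Zsemi> e = b \<Zsemi> r'"
  shows "cospan_comp C (cospan_arrow C l r) (cospan_of C b) = cospan_comp C (cospan_of C a) (cospan_arrow C l' r')"
  using assms cospan_arrow_eqI[of e l "inv_arrow C b \<Zsemi> r" "a \<Zsemi> l'" r'] by simp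

text \<open>\<open>cospan_of\<close> preserves composition and tensor, so the coherence equations
  are those of the coproduct in \<open>C\<close>. The laws for arbitrary cospans rest on pushouts:
  pasting for associativity, sums of pushouts for interchange.\<close>

lemma symmetric_monoidal_Cospan: "symmetric_monoidal_category (Cospan C)" (is "symmetric_monoidal_category ?K")
proof
  fix f assume "f \<in> Ar ?K"
  then show "Dom ?K f \<in> Ob ?K" "Cod ?K f \<in> Ob ?K"
    unfolding in_Ar_Cospan_iff by auto
next
  fix A assume "A \<in> Ob ?K"
  then show "Ide ?K A \<in> hom ?K A A"
    by (simp add: hom_def)
next
  fix x A B y D
  assume "x \<in> hom ?K A B" "y \<in> hom ?K B D"
  then obtain l r l' r' where s: "l \<in> Ar C" "r \<in> Ar C" "Cod C l = Cod C r" "Dom C l = A"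
    "Dom C r = B" "x = cospan_arrow C l r"
    "l' \<in> Ar C" "r' \<in> Ar C" "Cod C l' = Cod C r'" "Dom C l' = B" "Dom C r' = D"
      "y = cospan_arrow C l' r'"
    unfolding in_hom_Cospan_iff by blast
  then obtain p q where P: "is_pushout C r l' p q"
    using ex_pushout[of r l'] by auto
  show "Comp ?K x y \<in> hom ?K A D"
    using s is_pushout_simps[OF P] cospan_comp_cospan_arrow[OF P, of l r'] by (simp add: hom_def)
next
  fix x A B
  assume "x \<in> hom ?K A B"
  then obtain l r where s: "l \<in> Ar C" "r \<in> Ar C" "Cod C l = Cod C r" "Dom C l = A" "Dom C r = B"
    "x = cospan_arrow C l r"
    unfolding in_hom_Cospan_iff by blast
  then have "A \<in> Ob C" "B \<in> Ob C"
    by auto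
  then show "Comp ?K (Ide ?K A) x = x" "Comp ?K x (Ide ?K B) = x"
    using s by simp_all
next
  fix x y z A B D E
  assume "x \<in> hom ?K A B" "y \<in> hom ?K B D" "z \<in> hom ?K D E"
  then obtain l r l' r' l'' r'' where
    s: "l \<in> Ar C" "r \<in> Ar C" "Cod C l = Cod C r" "Dom C l = A" "Dom C r = B" "x = cospan_arrow C l r"
    "l' \<in> Ar C" "r' \<in> Ar C" "Cod C l' = Cod C r'" "Dom C l' = B" "Dom C r' = D"
      "y = cospan_arrow C l' r'"
    "l'' \<in> Ar C" "r'' \<in> Ar C" "Cod C l'' = Cod C r''" "Dom C l'' = D" "Dom C r'' = E"
      "z = cospan_arrow C l'' r''"
    unfolding in_hom_Cospan_iff by blast
  obtain p q where P: "is_pushout C r l' p q"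
    using ex_pushout[of r l'] s by auto
  obtain p' q' where P': "is_pushout C r' l'' p' q'"
    using ex_pushout[of r' l''] s by auto
  note t = is_pushout_simps[OF P] is_pushout_simps[OF P']
  \<comment> \<open>The third pushout glues the two inner ones along the apex of \<open>y\<close>,
    which they share; either bracketing is then computed by a pasted pushout with the same outer
    legs.\<close>
  obtain u v where Q: "is_pushout C q p' u v"
    using ex_pushout[of q p'] s t by auto
  note t = t is_pushout_simps[OF Q]
  have "is_pushout C r (l' \<Zsemi> p') (p \<Zsemi> u) v"
    by (rule is_pushout_paste[OF P Q])
  from cospan_comp_cospan_arrow[OF this, of l "r'' \<Zsemi> q'"]
  have "cospan_comp C x (cospan_comp C y z) = cospan_arrow C (l \<Zsemi> (p \<Zsemi> u)) (r'' \<Zsemi> (q' \<Zsemi> v))"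
    using s t cospan_comp_cospan_arrow[OF P', of l' r''] by simp
  moreover have "is_pushout C (r' \<Zsemi> q) l'' u (q' \<Zsemi> v)"
    by (rule is_pushout_sym[OF is_pushout_paste[OF is_pushout_sym[OF P'] is_pushout_sym[OF Q]]])
  from cospan_comp_cospan_arrow[OF this, of "l \<Zsemi> p" r'']
  have "cospan_comp C (cospan_comp C x y) z = cospan_arrow C (l \<Zsemi> (p \<Zsemi> u)) (r'' \<Zsemi> (q' \<Zsemi> v))"
    using s t cospan_comp_cospan_arrow[OF P, of l r'] by simp
  ultimately show "Comp ?K (Comp ?K x y) z = Comp ?K x (Comp ?K y z)"
    by simp
next
  fix x A B y A' B'
  assume "x \<in> hom ?K A B" "y \<in> hom ?K A' B'"
  then obtain l r l' r' where s: "l \<in> Ar C" "r \<in> Ar C" "Cod C l = Cod C r" "Dom C l = A"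
    "Dom C r = B" "x = cospan_arrow C l r"
    "l' \<in> Ar C" "r' \<in> Ar C" "Cod C l' = Cod C r'" "Dom C l' = A'" "Dom C r' = B'"
      "y = cospan_arrow C l' r'"
    unfolding in_hom_Cospan_iff by blast
  show "TensorAr ?K x y \<in> hom ?K (TensorOb ?K A A') (TensorOb ?K B B')"
    using s by (simp add: hom_def)
  show "Comp ?K (TensorAr ?K x y) (Sym ?K B B') =
    Comp ?K (Sym ?K A A') (TensorAr ?K y x)"
    \<comment> \<open>The evaluation rules are switched off to keep both sides in the shape of
      \<open>cospan_natural\<close>; the apex isomorphism \<open>e\<close> is the swap of the two
      apexes.\<close>
    unfolding s Cospan_simps using s(1-5,7-11)
    by (simp del: cospan_of_comp_cospan_arrow cospan_arrow_comp_cospan_of)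
      (rule cospan_natural[where e = "copair C (inj2 C (Cod C l') (Cod C l)) (inj1 C (Cod C l') (Cod C l))"]; force)
next
  fix x y A B D A' B' D' x' y'
  assume "x \<in> hom ?K A B" "y \<in> hom ?K B D" "x' \<in> hom ?K A' B'" "y' \<in> hom ?K B' D'"
  then obtain l r m n l' r' m' n' where
    s: "l \<in> Ar C" "r \<in> Ar C" "Cod C l = Cod C r" "Dom C l = A" "Dom C r = B" "x = cospan_arrow C l r"
    "m \<in> Ar C" "n \<in> Ar C" "Cod C m = Cod C n" "Dom C m = B" "Dom C n = D" "y = cospan_arrow C m n"
    "l' \<in> Ar C" "r' \<in> Ar C" "Cod C l' = Cod C r'" "Dom C l' = A'" "Dom C r' = B'"
      "x' = cospan_arrow C l' r'"
    "m' \<in> Ar C" "n' \<in> Ar C" "Cod C m' = Cod C n'" "Dom C m' = B'" "Dom C n' = D'"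
      "y' = cospan_arrow C m' n'"
    unfolding in_hom_Cospan_iff by blast
  obtain p q where P: "is_pushout C r m p q"
    using ex_pushout[of r m] s by auto
  obtain p' q' where P': "is_pushout C r' m' p' q'"
    using ex_pushout[of r' m'] s by auto
  note t = is_pushout_simps[OF P] is_pushout_simps[OF P']
  show "TensorAr ?K (Comp ?K x y) (Comp ?K x' y') =
    Comp ?K (TensorAr ?K x x') (TensorAr ?K y y')"
    using cospan_comp_cospan_arrow[OF P, of l n] cospan_comp_cospan_arrow[OF P', of l' n']
      cospan_comp_cospan_arrow[OF is_pushout_coprod[OF P P'], of "coprod_ar C l l'" "coprod_ar C n n'"] s t
    by (simp add: coprod_ar_Comp)
next
  fix x A A' y B B' z D D'
  assume "x \<in> hom ?K A A'" "y \<in> hom ?K B B'" "z \<in> hom ?K D D'"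
  then obtain l r l' r' l'' r'' where
    s: "l \<in> Ar C" "r \<in> Ar C" "Cod C l = Cod C r" "Dom C l = A" "Dom C r = A'" "x = cospan_arrow C l r"
    "l' \<in> Ar C" "r' \<in> Ar C" "Cod C l' = Cod C r'" "Dom C l' = B" "Dom C r' = B'"
      "y = cospan_arrow C l' r'"
    "l'' \<in> Ar C" "r'' \<in> Ar C" "Cod C l'' = Cod C r''" "Dom C l'' = D" "Dom C r'' = D'"
      "z = cospan_arrow C l'' r''"
    unfolding in_hom_Cospan_iff by blast
  show "Comp ?K (TensorAr ?K (TensorAr ?K x y) z) (Assoc ?K A' B' D') =
    Comp ?K (Assoc ?K A B D) (TensorAr ?K x (TensorAr ?K y z))"
    unfolding s Cospan_simps using s(1-5,7-11,13-17)
      coprod_assoc_natural[of l l' l''] coprod_assoc_natural[of r r' r'']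
    by (simp del: cospan_of_comp_cospan_arrow cospan_arrow_comp_cospan_of)
      (rule cospan_natural[where e = "coprod_assoc C (Cod C l) (Cod C l') (Cod C l'')"]; force)
next
  fix x A B
  assume "x \<in> hom ?K A B"
  then obtain l r where s: "l \<in> Ar C" "r \<in> Ar C" "Cod C l = Cod C r" "Dom C l = A" "Dom C r = B"
    "x = cospan_arrow C l r"
    unfolding in_hom_Cospan_iff by blast
  have t: "A \<in> Ob C" "B \<in> Ob C"
    using s by auto
  have "cospan_tensor C (cospan_of C (Ide C (initial_ob C))) x =
      cospan_arrow C (coprod_ar C (Ide C (initial_ob C)) l) (coprod_ar C (Ide C (initial_ob C)) r)"
    "cospan_tensor C x (cospan_of C (Ide C (initial_ob C))) =
      cospan_arrow C (coprod_ar C l (Ide C (initial_ob C))) (coprod_ar C r (Ide C (initial_ob C)))"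
    using s by (simp_all add: cospan_of_def)
  note T = this
  show "Comp ?K (TensorAr ?K (Ide ?K (Unit ?K)) x) (LUnit ?K B) =
    Comp ?K (LUnit ?K A) x"
    unfolding Cospan_simps T unfolding s
    by (rule cospan_natural[where e = "copair C (from_initial C (Cod C l)) (Ide C (Cod C l))"]) (use s t in simp_all)
  show "Comp ?K (TensorAr ?K x (Ide ?K (Unit ?K))) (RUnit ?K B) =
    Comp ?K (RUnit ?K A) x"
    unfolding Cospan_simps T unfolding s
    by (rule cospan_natural[where e = "copair C (Ide C (Cod C l)) (from_initial C (Cod C l))"]) (use s t in simp_all)
next
  fix A B assume "A \<in> Ob ?K" "B \<in> Ob ?K"
  then show
    "TensorOb ?K A B \<in> Ob ?K"
    "TensorAr ?K (Ide ?K A) (Ide ?K B) = Ide ?K (TensorOb ?K A B)"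
    "Sym ?K A B \<in> hom ?K (TensorOb ?K A B) (TensorOb ?K B A)"
    "Comp ?K (Sym ?K A B) (Sym ?K B A) = Ide ?K (TensorOb ?K A B)"
    "Comp ?K (Assoc ?K A (Unit ?K) B) (TensorAr ?K (Ide ?K A) (LUnit ?K B)) =
      TensorAr ?K (RUnit ?K A) (Ide ?K B)"
    by (simp_all add: hom_def coprod_triangle del: coprod_ar_copair)
next
  fix A B D assume a: "A \<in> Ob ?K" "B \<in> Ob ?K" "D \<in> Ob ?K"
  then show
    "Assoc ?K A B D \<in> hom ?K (TensorOb ?K (TensorOb ?K A B) D)
      (TensorOb ?K A (TensorOb ?K B D))"
    "iso ?K (Assoc ?K A B D)"
    by (simp_all add: hom_def iso_cospan_of)
  show "Comp ?K (Comp ?K (Assoc ?K A B D) (Sym ?K A (TensorOb ?K B D)))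
      (Assoc ?K B D A) =
    Comp ?K (Comp ?K (TensorAr ?K (Sym ?K A B) (Ide ?K D))
      (Assoc ?K B A D)) (TensorAr ?K (Ide ?K B) (Sym ?K A D))"
    using a coprod_hexagon[of A B D] by (simp del: copair_Comp coprod_ar_copair)
next
  fix A B D E assume "A \<in> Ob ?K" "B \<in> Ob ?K" "D \<in> Ob ?K" "E \<in> Ob ?K"
  then show "Comp ?K (Comp ?K (TensorAr ?K (Assoc ?K A B D) (Ide ?K E))
      (Assoc ?K A (TensorOb ?K B D) E)) (TensorAr ?K (Ide ?K A) (Assoc ?K B D E)) =
    Comp ?K (Assoc ?K (TensorOb ?K A B) D E) (Assoc ?K A B (TensorOb ?K D E))"
    using coprod_pentagon[of A B D E] by simp
next
  fix A assume "A \<in> Ob ?K"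
  then show "LUnit ?K A \<in> hom ?K (TensorOb ?K (Unit ?K) A) A"
    "iso ?K (LUnit ?K A)"
    "RUnit ?K A \<in> hom ?K (TensorOb ?K A (Unit ?K)) A"
    "iso ?K (RUnit ?K A)"
    by (simp_all add: hom_def iso_cospan_of)
qed simp

text \<open>If \<open>(l, r)\<close> and \<open>(l', r')\<close> are inverse cospans, then \<open>l'\<close> is a split monomorphism, hence so is
  its pushout \<open>p\<close>; and \<open>p\<close> is a split epimorphism because \<open>l \<Zsemi> p\<close> is invertible.\<close>

lemma iso_leg_if_inverse:
  assumes P: "is_pushout C r l' p q" and l: "l \<in> Ar C" "Cod C l = Cod C r" "iso C (l \<Zsemi> p)"
    and p': "p' \<in> Ar C" "Dom C p' = Cod C l'" "iso C (l' \<Zsemi> p')"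
  shows "iso C l"
proof -
  note s = is_pushout_simps[OF P] l p'
  let ?m = "p' \<Zsemi> inv_arrow C (l' \<Zsemi> p')"
  have m: "l' \<Zsemi> ?m = Ide C (Dom C l')" "?m \<in> Ar C" "Dom C ?m = Cod C l'" "Cod C ?m = Dom C l'"
    using iso_simps(5)[OF p'(3)] Comp_assoc'[of l' p' "inv_arrow C (l' \<Zsemi> p')"] s by simp_all
  \<comment> \<open>With the retraction \<open>?m\<close> of \<open>l'\<close>, the identity and
    \<open>?m \<Zsemi> r\<close> form a cocone on the span; its mediating arrow \<open>h\<close>
    splits \<open>p\<close>.\<close>
  have "l' \<Zsemi> (?m \<Zsemi> r) = r"
    using Comp_reassoc[OF m(1), of r] m s by simp
  then obtain h where h: "h \<in> Ar C" "Dom C h = Cod C p" "Cod C h = Cod C r"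
    "p \<Zsemi> h = Ide C (Cod C r)"
    using is_pushout_ex[OF P, of "Ide C (Cod C r)" "?m \<Zsemi> r"] m s by auto
  have "iso C p"
    by (rule isoI_split[of p h "inv_arrow C (l \<Zsemi> p) \<Zsemi> l"]) (use h s iso_simps(6)[OF l(3)] in simp_all)
  then show ?thesis
    using iso_left_factor[OF l(3)] s by simp
qed

text \<open>The equivalence in \<open>St\<close> quantifies over isomorphisms of cospans; this
  brings it down to isomorphisms of \<open>C\<close>. Both composites being identities makes
  \<open>l \<Zsemi> p\<close>, \<open>r' \<Zsemi> q\<close>, \<open>l' \<Zsemi> p'\<close> and
  \<open>r \<Zsemi> q'\<close> invertible, hence both legs of \<open>x\<close>, and moving the apex
  along the inverse of \<open>r\<close> leaves an identity as right leg.\<close>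

lemma inverse_arrows_CospanE:
  assumes "inverse_arrows (Cospan C) x y"
  obtains h where "iso C h" "x = cospan_of C h" "y = cospan_of C (inv_arrow C h)"
proof -
  interpret S: symmetric_monoidal_category "Cospan C"
    by (rule symmetric_monoidal_Cospan)
  from assms obtain l r l' r' where s: "l \<in> Ar C" "r \<in> Ar C" "Cod C l = Cod C r"
    "x = cospan_arrow C l r"
    "l' \<in> Ar C" "r' \<in> Ar C" "Cod C l' = Cod C r'" "y = cospan_arrow C l' r'"
    unfolding S.inverse_arrows_iff in_Ar_Cospan_iff by blast
  then have t: "Dom C l' = Dom C r" "Dom C r' = Dom C l"
    and c: "cospan_comp C x y = cospan_of C (Ide C (Dom C l))"
      "cospan_comp C y x = cospan_of C (Ide C (Dom C r))"
    using assms unfolding S.inverse_arrows_iff by simp_all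
  obtain p q where P: "is_pushout C r l' p q"
    using ex_pushout[of r l'] s t by auto
  obtain p' q' where Q: "is_pushout C r' l p' q'"
    using ex_pushout[of r' l] s t by auto
  note s = s t is_pushout_simps(1-4,6-9)[OF P] is_pushout_simps(1-4,6-9)[OF Q]
  have "cospan_arrow C (Ide C (Dom C l)) (Ide C (Dom C l)) = cospan_arrow C (l \<Zsemi> p) (r' \<Zsemi> q)"
    using cospan_comp_cospan_arrow[OF P, of l r'] c(1) s by (simp add: cospan_of_def)
  then have i: "iso C (l \<Zsemi> p)" "iso C (r' \<Zsemi> q)"
    by (rule cospan_arrow_eqE; use s in simp)+
  have "cospan_arrow C (Ide C (Dom C r)) (Ide C (Dom C r)) = cospan_arrow C (l' \<Zsemi> p') (r \<Zsemi> q')"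
    using cospan_comp_cospan_arrow[OF Q, of l' r] c(2) s by (simp add: cospan_of_def)
  then have j: "iso C (l' \<Zsemi> p')" "iso C (r \<Zsemi> q')"
    by (rule cospan_arrow_eqE; use s in simp)+
  have "iso C l"
    by (rule iso_leg_if_inverse[OF P _ _ i(1) _ _ j(1)]) (use s in simp_all)
  have "iso C r"
    by (rule iso_leg_if_inverse[OF is_pushout_sym[OF Q] _ _ j(2) _ _ i(2)]) (use s in simp_all)
  let ?h = "l \<Zsemi> inv_arrow C r"
  have "iso C ?h" "x = cospan_of C ?h"
    using \<open>iso C l\<close> \<open>iso C r\<close> s cospan_arrow_iso[of l r "inv_arrow C r"] by (simp_all add: cospan_of_def)
  moreover have "y = cospan_of C (inv_arrow C ?h)"
    using S.inverse_arrows_unique assms inverse_arrows_cospan_of calculation by blast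
  ultimately show ?thesis
    using that by blast
qed

end

section \<open>Full subcategories\<close>

lemma full_subcategory_simps [simp]:
  fixes C :: "('o, 'm, 'x) smcat_scheme"
  shows
  "Ob (full_subcategory C P) = {A \<in> Ob C. P A}"
  "Ar (full_subcategory C P) = {f \<in> Ar C. P (Dom C f) \<and> P (Cod C f)}"
  "Dom (full_subcategory C P) = Dom C"
  "Cod (full_subcategory C P) = Cod C"
  "Ide (full_subcategory C P) = Ide C"
  "Comp (full_subcategory C P) = Comp C"
  "Unit (full_subcategory C P) = Unit C"
  "TensorOb (full_subcategory C P) = TensorOb C"
  "TensorAr (full_subcategory C P) = TensorAr C"
  "Assoc (full_subcategory C P) = Assoc C"
  "LUnit (full_subcategory C P) = LUnit C"
  "RUnit (full_subcategory C P) = RUnit C"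
  "Sym (full_subcategory C P) = Sym C"
  by (simp_all add: full_subcategory_def)

lemma hom_full_subcategory_iff:
  fixes C :: "('o, 'm, 'x) smcat_scheme"
  shows "f \<in> hom (full_subcategory C P) A B \<longleftrightarrow> f \<in> hom C A B \<and> P A \<and> P B"
  by (auto simp: hom_def)

context symmetric_monoidal_category
begin

lemma iso_full_subcategory:
  assumes "iso C f" "P (Dom C f)" "P (Cod C f)"
  shows "iso (full_subcategory C P) f"
  using iso_inverse_arrows[OF assms(1)] assms(2,3) unfolding iso_def inverse_arrows_def
  by (auto simp: hom_def)

text \<open>Equations are inherited since hom-sets between admissible objects are unchanged.
  Invertibility of the coherence maps is relative to the subcategory, but fullness keeps their
  inverses; \<open>T'\<close> and \<open>T''\<close> ensure that tensors of arrows stay between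
  admissible objects.\<close>

lemma symmetric_monoidal_full_subcategory:
  assumes "P (Unit C)" and T: "\<And>A B. \<lbrakk>A \<in> Ob C; B \<in> Ob C; P A; P B\<rbrakk> \<Longrightarrow> P (A \<odot> B)"
  shows "symmetric_monoidal_category (full_subcategory C P)"
proof -
  have iso: "iso (full_subcategory C P) f" if "f \<in> hom C A B" "iso C f" "P A" "P B" for f A B
    using iso_full_subcategory[of f P] that by (auto simp: hom_def)
  have T': "P (A \<odot> A')" if "f \<in> hom C A B" "f' \<in> hom C A' B'" "P A" "P A'" for f f' A B A' B'
    using T that in_homD(4) by blast
  have T'': "P (B \<odot> B')" if "f \<in> hom C A B" "f' \<in> hom C A' B'" "P B" "P B'" for f f' A B A' B'
    using T that in_homD(5) by blast
  show ?thesis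
    apply unfold_locales
    unfolding hom_full_subcategory_iff full_subcategory_simps mem_Collect_eq
    by (auto simp: Comp_in_hom Ide_in_hom Comp_assoc Unit_in_Ob TensorOb_in_Ob TensorAr_in_hom
        Tensor_Ide Tensor_Comp Assoc_in_hom Assoc_natural LUnit_in_hom LUnit_natural RUnit_in_hom
        RUnit_natural Sym_in_hom Sym_natural Sym_Sym pentagon triangle hexagon assms Ide_Comp Comp_Ide
        intro: T' T''
        intro!: iso[OF Assoc_in_hom Assoc_iso] iso[OF LUnit_in_hom LUnit_iso] iso[OF RUnit_in_hom RUnit_iso])
qed

end

section \<open>Internal graphs\<close>

context category
begin

text \<open>Serves to show that discreteness of a graph is invariant under isomorphism
  (\<open>iso_imp_discr\<close>).\<close>

lemma is_initial_iso:
  assumes Z: "is_initial C Z" and h: "iso C h" "Dom C h = Z"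
  shows "is_initial C (Cod C h)"
  unfolding is_initial_def
proof (intro conjI ballI)
  fix A assume "A \<in> Ob C"
  then have u: "\<exists>!f. f \<in> hom C Z A"
    using Z by (simp add: is_initial_def)
  then obtain f where f: "f \<in> hom C Z A"
    by blast
  show "\<exists>!f. f \<in> hom C (Cod C h) A"
  proof (rule ex1I[of _ "inv_arrow C h \<Zsemi> f"])
    show "inv_arrow C h \<Zsemi> f \<in> hom C (Cod C h) A"
      using f h by (simp add: hom_def)
  next
    fix g assume g: "g \<in> hom C (Cod C h) A"
    then have "h \<Zsemi> g \<in> hom C Z A"
      using h by (simp add: hom_def)
    then have "h \<Zsemi> g = f"
      using u f by blast
    moreover have "inv_arrow C h \<Zsemi> (h \<Zsemi> g) = g"
      using g h by (intro iso_cancel(2)) (simp_all add: hom_def)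
    ultimately show "g = inv_arrow C h \<Zsemi> f"
      by simp
  qed
qed (use h in simp)

text \<open>Stated for a given comparison arrow \<open>h\<close>, because the comparison maps
  between tensors arise as copairings whose invertibility is then asked for.\<close>

lemma is_coproduct_unique:
  assumes P: "is_coproduct C A B P i j" and Q: "is_coproduct C A B Q k l"
    and h: "h \<in> Ar C" "Dom C h = P" "Cod C h = Q" "i \<Zsemi> h = k" "j \<Zsemi> h = l"
  shows "iso C h"
proof -
  note s = is_coproduct_simps[OF P] is_coproduct_simps[OF Q]
  have "\<exists>!m. m \<in> Ar C \<and> Dom C m = Q \<and> Cod C m = Cod C i \<and> k \<Zsemi> m = i \<and> l \<Zsemi> m = j"
    by (rule is_coproduct_ex1[OF Q]) (use s in simp_all)
  then obtain m where m: "m \<in> Ar C" "Dom C m = Q" "Cod C m = P" "k \<Zsemi> m = i" "l \<Zsemi> m = j"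
    using s by blast
  have "P \<in> Ob C" "Q \<in> Ob C"
    using h by auto
  have "i \<Zsemi> (h \<Zsemi> m) = k \<Zsemi> m" "j \<Zsemi> (h \<Zsemi> m) = l \<Zsemi> m"
    by (rule Comp_reassoc[OF h(4)] Comp_reassoc[OF h(5)]; simp add: s h m)+
  then have "h \<Zsemi> m = Ide C P"
    using is_coproduct_eqI[OF P, of "h \<Zsemi> m" "Ide C P"] \<open>P \<in> Ob C\<close> by (simp add: s h m)
  moreover have "k \<Zsemi> (m \<Zsemi> h) = i \<Zsemi> h" "l \<Zsemi> (m \<Zsemi> h) = j \<Zsemi> h"
    by (rule Comp_reassoc[OF m(4)] Comp_reassoc[OF m(5)]; simp add: s h(1-3) m)+
  then have "m \<Zsemi> h = Ide C Q"
    using is_coproduct_eqI[OF Q, of "m \<Zsemi> h" "Ide C Q"] \<open>Q \<in> Ob C\<close> by (simp add: s h m)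
  ultimately show ?thesis
    using h m by (intro isoI[of h m]) (simp add: inverse_arrows_iff)
qed

end

context finitely_cocomplete
begin

lemma iso_from_initial: "is_initial C Z \<Longrightarrow> iso C (from_initial C Z)"
proof -
  assume Z: "is_initial C Z"
  then have "Z \<in> Ob C"
    by (simp add: is_initial_def)
  have "\<exists>!f. f \<in> hom C Z (initial_ob C)"
    using Z by (simp add: is_initial_def)
  then obtain f where f: "f \<in> Ar C" "Dom C f = Z" "Cod C f = initial_ob C"
    unfolding hom_iff by blast
  have "f \<Zsemi> from_initial C Z \<in> hom C Z Z" "Ide C Z \<in> hom C Z Z"
    using f \<open>Z \<in> Ob C\<close> by (simp_all add: hom_def)
  moreover have "\<exists>!f. f \<in> hom C Z Z"
    using Z \<open>Z \<in> Ob C\<close> by (simp add: is_initial_def)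
  ultimately have "f \<Zsemi> from_initial C Z = Ide C Z"
    by blast
  moreover have "from_initial C Z \<Zsemi> f = Ide C (initial_ob C)"
    by (rule from_initial_eqI) (use f \<open>Z \<in> Ob C\<close> in simp_all)
  ultimately show ?thesis
    using f \<open>Z \<in> Ob C\<close> by (intro isoI[of _ f]) (simp add: inverse_arrows_iff)
qed

text \<open>Edge component of the fact that discrete graphs are closed under coproducts.\<close>

lemma is_coproduct_initial:
  "is_coproduct C (initial_ob C) (initial_ob C) (initial_ob C) (Ide C (initial_ob C)) (Ide C (initial_ob C))"
proof (rule is_coproductI)
  fix f g
  assume "f \<in> Ar C" "g \<in> Ar C" "Dom C f = initial_ob C" "Dom C g = initial_ob C" "Cod C f = Cod C g"
  then show "\<exists>h. h \<in> Ar C \<and> Dom C h = initial_ob C \<and> Cod C h = Cod C f \<and>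
    Ide C (initial_ob C) \<Zsemi> h = f \<and> Ide C (initial_ob C) \<Zsemi> h = g"
    using from_initial_eqI[of f g] by (intro exI[of _ f]) simp
qed simp_all

text \<open>Morphisms out of a discrete graph are \<open>from_initial\<close> on edges, so this is
  the edge half of gluing two graphs along vertices.\<close>

lemma is_pushout_from_initial:
  assumes "is_coproduct C A B P i j"
  shows "is_pushout C (from_initial C A) (from_initial C B) i j"
proof -
  note s = is_coproduct_simps[OF assms]
  have t: "A \<in> Ob C" "B \<in> Ob C" "P \<in> Ob C"
    using s by auto
  show ?thesis
  proof (rule is_pushoutI)
    fix u v
    assume a: "u \<in> Ar C" "v \<in> Ar C" "Dom C u = Cod C (from_initial C A)"
      "Dom C v = Cod C (from_initial C B)" "Cod C u = Cod C v"
    then have "\<exists>!h. h \<in> Ar C \<and> Dom C h = P \<and> Cod C h = Cod C u \<and> i \<Zsemi> h = u \<and> j \<Zsemi> h = v"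
      by (intro is_coproduct_ex1[OF assms]) (use t in simp_all)
    then show "\<exists>h. h \<in> Ar C \<and> Dom C h = Cod C i \<and> Cod C h = Cod C u \<and> i \<Zsemi> h = u \<and> j \<Zsemi> h = v"
      unfolding s(3) by (rule ex1_implies_ex)
  next
    fix h k
    assume "h \<in> Ar C" "k \<in> Ar C" "Dom C h = Cod C i" "Dom C k = Cod C i" "Cod C h = Cod C k"
      "i \<Zsemi> h = i \<Zsemi> k" "j \<Zsemi> h = j \<Zsemi> k"
    then show "h = k"
      using is_coproduct_eqI[OF assms, of h k] s by simp
  qed (use s t in simp_all)
qed

end

text \<open>\<open>G\<close> is the category of internal graphs \<open>s, t : E \<rightrightarrows> V\<close> of \<open>C\<close>, with \<open>gr s t\<close> the graph and
  \<open>mor X e v Y\<close> the morphism given by the indicated data.\<close>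

locale internal_graphs = C: finitely_cocomplete C + G: category G
  for C :: "('o, 'm, 'x) cat_scheme" (structure) and G :: "('p, 'n, 'y) cat_scheme" +
  fixes gr :: "'m \<Rightarrow> 'm \<Rightarrow> 'p" and sr tg :: "'p \<Rightarrow> 'm"
    and mor :: "'p \<Rightarrow> 'm \<Rightarrow> 'm \<Rightarrow> 'p \<Rightarrow> 'n" and Em Vm :: "'n \<Rightarrow> 'm" and discr :: "'p \<Rightarrow> bool"
  assumes initial_unique: "is_initial C Z \<Longrightarrow> Z = initial_ob C"
    and gr: "\<lbrakk>s \<in> Ar C; t \<in> Ar C; Dom C t = Dom C s; Cod C t = Cod C s\<rbrakk>
      \<Longrightarrow> gr s t \<in> Ob G \<and> sr (gr s t) = s \<and> tg (gr s t) = t"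
    and sr_tg: "X \<in> Ob G \<Longrightarrow> sr X \<in> Ar C \<and> tg X \<in> Ar C \<and> Dom C (tg X) = Dom C (sr X) \<and>
      Cod C (tg X) = Cod C (sr X) \<and> gr (sr X) (tg X) = X"
    and Em_Vm: "m \<in> Ar G \<Longrightarrow> Em m \<in> Ar C \<and> Vm m \<in> Ar C \<and>
      Dom C (Em m) = Dom C (sr (Dom G m)) \<and> Cod C (Em m) = Dom C (sr (Cod G m)) \<and>
      Dom C (Vm m) = Cod C (sr (Dom G m)) \<and> Cod C (Vm m) = Cod C (sr (Cod G m)) \<and>
      sr (Dom G m) \<Zsemi> Vm m = Em m \<Zsemi> sr (Cod G m) \<and> tg (Dom G m) \<Zsemi> Vm m = Em m \<Zsemi> tg (Cod G m) \<and>
      mor (Dom G m) (Em m) (Vm m) (Cod G m) = m"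
    and mor: "\<lbrakk>X \<in> Ob G; Y \<in> Ob G; e \<in> Ar C; v \<in> Ar C; Dom C e = Dom C (sr X); Cod C e = Dom C (sr Y);
      Dom C v = Cod C (sr X); Cod C v = Cod C (sr Y); sr X \<Zsemi> v = e \<Zsemi> sr Y; tg X \<Zsemi> v = e \<Zsemi> tg Y\<rbrakk>
      \<Longrightarrow> mor X e v Y \<in> hom G X Y \<and> Em (mor X e v Y) = e \<and> Vm (mor X e v Y) = v"
    and Em_Vm_Ide: "X \<in> Ob G \<Longrightarrow> Em (Ide G X) = Ide C (Dom C (sr X)) \<and> Vm (Ide G X) = Ide C (Cod C (sr X))"
    and Em_Vm_Comp: "\<lbrakk>m \<in> Ar G; n \<in> Ar G; Cod G m = Dom G n\<rbrakk>
      \<Longrightarrow> Em (m \<Zsemi>\<^bsub>G\<^esub> n) = Em m \<Zsemi> Em n \<and> Vm (m \<Zsemi>\<^bsub>G\<^esub> n) = Vm m \<Zsemi> Vm n"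
    and discr_iff: "X \<in> Ob G \<Longrightarrow> discr X \<longleftrightarrow> Dom C (sr X) = initial_ob C"
begin

lemmas gr_simps [simp] = gr[THEN conjunct1] gr[THEN conjunct2, THEN conjunct1] gr[THEN conjunct2, THEN conjunct2]

lemma sr_tg_simps [simp]:
  assumes "X \<in> Ob G"
  shows "sr X \<in> Ar C" "tg X \<in> Ar C" "Dom C (tg X) = Dom C (sr X)" "Cod C (tg X) = Cod C (sr X)"
    "gr (sr X) (tg X) = X"
  using sr_tg[OF assms] by auto

lemma Em_Vm_simps [simp]:
  assumes "m \<in> Ar G"
  shows "Em m \<in> Ar C" "Vm m \<in> Ar C" "Dom C (Em m) = Dom C (sr (Dom G m))"
    "Cod C (Em m) = Dom C (sr (Cod G m))"
    "Dom C (Vm m) = Cod C (sr (Dom G m))" "Cod C (Vm m) = Cod C (sr (Cod G m))"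
  using Em_Vm[OF assms] by auto

lemma Em_Vm_commute:
  assumes "m \<in> Ar G"
  shows "sr (Dom G m) \<Zsemi> Vm m = Em m \<Zsemi> sr (Cod G m)"
    "tg (Dom G m) \<Zsemi> Vm m = Em m \<Zsemi> tg (Cod G m)"
  using Em_Vm[OF assms] by auto

lemma mor_simps [simp]:
  assumes "X \<in> Ob G" "Y \<in> Ob G" "e \<in> Ar C" "v \<in> Ar C" "Dom C e = Dom C (sr X)"
    "Cod C e = Dom C (sr Y)"
      "Dom C v = Cod C (sr X)" "Cod C v = Cod C (sr Y)" "sr X \<Zsemi> v = e \<Zsemi> sr Y"
        "tg X \<Zsemi> v = e \<Zsemi> tg Y"
  shows "mor X e v Y \<in> Ar G" "Dom G (mor X e v Y) = X" "Cod G (mor X e v Y) = Y"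
    "Em (mor X e v Y) = e" "Vm (mor X e v Y) = v"
  using mor[OF assms] by (auto simp: hom_def)

lemma Em_Vm_Ide_simps [simp]:
  assumes "X \<in> Ob G"
  shows "Em (Ide G X) = Ide C (Dom C (sr X))" "Vm (Ide G X) = Ide C (Cod C (sr X))"
  using Em_Vm_Ide[OF assms] by auto

lemma Em_Vm_Comp_simps [simp]:
  assumes "m \<in> Ar G" "n \<in> Ar G" "Cod G m = Dom G n"
  shows "Em (m \<Zsemi>\<^bsub>G\<^esub> n) = Em m \<Zsemi> Em n"
    "Vm (m \<Zsemi>\<^bsub>G\<^esub> n) = Vm m \<Zsemi> Vm n"
  using Em_Vm_Comp[OF assms] by auto

lemma Ar_G_eqI:
  assumes "m \<in> Ar G" "n \<in> Ar G" "Dom G m = Dom G n" "Cod G m = Cod G n" "Em m = Em n" "Vm m = Vm n"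
  shows "m = n"
  using Em_Vm[OF assms(1)] Em_Vm[OF assms(2)] assms by metis

text \<open>Inverting both components gives a graph morphism again: a commuting square with two
  opposite invertible sides also commutes with their inverses. The auxiliary fact \<open>*\<close>
  is this square, used for sources and for targets.\<close>

lemma iso_G_iff: "m \<in> Ar G \<Longrightarrow> iso G m \<longleftrightarrow> iso C (Em m) \<and> iso C (Vm m)"
proof (intro iffI conjI; (elim conjE)?)
  assume m: "m \<in> Ar G" "iso G m"
  note i = G.iso_simps[OF m(2)]
  have "Em m \<Zsemi> Em (inv_arrow G m) = Ide C (Dom C (sr (Dom G m)))"
    "Em (inv_arrow G m) \<Zsemi> Em m = Ide C (Dom C (sr (Cod G m)))"
    "Vm m \<Zsemi> Vm (inv_arrow G m) = Ide C (Cod C (sr (Dom G m)))"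
    "Vm (inv_arrow G m) \<Zsemi> Vm m = Ide C (Cod C (sr (Cod G m)))"
    using arg_cong[OF i(5), of Em] arg_cong[OF i(6), of Em] arg_cong[OF i(5), of Vm] arg_cong[OF i(6), of Vm] i(1-4)
    by (simp_all del: G.iso_simps add: i(1-4))
  then have "inverse_arrows C (Em m) (Em (inv_arrow G m))" "inverse_arrows C (Vm m) (Vm (inv_arrow G m))"
    using m i(1-4) by (simp_all add: C.inverse_arrows_iff)
  then show "iso C (Em m)" "iso C (Vm m)"
    using C.isoI by blast+
next
  assume m: "m \<in> Ar G" and i: "iso C (Em m)" "iso C (Vm m)"
  have *: "x' \<Zsemi> inv_arrow C (Vm m) = inv_arrow C (Em m) \<Zsemi> x"
    if "x \<in> Ar C" "x' \<in> Ar C" "Dom C x = Dom C (Em m)" "Cod C x = Dom C (Vm m)"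
      "Dom C x' = Cod C (Em m)"
      "Cod C x' = Cod C (Vm m)" "x \<Zsemi> Vm m = Em m \<Zsemi> x'" for x x'
  proof -
    have "Em m \<Zsemi> (x' \<Zsemi> inv_arrow C (Vm m)) = (x \<Zsemi> Vm m) \<Zsemi> inv_arrow C (Vm m)"
      by (rule C.Comp_reassoc[OF that(7)[symmetric]]) (use that i in simp_all)
    also have "\<dots> = x"
      using that(1-6) i by simp
    finally have "Em m \<Zsemi> (x' \<Zsemi> inv_arrow C (Vm m)) = x" .
    then show ?thesis
      using C.iso_cancel(2)[OF i(1), of "x' \<Zsemi> inv_arrow C (Vm m)"] that i by simp
  qed
  let ?n = "mor (Cod G m) (inv_arrow C (Em m)) (inv_arrow C (Vm m)) (Dom G m)"
  have n: "?n \<in> hom G (Cod G m) (Dom G m) \<and> Em ?n = inv_arrow C (Em m) \<and> Vm ?n = inv_arrow C (Vm m)"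
    by (rule mor) (use m i *[of "sr (Dom G m)" "sr (Cod G m)"] *[of "tg (Dom G m)"
      "tg (Cod G m)"] Em_Vm_commute[OF m] in simp_all)
  have "m \<Zsemi>\<^bsub>G\<^esub> ?n = Ide G (Dom G m)" "?n \<Zsemi>\<^bsub>G\<^esub> m = Ide G (Cod G m)"
    by (rule Ar_G_eqI; use m n i in \<open>simp add: hom_def\<close>)+
  then show "iso G m"
    using m n by (intro G.isoI[of m ?n]) (simp add: G.inverse_arrows_iff hom_def)
qed

text \<open>The mediating graph morphism consists of the mediating arrows \<open>e\<close> and
  \<open>w\<close> of the two components. That it respects sources and targets is an equation
  between arrows out of the edge pushout, so it can be checked on the jointly epic legs.\<close>

lemma is_pushout_G:
  assumes fg: "f \<in> Ar G" "g \<in> Ar G" "p \<in> Ar G" "q \<in> Ar G" "Dom G g = Dom G f"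
    "Dom G p = Cod G f" "Dom G q = Cod G g"
      "Cod G q = Cod G p"
    and E: "is_pushout C (Em f) (Em g) (Em p) (Em q)" and V: "is_pushout C (Vm f) (Vm g) (Vm p) (Vm q)"
  shows "is_pushout G f g p q"
proof (rule G.is_pushoutI)
  show "f \<Zsemi>\<^bsub>G\<^esub> p = g \<Zsemi>\<^bsub>G\<^esub> q"
    by (rule Ar_G_eqI) (use fg C.is_pushout_simps(9)[OF E] C.is_pushout_simps(9)[OF V] in simp_all)
next
  fix u v
  assume a: "u \<in> Ar G" "v \<in> Ar G" "Dom G u = Cod G f" "Dom G v = Cod G g" "Cod G u = Cod G v" and
    eq: "f \<Zsemi>\<^bsub>G\<^esub> u = g \<Zsemi>\<^bsub>G\<^esub> v"
  have eq': "Em f \<Zsemi> Em u = Em g \<Zsemi> Em v" "Vm f \<Zsemi> Vm u = Vm g \<Zsemi> Vm v"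
    using arg_cong[OF eq, of Em] arg_cong[OF eq, of Vm] a fg by simp_all
  obtain e where e: "e \<in> Ar C" "Dom C e = Cod C (Em p)" "Cod C e = Cod C (Em u)"
    "Em p \<Zsemi> e = Em u" "Em q \<Zsemi> e = Em v"
    by (rule C.is_pushout_ex[OF E _ _ _ _ _ eq'(1)]) (use a fg in simp_all)
  obtain w where w: "w \<in> Ar C" "Dom C w = Cod C (Vm p)" "Cod C w = Cod C (Vm u)"
    "Vm p \<Zsemi> w = Vm u" "Vm q \<Zsemi> w = Vm v"
    by (rule C.is_pushout_ex[OF V _ _ _ _ _ eq'(2)]) (use a fg in simp_all)
  \<comment> \<open>Stated for generic \<open>x\<close>, \<open>y\<close>, \<open>x1\<close>,
    \<open>x2\<close>, to be used once for the source maps and once for the target maps.\<close>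
  have *: "x \<Zsemi> w = e \<Zsemi> y"
    if "x \<in> Ar C" "y \<in> Ar C" "Dom C x = Cod C (Em p)" "Cod C x = Cod C (Vm p)" "Dom C y = Cod C e"
      "Cod C y = Cod C w"
      "x1 \<in> Ar C" "Dom C x1 = Dom C (Em p)" "Cod C x1 = Dom C (Vm p)"
      "x2 \<in> Ar C" "Dom C x2 = Dom C (Em q)" "Cod C x2 = Dom C (Vm q)"
      "Em p \<Zsemi> x = x1 \<Zsemi> Vm p" "Em q \<Zsemi> x = x2 \<Zsemi> Vm q"
        "x1 \<Zsemi> Vm u = Em u \<Zsemi> y" "x2 \<Zsemi> Vm v = Em v \<Zsemi> y" for x y x1 x2
  proof (rule C.is_pushout_eqI[OF E])
    have "Em p \<Zsemi> (x \<Zsemi> w) = x1 \<Zsemi> (Vm p \<Zsemi> w)"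
      by (rule C.Comp_reassoc2[OF that(13)]) (use that fg w in simp_all)
    also have "\<dots> = Em p \<Zsemi> (e \<Zsemi> y)"
      unfolding w(4) that(15) e(4)[symmetric] by (rule C.Comp_assoc') (use that fg e in simp_all)
    finally show "Em p \<Zsemi> (x \<Zsemi> w) = Em p \<Zsemi> (e \<Zsemi> y)" .
    have "Em q \<Zsemi> (x \<Zsemi> w) = x2 \<Zsemi> (Vm q \<Zsemi> w)"
      by (rule C.Comp_reassoc2[OF that(14)]) (use that fg w in simp_all)
    also have "\<dots> = Em q \<Zsemi> (e \<Zsemi> y)"
      unfolding w(5) that(16) e(5)[symmetric] by (rule C.Comp_assoc') (use that fg e in simp_all)
    finally show "Em q \<Zsemi> (x \<Zsemi> w) = Em q \<Zsemi> (e \<Zsemi> y)" .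
  qed (use that e w in simp_all)
  have "sr (Cod G p) \<Zsemi> w = e \<Zsemi> sr (Cod G u)"
    by (rule *[of _ _ "sr (Cod G f)" "sr (Cod G g)"])
      (use a fg e w Em_Vm_commute[OF fg(3)] Em_Vm_commute[OF fg(4)] Em_Vm_commute[OF a(1)] Em_Vm_commute[OF a(2)] in simp_all)
  moreover have "tg (Cod G p) \<Zsemi> w = e \<Zsemi> tg (Cod G u)"
    by (rule *[of _ _ "tg (Cod G f)" "tg (Cod G g)"])
      (use a fg e w Em_Vm_commute[OF fg(3)] Em_Vm_commute[OF fg(4)] Em_Vm_commute[OF a(1)] Em_Vm_commute[OF a(2)] in simp_all)
  ultimately have m: "mor (Cod G p) e w (Cod G u) \<in> hom G (Cod G p) (Cod G u) \<and>
      Em (mor (Cod G p) e w (Cod G u)) = e \<and> Vm (mor (Cod G p) e w (Cod G u)) = w" (is "?m \<in> _ \<and> _")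
    by (intro mor) (use a fg e w in simp_all)
  have "p \<Zsemi>\<^bsub>G\<^esub> ?m = u" "q \<Zsemi>\<^bsub>G\<^esub> ?m = v"
    by (rule Ar_G_eqI; use a fg e w m in \<open>simp add: hom_def\<close>)+
  then show "\<exists>h. h \<in> Ar G \<and> Dom G h = Cod G p \<and> Cod G h = Cod G u \<and> p \<Zsemi>\<^bsub>G\<^esub> h = u \<and> q \<Zsemi>\<^bsub>G\<^esub> h = v"
    using m by (intro exI[of _ ?m]) (simp add: hom_def)
next
  fix h k
  assume a: "h \<in> Ar G" "k \<in> Ar G" "Dom G h = Cod G p" "Dom G k = Cod G p" "Cod G h = Cod G k"
    and eq: "p \<Zsemi>\<^bsub>G\<^esub> h = p \<Zsemi>\<^bsub>G\<^esub> k"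
      "q \<Zsemi>\<^bsub>G\<^esub> h = q \<Zsemi>\<^bsub>G\<^esub> k"
  have "Em h = Em k"
    by (rule C.is_pushout_eqI[OF E]) (use a fg arg_cong[OF eq(1), of Em] arg_cong[OF eq(2), of Em] in simp_all)
  moreover have "Vm h = Vm k"
    by (rule C.is_pushout_eqI[OF V]) (use a fg arg_cong[OF eq(1), of Vm] arg_cong[OF eq(2), of Vm] in simp_all)
  ultimately show "h = k"
    using a by (intro Ar_G_eqI) simp_all
qed (use fg in simp_all)

text \<open>Edges and vertices are glued separately in \<open>C\<close>; the universal property of
  the edge pushout then induces source and target of the glued graph.\<close>

lemma ex_pushout_G:
  assumes fg: "f \<in> Ar G" "g \<in> Ar G" "Dom G f = Dom G g"
  shows "\<exists>p q. is_pushout G f g p q"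
proof -
  obtain pe qe where E: "is_pushout C (Em f) (Em g) pe qe"
    using C.ex_pushout[of "Em f" "Em g"] fg by auto
  obtain pv qv where V: "is_pushout C (Vm f) (Vm g) pv qv"
    using C.ex_pushout[of "Vm f" "Vm g"] fg by auto
  note s = C.is_pushout_simps[OF E] C.is_pushout_simps[OF V]
  \<comment> \<open>\<open>z\<close> becomes the source or target map of the glued graph;
    \<open>x\<close> and \<open>y\<close> are those of the two graphs and \<open>w\<close> that of
    the shared one.\<close>
  have ex: "\<exists>z. z \<in> Ar C \<and> Dom C z = Cod C pe \<and> Cod C z = Cod C pv \<and> x \<Zsemi> pv = pe \<Zsemi> z \<and> y \<Zsemi> qv = qe \<Zsemi> z"
    if x: "x \<in> Ar C" "y \<in> Ar C" "Dom C x = Cod C (Em f)" "Cod C x = Cod C (Vm f)"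
      "Dom C y = Cod C (Em g)" "Cod C y = Cod C (Vm g)"
      "w \<in> Ar C" "Dom C w = Dom C (Em f)" "Cod C w = Dom C (Vm f)"
      "w \<Zsemi> Vm f = Em f \<Zsemi> x" "w \<Zsemi> Vm g = Em g \<Zsemi> y" for x y w
  proof -
    have "Em f \<Zsemi> (x \<Zsemi> pv) = w \<Zsemi> (Vm f \<Zsemi> pv)"
      by (rule C.Comp_reassoc2[OF that(10)[symmetric]]) (use that s fg in simp_all)
    also have "\<dots> = Em g \<Zsemi> (y \<Zsemi> qv)"
      unfolding s(18) by (rule C.Comp_reassoc2[OF that(11)]) (use that s fg in simp_all)
    finally have "Em f \<Zsemi> (x \<Zsemi> pv) = Em g \<Zsemi> (y \<Zsemi> qv)" .
    note eq = this
    obtain z where "z \<in> Ar C" "Dom C z = Cod C pe" "Cod C z = Cod C (x \<Zsemi> pv)"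
      "pe \<Zsemi> z = x \<Zsemi> pv" "qe \<Zsemi> z = y \<Zsemi> qv"
      by (rule C.is_pushout_ex[OF E _ _ _ _ _ eq]) (simp_all add: x s fg)
    then show ?thesis
      using that s by (intro exI[of _ z]) simp
  qed
  obtain s' where s': "s' \<in> Ar C" "Dom C s' = Cod C pe" "Cod C s' = Cod C pv"
    "sr (Cod G f) \<Zsemi> pv = pe \<Zsemi> s'" "sr (Cod G g) \<Zsemi> qv = qe \<Zsemi> s'"
    using ex[of "sr (Cod G f)" "sr (Cod G g)"
      "sr (Dom G f)"] fg Em_Vm_commute[OF fg(1)] Em_Vm_commute[OF fg(2)] by auto
  obtain t' where t': "t' \<in> Ar C" "Dom C t' = Cod C pe" "Cod C t' = Cod C pv"
    "tg (Cod G f) \<Zsemi> pv = pe \<Zsemi> t'" "tg (Cod G g) \<Zsemi> qv = qe \<Zsemi> t'"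
    using ex[of "tg (Cod G f)" "tg (Cod G g)"
      "tg (Dom G f)"] fg Em_Vm_commute[OF fg(1)] Em_Vm_commute[OF fg(2)] by auto
  have "is_pushout G f g (mor (Cod G f) pe pv (gr s' t')) (mor (Cod G g) qe qv (gr s' t'))"
    by (rule is_pushout_G) (use fg s s' t' E V in simp_all)
  then show ?thesis
    by blast
qed

text \<open>Componentwise like pushouts: compatibility with source and target is tested on the
  injections of the edge coproduct.\<close>

lemma is_coproduct_G:
  assumes ij: "i \<in> Ar G" "j \<in> Ar G" "Cod G j = Cod G i"
    and E: "is_coproduct C (Dom C (Em i)) (Dom C (Em j)) (Cod C (Em i)) (Em i) (Em j)"
    and V: "is_coproduct C (Dom C (Vm i)) (Dom C (Vm j)) (Cod C (Vm i)) (Vm i) (Vm j)"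
  shows "is_coproduct G (Dom G i) (Dom G j) (Cod G i) i j"
proof (rule G.is_coproductI)
  fix u v
  assume a: "u \<in> Ar G" "v \<in> Ar G" "Dom G u = Dom G i" "Dom G v = Dom G j" "Cod G u = Cod G v"
  have "\<exists>!e. e \<in> Ar C \<and> Dom C e = Cod C (Em i) \<and> Cod C e = Cod C (Em u) \<and> Em i \<Zsemi> e = Em u \<and> Em j \<Zsemi> e = Em v"
    by (rule C.is_coproduct_ex1[OF E]) (use a ij in simp_all)
  then obtain e where e: "e \<in> Ar C" "Dom C e = Cod C (Em i)" "Cod C e = Cod C (Em u)"
    "Em i \<Zsemi> e = Em u" "Em j \<Zsemi> e = Em v"
    by blast
  have "\<exists>!w. w \<in> Ar C \<and> Dom C w = Cod C (Vm i) \<and> Cod C w = Cod C (Vm u) \<and> Vm i \<Zsemi> w = Vm u \<and> Vm j \<Zsemi> w = Vm v"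
    by (rule C.is_coproduct_ex1[OF V]) (use a ij in simp_all)
  then obtain w where w: "w \<in> Ar C" "Dom C w = Cod C (Vm i)" "Cod C w = Cod C (Vm u)"
    "Vm i \<Zsemi> w = Vm u" "Vm j \<Zsemi> w = Vm v"
    by blast
  have *: "x \<Zsemi> w = e \<Zsemi> y"
    if "x \<in> Ar C" "y \<in> Ar C" "Dom C x = Cod C (Em i)" "Cod C x = Cod C (Vm i)" "Dom C y = Cod C e"
      "Cod C y = Cod C w"
      "x1 \<in> Ar C" "Dom C x1 = Dom C (Em i)" "Cod C x1 = Dom C (Vm i)"
      "x2 \<in> Ar C" "Dom C x2 = Dom C (Em j)" "Cod C x2 = Dom C (Vm j)"
      "Em i \<Zsemi> x = x1 \<Zsemi> Vm i" "Em j \<Zsemi> x = x2 \<Zsemi> Vm j"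
        "x1 \<Zsemi> Vm u = Em u \<Zsemi> y" "x2 \<Zsemi> Vm v = Em v \<Zsemi> y" for x y x1 x2
  proof (rule C.is_coproduct_eqI[OF E])
    have "Em i \<Zsemi> (x \<Zsemi> w) = x1 \<Zsemi> (Vm i \<Zsemi> w)"
      by (rule C.Comp_reassoc2[OF that(13)]) (use that ij w in simp_all)
    also have "\<dots> = Em i \<Zsemi> (e \<Zsemi> y)"
      unfolding w(4) that(15) e(4)[symmetric] by (rule C.Comp_assoc') (use that ij e in simp_all)
    finally show "Em i \<Zsemi> (x \<Zsemi> w) = Em i \<Zsemi> (e \<Zsemi> y)" .
    have "Em j \<Zsemi> (x \<Zsemi> w) = x2 \<Zsemi> (Vm j \<Zsemi> w)"
      by (rule C.Comp_reassoc2[OF that(14)]) (use that ij w in simp_all)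
    also have "\<dots> = Em j \<Zsemi> (e \<Zsemi> y)"
      unfolding w(5) that(16) e(5)[symmetric] by (rule C.Comp_assoc') (use that ij e in simp_all)
    finally show "Em j \<Zsemi> (x \<Zsemi> w) = Em j \<Zsemi> (e \<Zsemi> y)" .
  qed (use that e w in simp_all)
  have "sr (Cod G i) \<Zsemi> w = e \<Zsemi> sr (Cod G u)"
    by (rule *[of _ _ "sr (Dom G i)" "sr (Dom G j)"])
      (use a ij e w Em_Vm_commute[OF ij(1)] Em_Vm_commute[OF ij(2)] Em_Vm_commute[OF a(1)] Em_Vm_commute[OF a(2)] in simp_all)
  moreover have "tg (Cod G i) \<Zsemi> w = e \<Zsemi> tg (Cod G u)"
    by (rule *[of _ _ "tg (Dom G i)" "tg (Dom G j)"])
      (use a ij e w Em_Vm_commute[OF ij(1)] Em_Vm_commute[OF ij(2)] Em_Vm_commute[OF a(1)] Em_Vm_commute[OF a(2)] in simp_all)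
  ultimately have m: "mor (Cod G i) e w (Cod G u) \<in> hom G (Cod G i) (Cod G u) \<and>
      Em (mor (Cod G i) e w (Cod G u)) = e \<and> Vm (mor (Cod G i) e w (Cod G u)) = w" (is "?m \<in> _ \<and> _")
    by (intro mor) (use a ij e w in simp_all)
  have "i \<Zsemi>\<^bsub>G\<^esub> ?m = u" "j \<Zsemi>\<^bsub>G\<^esub> ?m = v"
    by (rule Ar_G_eqI; use a ij e w m in \<open>simp add: hom_def\<close>)+
  then show "\<exists>h. h \<in> Ar G \<and> Dom G h = Cod G i \<and> Cod G h = Cod G u \<and> i \<Zsemi>\<^bsub>G\<^esub> h = u \<and> j \<Zsemi>\<^bsub>G\<^esub> h = v"
    using m by (intro exI[of _ ?m]) (simp add: hom_def)
next
  fix h k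
  assume a: "h \<in> Ar G" "k \<in> Ar G" "Dom G h = Cod G i" "Dom G k = Cod G i" "Cod G h = Cod G k"
    and eq: "i \<Zsemi>\<^bsub>G\<^esub> h = i \<Zsemi>\<^bsub>G\<^esub> k"
      "j \<Zsemi>\<^bsub>G\<^esub> h = j \<Zsemi>\<^bsub>G\<^esub> k"
  have "Em h = Em k"
    by (rule C.is_coproduct_eqI[OF E]) (use a ij arg_cong[OF eq(1), of Em] arg_cong[OF eq(2), of Em] in simp_all)
  moreover have "Vm h = Vm k"
    by (rule C.is_coproduct_eqI[OF V]) (use a ij arg_cong[OF eq(1), of Vm] arg_cong[OF eq(2), of Vm] in simp_all)
  ultimately show "h = k"
    using a by (intro Ar_G_eqI) simp_all
qed (use ij in simp_all)

text \<open>A coproduct of graphs with known source and target; the one picked by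
  \<open>coprod_ob\<close> is isomorphic to it but otherwise arbitrary.\<close>

definition graph_coprod where
  "graph_coprod X Y = gr (coprod_ar C (sr X) (sr Y)) (coprod_ar C (tg X) (tg Y))"

definition graph_inj1 where
  "graph_inj1 X Y = mor X (inj1 C (Dom C (sr X)) (Dom C (sr Y))) (inj1 C (Cod C (sr X)) (Cod C (sr Y))) (graph_coprod X Y)"

definition graph_inj2 where
  "graph_inj2 X Y = mor Y (inj2 C (Dom C (sr X)) (Dom C (sr Y))) (inj2 C (Cod C (sr X)) (Cod C (sr Y))) (graph_coprod X Y)"

lemma graph_inj_simps [simp]:
  assumes "X \<in> Ob G" "Y \<in> Ob G"
  shows "graph_coprod X Y \<in> Ob G" "graph_inj1 X Y \<in> Ar G" "Dom G (graph_inj1 X Y) = X"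
    "Cod G (graph_inj1 X Y) = graph_coprod X Y"
    "graph_inj2 X Y \<in> Ar G" "Dom G (graph_inj2 X Y) = Y" "Cod G (graph_inj2 X Y) = graph_coprod X Y"
    "Em (graph_inj1 X Y) = inj1 C (Dom C (sr X)) (Dom C (sr Y))"
      "Vm (graph_inj1 X Y) = inj1 C (Cod C (sr X)) (Cod C (sr Y))"
    "Em (graph_inj2 X Y) = inj2 C (Dom C (sr X)) (Dom C (sr Y))"
      "Vm (graph_inj2 X Y) = inj2 C (Cod C (sr X)) (Cod C (sr Y))"
  using assms by (simp_all add: graph_coprod_def graph_inj1_def graph_inj2_def)

lemma is_coproduct_graph_coprod:
  assumes "X \<in> Ob G" "Y \<in> Ob G"
  shows "is_coproduct G X Y (graph_coprod X Y) (graph_inj1 X Y) (graph_inj2 X Y)"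
  using is_coproduct_G[of "graph_inj1 X Y" "graph_inj2 X Y"] C.is_coproduct_coprod assms by simp

section \<open>Discrete graphs and the comparison of tensors\<close>

definition discrete_graph :: "'o \<Rightarrow> 'p" where
  "discrete_graph A = gr (from_initial C A) (from_initial C A)"

lemma discrete_graph_simps [simp]:
  assumes "A \<in> Ob C"
  shows "discrete_graph A \<in> Ob G" "sr (discrete_graph A) = from_initial C A"
    "tg (discrete_graph A) = from_initial C A"
    "discr (discrete_graph A)"
  using assms by (simp_all add: discrete_graph_def discr_iff)

text \<open>An equality and not just an isomorphism: \<open>discr\<close> fixes the edge object to
  be the chosen initial one, and source and target out of it are unique. Bijectivity on objects
  rests on this.\<close>

lemma discr_iff_discrete_graph:
  assumes "X \<in> Ob G"
  shows "discr X \<longleftrightarrow> X = discrete_graph (Cod C (sr X))"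
proof
  assume "discr X"
  then have "sr X = from_initial C (Cod C (sr X))" "tg X = from_initial C (Cod C (sr X))"
    using assms by (auto simp: discr_iff intro!: C.from_initial_eqI)
  then show "X = discrete_graph (Cod C (sr X))"
    unfolding discrete_graph_def using assms by (metis sr_tg_simps(5))
next
  assume "X = discrete_graph (Cod C (sr X))"
  then show "discr X"
    using assms by (metis discrete_graph_simps(4) C.Cod_Ob sr_tg_simps(1))
qed

text \<open>\<open>leg a X\<close> is the transpose of \<open>a\<close> under the adjunction between discrete graphs and vertices.\<close>

definition leg :: "'m \<Rightarrow> 'p \<Rightarrow> 'n" where
  "leg a X = mor (discrete_graph (Dom C a)) (from_initial C (Dom C (sr X))) a X"

lemma leg_simps [simp]:
  assumes "a \<in> Ar C" "X \<in> Ob G" "Cod C a = Cod C (sr X)"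
  shows "leg a X \<in> Ar G" "Dom G (leg a X) = discrete_graph (Dom C a)" "Cod G (leg a X) = X"
    "Em (leg a X) = from_initial C (Dom C (sr X))" "Vm (leg a X) = a"
  using assms by (simp_all add: leg_def)

text \<open>The edge component starts at the initial object, so it is forced, and the vertex
  component determines the morphism.\<close>

lemma leg_eqI:
  assumes "m \<in> Ar G" "Dom G m = discrete_graph A" "A \<in> Ob C" "Cod G m = X" "Vm m = a"
  shows "m = leg a X"
proof -
  have "a \<in> Ar C" "X \<in> Ob G" "Cod C a = Cod C (sr X)" "Dom C a = A"
    using assms Em_Vm_simps[OF assms(1)] by auto
  moreover have "Em m = from_initial C (Dom C (sr X))"
    by (rule C.from_initial_eqI) (use assms in auto)
  ultimately show ?thesis
    using assms by (intro Ar_G_eqI) simp_all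
qed

definition discrete_map :: "'m \<Rightarrow> 'n" where
  "discrete_map f = leg f (discrete_graph (Cod C f))"

lemma discrete_map_simps [simp]:
  assumes "f \<in> Ar C"
  shows "discrete_map f \<in> Ar G" "Dom G (discrete_map f) = discrete_graph (Dom C f)"
    "Cod G (discrete_map f) = discrete_graph (Cod C f)" "Em (discrete_map f) = Ide C (initial_ob C)"
      "Vm (discrete_map f) = f"
  using assms C.from_initial_eqI[of "from_initial C (initial_ob C)"
    "Ide C (initial_ob C)"] by (simp_all add: discrete_map_def)

lemma discrete_map_leg [simp]:
  assumes "f \<in> Ar C" "a \<in> Ar C" "Cod C f = Dom C a" "X \<in> Ob G" "Cod C a = Cod C (sr X)"
  shows "discrete_map f \<Zsemi>\<^bsub>G\<^esub> leg a X = leg (f \<Zsemi> a) X"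
  by (rule leg_eqI[of _ "Dom C f"]) (use assms in simp_all)

lemma leg_Comp:
  assumes "a \<in> Ar C" "X \<in> Ob G" "Cod C a = Cod C (sr X)" "m \<in> Ar G" "Dom G m = X"
  shows "leg a X \<Zsemi>\<^bsub>G\<^esub> m = leg (a \<Zsemi> Vm m) (Cod G m)"
  by (rule leg_eqI[of _ "Dom C a"]) (use assms in simp_all)

lemma discrete_map_Comp [simp]:
  assumes "f \<in> Ar C" "g \<in> Ar C" "Cod C f = Dom C g"
  shows "discrete_map f \<Zsemi>\<^bsub>G\<^esub> discrete_map g = discrete_map (f \<Zsemi> g)"
  using assms by (simp add: discrete_map_def[of g] discrete_map_def[of "f \<Zsemi> g"])

lemma discrete_map_Ide [simp]: "A \<in> Ob C \<Longrightarrow> discrete_map (Ide C A) = Ide G (discrete_graph A)"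
  by (rule Ar_G_eqI) simp_all

lemma is_coproduct_discrete:
  assumes "A \<in> Ob C" "B \<in> Ob C"
  shows "is_coproduct G (discrete_graph A) (discrete_graph B) (discrete_graph (coprod_ob C A B))
    (discrete_map (inj1 C A B)) (discrete_map (inj2 C A B))"
  using is_coproduct_G[of "discrete_map (inj1 C A B)" "discrete_map (inj2 C A B)"]
    C.is_coproduct_coprod C.is_coproduct_initial assms by simp

lemma is_initial_discrete: "is_initial G (discrete_graph (initial_ob C))"
  unfolding is_initial_def
proof (intro conjI ballI)
  fix X assume X: "X \<in> Ob G"
  show "\<exists>!m. m \<in> hom G (discrete_graph (initial_ob C)) X"
  proof (rule ex1I[of _ "leg (from_initial C (Cod C (sr X))) X"])
    show "leg (from_initial C (Cod C (sr X))) X \<in> hom G (discrete_graph (initial_ob C)) X"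
      using X by (simp add: hom_def)
  next
    fix m assume m: "m \<in> hom G (discrete_graph (initial_ob C)) X"
    then have "Vm m = from_initial C (Cod C (sr X))"
      by (intro C.from_initial_eqI) (use X in \<open>auto simp: hom_def\<close>)
    then show "m = leg (from_initial C (Cod C (sr X))) X"
      using m by (intro leg_eqI[of _ "initial_ob C"]) (auto simp: hom_def)
  qed
qed simp

sublocale G: finitely_cocomplete G
proof
  show "\<exists>Z. is_initial G Z"
    using is_initial_discrete by blast
  show "\<exists>P i j. is_coproduct G A B P i j" if "A \<in> Ob G" "B \<in> Ob G" for A B
    using is_coproduct_graph_coprod[OF that] by blast
  show "\<exists>p q. is_pushout G f g p q" if "f \<in> Ar G" "g \<in> Ar G" "Dom G f = Dom G g" for f g
    by (rule ex_pushout_G[OF that])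
qed

text \<open>The edge object of the codomain is isomorphic to an initial one, hence initial, hence
  equal to the chosen one by \<open>initial_unique\<close>.\<close>

lemma iso_imp_discr:
  assumes "iso G m" "discr (Dom G m)"
  shows "discr (Cod G m)"
proof -
  have "iso C (Em m)" "Dom C (Em m) = initial_ob C"
    using assms iso_G_iff[of m] by (auto simp: discr_iff)
  then have "is_initial C (Cod C (Em m))"
    using C.is_initial_iso[OF C.is_initial_initial_ob] by simp
  then show ?thesis
    using assms initial_unique by (simp add: discr_iff)
qed

lemma discr_initial_ob: "discr (initial_ob G)"
  using iso_imp_discr[of "inv_arrow G (from_initial G (discrete_graph (initial_ob C)))"]
    G.iso_from_initial[OF is_initial_discrete] by simp

text \<open>Compares the chosen coproduct of two discrete graphs with the discrete graph on the
  chosen coproduct of their vertices; seen as a cospan it becomes the structure map of the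
  functor.\<close>

definition discrete_mu :: "'o \<Rightarrow> 'o \<Rightarrow> 'n" where
  "discrete_mu A B = copair G (discrete_map (inj1 C A B)) (discrete_map (inj2 C A B))"

lemma discrete_mu_simps [simp]:
  assumes "A \<in> Ob C" "B \<in> Ob C"
  shows "discrete_mu A B \<in> Ar G"
    "Dom G (discrete_mu A B) = coprod_ob G (discrete_graph A) (discrete_graph B)"
    "Cod G (discrete_mu A B) = discrete_graph (coprod_ob C A B)" "iso G (discrete_mu A B)"
proof -
  show *: "discrete_mu A B \<in> Ar G"
    "Dom G (discrete_mu A B) = coprod_ob G (discrete_graph A) (discrete_graph B)"
    "Cod G (discrete_mu A B) = discrete_graph (coprod_ob C A B)"
    using assms by (simp_all add: discrete_mu_def)
  show "iso G (discrete_mu A B)"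
    by (rule G.is_coproduct_unique[OF G.is_coproduct_coprod is_coproduct_discrete[OF assms]])
      (use assms * in \<open>simp_all add: discrete_mu_def\<close>)
qed

lemma discr_coprod_ob:
  assumes "X \<in> Ob G" "Y \<in> Ob G" "discr X" "discr Y"
  shows "discr (coprod_ob G X Y)"
proof -
  obtain A B where "A \<in> Ob C" "B \<in> Ob C" "X = discrete_graph A" "Y = discrete_graph B"
    using assms discr_iff_discrete_graph sr_tg_simps(1) C.Cod_Ob by metis
  then show ?thesis
    using iso_imp_discr[of "inv_arrow G (discrete_mu A B)"] by simp
qed

lemma symmetric_monoidal_discrete: "symmetric_monoidal_category (full_subcategory (Cospan G) discr)"
  by (rule symmetric_monoidal_category.symmetric_monoidal_full_subcategory[OF G.symmetric_monoidal_Cospan])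
    (simp_all add: discr_initial_ob discr_coprod_ob)

end

section \<open>Stateful processes in cospans\<close>

lemma St_simps [simp]:
  "Ob (St C) = Ob C"
  "Dom (St C) = fst"
  "Cod (St C) = (\<lambda>x. snd (snd x))"
  "Ide (St C) = (\<lambda>A. st_arrow C A A (Unit C) (Ide C (TensorOb C (Unit C) A)))"
  "Comp (St C) = st_comp C"
  "Unit (St C) = Unit C"
  "TensorOb (St C) = TensorOb C"
  "TensorAr (St C) = st_tensor C"
  "Assoc (St C) = (\<lambda>A B D. st_of C (Assoc C A B D))"
  "LUnit (St C) = (\<lambda>A. st_of C (LUnit C A))"
  "RUnit (St C) = (\<lambda>A. st_of C (RUnit C A))"
  "Sym (St C) = (\<lambda>A B. st_of C (Sym C A B))"
  by (auto simp: St_def fun_eq_iff)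

context finitely_cocomplete
begin

lemma inv_arrow_cospan_of [simp]: "iso C f \<Longrightarrow> inv_arrow (Cospan C) (cospan_of C f) = cospan_of C (inv_arrow C f)"
  using category.inv_arrow_eq[OF symmetric_monoidal_category.axioms(1)[OF symmetric_monoidal_Cospan]]
    inverse_arrows_cospan_of by blast

lemma cospan_tensor_Ide [simp]:
  assumes "l \<in> Ar C" "r \<in> Ar C" "Cod C l = Cod C r" "A \<in> Ob C"
  shows "cospan_tensor C (cospan_of C (Ide C A)) (cospan_arrow C l r) =
      cospan_arrow C (coprod_ar C (Ide C A) l) (coprod_ar C (Ide C A) r)"
    "cospan_tensor C (cospan_arrow C l r) (cospan_of C (Ide C A)) =
      cospan_arrow C (coprod_ar C l (Ide C A)) (coprod_ar C r (Ide C A))"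
  using assms by (simp_all add: cospan_of_def)

text \<open>A process with state space \<open>S\<close> is a cospan \<open>S \<odot> A \<rightarrow> V \<leftarrow> S \<odot> B\<close>, that is, a graph \<open>s, t : S \<rightrightarrows> V\<close>
  together with \<open>a : A \<rightarrow> V\<close> and \<open>b : B \<rightarrow> V\<close>.\<close>

definition process_data :: "'b \<Rightarrow> 'b \<Rightarrow> 'b \<Rightarrow> 'b \<Rightarrow> bool" where
  "process_data s t a b \<longleftrightarrow> s \<in> Ar C \<and> t \<in> Ar C \<and> a \<in> Ar C \<and> b \<in> Ar C \<and> Dom C t = Dom C s \<and>
     Cod C t = Cod C s \<and> Cod C a = Cod C s \<and> Cod C b = Cod C s"

definition process :: "'b \<Rightarrow> 'b \<Rightarrow> 'b \<Rightarrow> 'b \<Rightarrow> ('a, ('a, 'b) cospan_arrow) st_arrow" where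
  "process s t a b =
     st_arrow (Cospan C) (Dom C a) (Dom C b) (Dom C s) (cospan_arrow C (copair C s a) (copair C t b))"

abbreviation process_class where
  "process_class s t a b \<equiv>
     st_class (Cospan C) (Dom C a) (Dom C b) (Dom C s) (cospan_arrow C (copair C s a) (copair C t b))"

text \<open>State isomorphisms in \<open>Cospan C\<close> come from isomorphisms \<open>h\<close> of
  \<open>C\<close>. Conjugating by \<open>h\<close> precomposes \<open>s\<close> and
  \<open>t\<close> with the inverse of \<open>h\<close>, which is the \<open>k\<close> of the
  statement, while \<open>a\<close> and \<open>b\<close> stay fixed.\<close>

lemma in_process_class_iff:
  assumes d: "process_data s t a b"
  shows "(T, g) \<in> process_class s t a b \<longleftrightarrow>
    (\<exists>k. iso C k \<and> Dom C k = T \<and> Cod C k = Dom C s \<and>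
       g = cospan_arrow C (copair C (k \<Zsemi> s) a) (copair C (k \<Zsemi> t) b))"
proof -
  have *: "cospan_comp C (cospan_comp C (cospan_tensor C (cospan_of C (inv_arrow C h)) (cospan_of C (Ide C (Dom C a))))
      (cospan_arrow C (copair C s a) (copair C t b))) (cospan_tensor C (cospan_of C h) (cospan_of C (Ide C (Dom C b)))) =
    cospan_arrow C (copair C (inv_arrow C h \<Zsemi> s) a) (copair C (inv_arrow C h \<Zsemi> t) b)"
    if "iso C h" "Dom C h = Dom C s" for h
    using that d by (simp add: process_data_def)
  show ?thesis
  proof
    assume "(T, g) \<in> process_class s t a b"
    then obtain h k where hk: "h \<in> hom (Cospan C) (Dom C s) T" "inverse_arrows (Cospan C) h k"
      and g: "g = cospan_comp C (cospan_comp C (cospan_tensor C k (cospan_of C (Ide C (Dom C a))))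
        (cospan_arrow C (copair C s a) (copair C t b))) (cospan_tensor C h (cospan_of C (Ide C (Dom C b))))"
      by (auto simp: st_class_def)
    obtain h0 where h0: "iso C h0" "h = cospan_of C h0" "k = cospan_of C (inv_arrow C h0)"
      using inverse_arrows_CospanE[OF hk(2)] .
    then have "Dom C h0 = Dom C s" "Cod C h0 = T"
      using hk(1) by (simp_all add: hom_def)
    then show "\<exists>k. iso C k \<and> Dom C k = T \<and> Cod C k = Dom C s \<and>
       g = cospan_arrow C (copair C (k \<Zsemi> s) a) (copair C (k \<Zsemi> t) b)"
      using * h0 g by (intro exI[of _ "inv_arrow C h0"]) simp
  next
    assume "\<exists>k. iso C k \<and> Dom C k = T \<and> Cod C k = Dom C s \<and>
       g = cospan_arrow C (copair C (k \<Zsemi> s) a) (copair C (k \<Zsemi> t) b)"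
    then obtain k where k: "iso C k" "Dom C k = T" "Cod C k = Dom C s"
      "g = cospan_arrow C (copair C (k \<Zsemi> s) a) (copair C (k \<Zsemi> t) b)"
      by blast
    then have "cospan_of C (inv_arrow C k) \<in> hom (Cospan C) (Dom C s) T"
      "inverse_arrows (Cospan C) (cospan_of C (inv_arrow C k)) (cospan_of C k)"
      using inverse_arrows_cospan_of[of "inv_arrow C k"] by (simp_all add: hom_def)
    moreover have "g = cospan_comp C (cospan_comp C (cospan_tensor C (cospan_of C k) (cospan_of C (Ide C (Dom C a))))
      (cospan_arrow C (copair C s a) (copair C t b)))
      (cospan_tensor C (cospan_of C (inv_arrow C k)) (cospan_of C (Ide C (Dom C b))))"
      using *[of "inv_arrow C k"] k by simp
    ultimately show "(T, g) \<in> process_class s t a b"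
      unfolding st_class_def Cospan_simps by blast
  qed
qed

lemma process_class_refl:
  assumes "process_data s t a b"
  shows "(Dom C s, cospan_arrow C (copair C s a) (copair C t b)) \<in> process_class s t a b"
  unfolding in_process_class_iff[OF assms]
  using assms by (intro exI[of _ "Ide C (Dom C s)"]) (simp add: process_data_def)

text \<open>One inclusion is enough, since the same statement for the inverse renamings gives the
  other.\<close>

lemma process_class_mono:
  assumes d: "process_data s t a b" "process_data s' t' a' b'" and
    e: "iso C e" "Dom C e = Dom C s" "Cod C e = Dom C s'" and v: "iso C v" "Dom C v = Cod C s"
    and eq: "s \<Zsemi> v = e \<Zsemi> s'" "t \<Zsemi> v = e \<Zsemi> t'" "a \<Zsemi> v = a'"
      "b \<Zsemi> v = b'"
  shows "process_class s t a b \<subseteq> process_class s' t' a' b'"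
proof clarify
  fix T g A X B
  assume "(T, A, X, B) \<in> process_class s t a b"
  then obtain k where k: "iso C k" "Dom C k = T" "Cod C k = Dom C s"
    "(A, X, B) = cospan_arrow C (copair C (k \<Zsemi> s) a) (copair C (k \<Zsemi> t) b)"
    unfolding in_process_class_iff[OF d(1)] by blast
  note k(4)
  also have "cospan_arrow C (copair C (k \<Zsemi> s) a) (copair C (k \<Zsemi> t) b) = cospan_arrow C (copair C (k \<Zsemi> s) a \<Zsemi> v) (copair C (k \<Zsemi> t) b \<Zsemi> v)"
    by (rule cospan_arrow_iso[symmetric]) (use k d v in \<open>simp_all add: process_data_def del: copair_Comp\<close>)
  also have "\<dots> = cospan_arrow C (copair C ((k \<Zsemi> e) \<Zsemi> s') a') (copair C ((k \<Zsemi> e) \<Zsemi> t') b')"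
    using k d e v eq by (simp add: process_data_def)
  finally show "(T, A, X, B) \<in> process_class s' t' a' b'"
    unfolding in_process_class_iff[OF d(2)] using k(1-3) e by (intro exI[of _ "k \<Zsemi> e"]) simp
qed

text \<open>\<open>e\<close> renames states, the quotient built into \<open>St\<close>;
  \<open>v\<close> renames apexes, the quotient built into cospans. The laws of processes below are
  proved by exhibiting such a pair.\<close>

lemma process_eqI:
  assumes e: "iso C e" and v: "iso C v" and d: "process_data s t a b" "process_data s' t' a' b'" and
    t: "Dom C e = Dom C s" "Cod C e = Dom C s'" "Dom C v = Cod C s" "Cod C v = Cod C s'"
    and eq: "s \<Zsemi> v = e \<Zsemi> s'" "t \<Zsemi> v = e \<Zsemi> t'" "a \<Zsemi> v = a'"
      "b \<Zsemi> v = b'"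
  shows "process s t a b = process s' t' a' b'"
proof -
  \<comment> \<open>The conditions on \<open>s\<close> and \<open>t\<close>, turned around along the
    inverses of \<open>e\<close> and \<open>v\<close>.\<close>
  have *: "x' \<Zsemi> inv_arrow C v = inv_arrow C e \<Zsemi> x"
    if "x \<in> Ar C" "x' \<in> Ar C" "Dom C x = Dom C s" "Cod C x = Cod C s" "Dom C x' = Dom C s'"
      "Cod C x' = Cod C s'"
      "x \<Zsemi> v = e \<Zsemi> x'" for x x'
  proof -
    have "inv_arrow C e \<Zsemi> (x \<Zsemi> v) = x'"
      unfolding that(7) using that(1-6) e t by simp
    then have "x' \<Zsemi> inv_arrow C v = (inv_arrow C e \<Zsemi> (x \<Zsemi> v)) \<Zsemi> inv_arrow C v"
      by simp
    then show ?thesis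
      using that(1-6) e v t by simp
  qed
  have "process_class s' t' a' b' \<subseteq> process_class s t a b"
    by (rule process_class_mono[where e = "inv_arrow C e" and v = "inv_arrow C v"])
      (use d e v t * eq(1,2) eq(3,4)[symmetric] in \<open>simp_all add: process_data_def\<close>)
  moreover have "process_class s t a b \<subseteq> process_class s' t' a' b'"
    by (rule process_class_mono[OF d e t(1,2) v t(3) eq])
  moreover have "Dom C a = Dom C a'" "Dom C b = Dom C b'"
    using eq(3,4)[symmetric] d v t by (simp_all add: process_data_def)
  ultimately show ?thesis
    by (simp add: process_def st_arrow_def)
qed

text \<open>The second quadruple represents a member of the class of the first process. Membership
  gives the state renaming (its inverse is \<open>e\<close>), and the resulting equality of cospans
  gives \<open>v\<close>; copairings are then compared component by component.\<close>

lemma process_eqE: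
  assumes "process s t a b = process s' t' a' b'" and d: "process_data s t a b" "process_data s' t' a' b'"
  obtains e v where "iso C e" "iso C v" "Dom C e = Dom C s" "Cod C e = Dom C s'" "Dom C v = Cod C s"
    "Cod C v = Cod C s'"
    "s \<Zsemi> v = e \<Zsemi> s'" "t \<Zsemi> v = e \<Zsemi> t'" "a \<Zsemi> v = a'" "b \<Zsemi> v = b'"
proof -
  have D: "Dom C a = Dom C a'" "Dom C b = Dom C b'" and "process_class s t a b = process_class s' t' a' b'"
    using assms(1) unfolding process_def st_arrow_def prod.inject by blast+
  then have "(Dom C s', cospan_arrow C (copair C s' a') (copair C t' b')) \<in> process_class s t a b"
    using process_class_refl[OF d(2)] by simp
  then obtain k where k: "iso C k" "Dom C k = Dom C s'" "Cod C k = Dom C s"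
    and eq: "cospan_arrow C (copair C s' a') (copair C t' b') = cospan_arrow C (copair C (k \<Zsemi> s) a) (copair C (k \<Zsemi> t) b)"
    unfolding in_process_class_iff[OF d(1)] by blast
  obtain v where v: "iso C v" "Dom C v = Cod C (copair C (k \<Zsemi> s) a)"
    "copair C s' a' = copair C (k \<Zsemi> s) a \<Zsemi> v"
    "copair C t' b' = copair C (k \<Zsemi> t) b \<Zsemi> v"
    by (rule cospan_arrow_eqE[OF eq[symmetric]]) (use d in \<open>simp_all add: process_data_def\<close>)
  have v2: "Dom C v = Cod C s"
    using v(2) k d by (simp add: process_data_def)
  have "copair C s' a' = copair C (k \<Zsemi> (s \<Zsemi> v)) (a \<Zsemi> v)"
    "copair C t' b' = copair C (k \<Zsemi> (t \<Zsemi> v)) (b \<Zsemi> v)"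
    using v(1,3,4) v2 k d by (simp_all add: process_data_def)
  moreover have "copair C s' a' = copair C (k \<Zsemi> (s \<Zsemi> v)) (a \<Zsemi> v) \<longleftrightarrow> s' = k \<Zsemi> (s \<Zsemi> v) \<and> a' = a \<Zsemi> v"
    "copair C t' b' = copair C (k \<Zsemi> (t \<Zsemi> v)) (b \<Zsemi> v) \<longleftrightarrow> t' = k \<Zsemi> (t \<Zsemi> v) \<and> b' = b \<Zsemi> v"
    by (rule copair_eq_iff; use k(1-3) d D v(1) v2 in \<open>simp add: process_data_def\<close>)+
  ultimately have q: "s' = k \<Zsemi> (s \<Zsemi> v)" "a' = a \<Zsemi> v" "t' = k \<Zsemi> (t \<Zsemi> v)"
    "b' = b \<Zsemi> v"
    by blast+
  have "Cod C v = Cod C s'"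
    unfolding q(1) using k d v(1) v2 by (simp add: process_data_def)
  moreover have "inv_arrow C k \<Zsemi> s' = s \<Zsemi> v" "inv_arrow C k \<Zsemi> t' = t \<Zsemi> v"
    unfolding q(1,3) using k d v(1) v2 by (simp_all add: process_data_def)
  ultimately show ?thesis
    using that[of "inv_arrow C k" v] k(1-3) v(1) v2 q(2,4) by simp
qed

text \<open>A leg out of a coproduct is the copairing of its restrictions along the injections: the
  left leg yields \<open>s\<close> and \<open>a\<close>, the right leg \<open>t\<close> and
  \<open>b\<close>.\<close>

lemma in_hom_St_Cospan_iff:
  "x \<in> hom (St (Cospan C)) A B \<longleftrightarrow>
     (\<exists>s t a b. process_data s t a b \<and> Dom C a = A \<and> Dom C b = B \<and> x = process s t a b)"
proof
  assume x: "x \<in> hom (St (Cospan C)) A B"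
  then have "x \<in> Ar (St (Cospan C))"
    by (simp add: hom_def)
  then have "\<exists>A B S f. x = st_arrow (Cospan C) A B S f \<and> A \<in> Ob C \<and> B \<in> Ob C \<and> S \<in> Ob C \<and>
      f \<in> hom (Cospan C) (coprod_ob C S A) (coprod_ob C S B)"
    by (simp add: St_def del: split_paired_Ex)
  moreover have "fst x = A" "snd (snd x) = B"
    using x by (simp_all add: hom_def)
  ultimately obtain S f where S: "A \<in> Ob C" "B \<in> Ob C"
    "S \<in> Ob C" and x: "x = st_arrow (Cospan C) A B S f"
    and "f \<in> hom (Cospan C) (coprod_ob C S A) (coprod_ob C S B)"
    unfolding st_arrow_def by auto
  then obtain l r where lr: "l \<in> Ar C" "r \<in> Ar C" "Cod C l = Cod C r" "Dom C l = coprod_ob C S A"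
    "Dom C r = coprod_ob C S B" "f = cospan_arrow C l r"
    unfolding in_hom_Cospan_iff by blast
  let ?s = "inj1 C S A \<Zsemi> l" and ?t = "inj1 C S B \<Zsemi> r" and ?a = "inj2 C S A \<Zsemi> l" and ?b = "inj2 C S B \<Zsemi> r"
  have "process_data ?s ?t ?a ?b" "Dom C ?a = A" "Dom C ?b = B" "x = process ?s ?t ?a ?b"
    using S lr x by (simp_all add: process_data_def process_def)
  then show "\<exists>s t a b. process_data s t a b \<and> Dom C a = A \<and> Dom C b = B \<and> x = process s t a b"
    by blast
next
  assume "\<exists>s t a b. process_data s t a b \<and> Dom C a = A \<and> Dom C b = B \<and> x = process s t a b"
  then obtain s t a b where d: "process_data s t a b" and x: "Dom C a = A" "Dom C b = B" "x = process s t a b"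
    by blast
  have "cospan_arrow C (copair C s a) (copair C t b) \<in> hom (Cospan C) (coprod_ob C (Dom C s) A) (coprod_ob C (Dom C s) B)"
    using d x by (simp add: process_data_def hom_def)
  moreover have "A \<in> Ob C" "B \<in> Ob C" "Dom C s \<in> Ob C"
    using d x by (auto simp: process_data_def)
  ultimately have "x \<in> Ar (St (Cospan C))"
    unfolding St_def x process_def by (simp del: split_paired_Ex) blast
  then show "x \<in> hom (St (Cospan C)) A B"
    using x by (simp add: hom_def process_def st_arrow_def)
qed

text \<open>The central computation. The first process runs beside the idle state of the second,
  then the second beside the idle state of the first, so the middle object is
  \<open>S + (T + B)\<close> and the two apexes are \<open>T + V\<close> and \<open>S + W\<close>.
  In terms of points, gluing identifies each point of \<open>T\<close> with its image under
  \<open>s'\<close> in \<open>W\<close>, and each point of \<open>S\<close> with its image under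
  \<open>t\<close> in \<open>V\<close>. Both idle summands are absorbed, and the pushout of
  \<open>b\<close> and \<open>a'\<close> remains.\<close>

lemma st_seq_Cospan:
  assumes d: "process_data s t a b" "process_data s' t' a' b'" and P: "is_pushout C b a' p q"
  shows "st_seq (Cospan C) (Dom C a) (Dom C b) (Dom C b') (Dom C s) (Dom C s')
      (cospan_arrow C (copair C s a) (copair C t b)) (cospan_arrow C (copair C s' a') (copair C t' b')) =
    cospan_arrow C (copair C (copair C (s \<Zsemi> p) (s' \<Zsemi> q)) (a \<Zsemi> p)) (copair C (copair C (t \<Zsemi> p) (t' \<Zsemi> q)) (b' \<Zsemi> q))"
proof -
  let ?S = "Dom C s" and ?T = "Dom C s'" and ?V = "Cod C s" and ?W = "Cod C s'"
  note u = is_pushout_simps(1-4,6-9)[OF P]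
  have D: "Dom C a' = Dom C b"
    using is_pushout_simps(5)[OF P] .
  note d' = d[unfolded process_data_def]
  have O: "Dom C a \<in> Ob C" "Dom C b \<in> Ob C" "Dom C b' \<in> Ob C" "?S \<in> Ob C" "?T \<in> Ob C"
    "?V \<in> Ob C" "?W \<in> Ob C"
    using d' by auto
  \<comment> \<open>\<open>?r\<close> and \<open>?l\<close> are the inner legs of the two halves,
    with domain \<open>S + (T + B)\<close> after the middle reassociation.\<close>
  let ?r = "copair C (t \<Zsemi> inj2 C ?T ?V) (copair C (inj1 C ?T ?V) (b \<Zsemi> inj2 C ?T ?V))"
  let ?l = "copair C (inj1 C ?S ?W) (copair C (s' \<Zsemi> inj2 C ?S ?W) (a' \<Zsemi> inj2 C ?S ?W))"
  let ?f = "cospan_arrow C (copair C (copair C (s \<Zsemi> inj2 C ?T ?V) (inj1 C ?T ?V)) (a \<Zsemi> inj2 C ?T ?V)) ?r"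
  let ?g = "cospan_arrow C ?l (coprod_ar C (Ide C ?S) (copair C t' b'))"
  have f: "cospan_comp C (cospan_comp C (cospan_comp C (cospan_comp C (cospan_comp C
      (cospan_tensor C (cospan_of C (copair C (inj2 C ?T ?S) (inj1 C ?T ?S))) (cospan_of C (Ide C (Dom C a))))
      (cospan_of C (coprod_assoc C ?T ?S (Dom C a))))
      (cospan_tensor C (cospan_of C (Ide C ?T)) (cospan_arrow C (copair C s a) (copair C t b))))
      (inv_arrow (Cospan C) (cospan_of C (coprod_assoc C ?T ?S (Dom C b)))))
      (cospan_tensor C (cospan_of C (copair C (inj2 C ?S ?T) (inj1 C ?S ?T))) (cospan_of C (Ide C (Dom C b)))))
      (cospan_of C (coprod_assoc C ?S ?T (Dom C b))) = ?f"
    (is "?lhs = _")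
  proof -
    let ?L = "coprod_ar C (copair C (inj2 C ?T ?S) (inj1 C ?T ?S)) (Ide C (Dom C a)) \<Zsemi>
        (coprod_assoc C ?T ?S (Dom C a) \<Zsemi> coprod_ar C (Ide C ?T) (copair C s a))"
    let ?R = "coprod_ar C (copair C (inj2 C ?T ?S) (inj1 C ?T ?S)) (Ide C (Dom C b)) \<Zsemi>
        (coprod_assoc C ?T ?S (Dom C b) \<Zsemi> coprod_ar C (Ide C ?T) (copair C t b))"
    have "?lhs = cospan_arrow C ?L (inv_arrow C (coprod_assoc C ?S ?T (Dom C b)) \<Zsemi> ?R)"
      using d' O by (simp add: inv_structure(3) del: coprod_ar_copair copair_Comp)
    moreover have "?L = copair C (copair C (s \<Zsemi> inj2 C ?T ?V) (inj1 C ?T ?V)) (a \<Zsemi> inj2 C ?T ?V)"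
      using d' O by (simp add: coprod_assoc_def coprod_ar_def)
    moreover have "?R = copair C (copair C (t \<Zsemi> inj2 C ?T ?V) (inj1 C ?T ?V)) (b \<Zsemi> inj2 C ?T ?V)"
      using d' O by (simp add: coprod_assoc_def coprod_ar_def)
    moreover have "inv_arrow C (coprod_assoc C ?S ?T (Dom C b)) \<Zsemi>
        copair C (copair C (t \<Zsemi> inj2 C ?T ?V) (inj1 C ?T ?V)) (b \<Zsemi> inj2 C ?T ?V) = ?r"
      unfolding inv_coprod_assoc[OF O(4,5,2)] using d' O by (simp add: coprod_assoc_inv_def)
    ultimately show ?thesis
      by simp
  qed
  have g: "cospan_tensor C (cospan_of C (Ide C ?S)) (cospan_arrow C (copair C s' a') (copair C t' b')) = ?g"
    using d' O by (simp add: coprod_ar_def)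
  \<comment> \<open>The apex is that of the pushout of \<open>b\<close> and \<open>a'\<close>: the
    idle \<open>T\<close> enters it through \<open>s' \<Zsemi> q\<close>, the idle \<open>S\<close>
    through \<open>t \<Zsemi> p\<close>.\<close>
  have "is_pushout C ?r ?l (copair C (s' \<Zsemi> q) p) (copair C (t \<Zsemi> p) q)"
  proof (rule is_pushoutI)
    fix x y
    assume a: "x \<in> Ar C" "y \<in> Ar C" "Dom C x = Cod C ?r" "Dom C y = Cod C ?l" "Cod C x = Cod C y"
      "?r \<Zsemi> x = ?l \<Zsemi> y"
    have xy: "Dom C x = coprod_ob C ?T ?V" "Dom C y = coprod_ob C ?S ?W"
      using a(3,4) d' O u D by simp_all
    have "?r \<Zsemi> x = copair C (t \<Zsemi> (inj2 C ?T ?V \<Zsemi> x)) (copair C (inj1 C ?T ?V \<Zsemi> x) (b \<Zsemi> (inj2 C ?T ?V \<Zsemi> x)))"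
      "?l \<Zsemi> y = copair C (inj1 C ?S ?W \<Zsemi> y) (copair C (s' \<Zsemi> (inj2 C ?S ?W \<Zsemi> y)) (a' \<Zsemi> (inj2 C ?S ?W \<Zsemi> y)))"
      using a(1,2) xy d' O u D by simp_all
    then have "copair C (t \<Zsemi> (inj2 C ?T ?V \<Zsemi> x)) (copair C (inj1 C ?T ?V \<Zsemi> x) (b \<Zsemi> (inj2 C ?T ?V \<Zsemi> x))) =
      copair C (inj1 C ?S ?W \<Zsemi> y) (copair C (s' \<Zsemi> (inj2 C ?S ?W \<Zsemi> y)) (a' \<Zsemi> (inj2 C ?S ?W \<Zsemi> y)))"
      using a(6) by simp
    then have e: "t \<Zsemi> (inj2 C ?T ?V \<Zsemi> x) = inj1 C ?S ?W \<Zsemi> y"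
      "inj1 C ?T ?V \<Zsemi> x = s' \<Zsemi> (inj2 C ?S ?W \<Zsemi> y)"
      "b \<Zsemi> (inj2 C ?T ?V \<Zsemi> x) = a' \<Zsemi> (inj2 C ?S ?W \<Zsemi> y)"
      using a(1,2,5) xy d' O u D by (simp_all add: copair_eq_iff)
    \<comment> \<open>Only the third component is a condition on the span \<open>b\<close>,
      \<open>a'\<close>; the first two merely force the values on the idle summands.\<close>
    obtain h where h: "h \<in> Ar C" "Dom C h = Cod C p" "Cod C h = Cod C (inj2 C ?T ?V \<Zsemi> x)"
      "p \<Zsemi> h = inj2 C ?T ?V \<Zsemi> x" "q \<Zsemi> h = inj2 C ?S ?W \<Zsemi> y"
      by (rule is_pushout_ex[OF P _ _ _ _ _ e(3)]) (use a(1,2,5) xy d' O u D in simp_all)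
    have "copair C (s' \<Zsemi> q) p \<Zsemi> h = copair C (inj1 C ?T ?V \<Zsemi> x) (inj2 C ?T ?V \<Zsemi> x)"
      unfolding e(2) using h d' u by simp
    also have "\<dots> = x"
      using a(1) xy O by simp
    finally have 1: "copair C (s' \<Zsemi> q) p \<Zsemi> h = x" .
    have "copair C (t \<Zsemi> p) q \<Zsemi> h = copair C (inj1 C ?S ?W \<Zsemi> y) (inj2 C ?S ?W \<Zsemi> y)"
      unfolding e(1)[symmetric] using h d' u by simp
    also have "\<dots> = y"
      using a(2) xy O by simp
    finally have 2: "copair C (t \<Zsemi> p) q \<Zsemi> h = y" .
    show "\<exists>h. h \<in> Ar C \<and> Dom C h = Cod C (copair C (s' \<Zsemi> q) p) \<and> Cod C h = Cod C x \<and>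
        copair C (s' \<Zsemi> q) p \<Zsemi> h = x \<and> copair C (t \<Zsemi> p) q \<Zsemi> h = y"
      using 1 2 h a(1) xy d' O u by (intro exI[of _ h]) simp
  next
    fix h k
    assume a: "h \<in> Ar C" "k \<in> Ar C" "Dom C h = Cod C (copair C (s' \<Zsemi> q) p)"
      "Dom C k = Cod C (copair C (s' \<Zsemi> q) p)"
      "Cod C h = Cod C k"
      and e: "copair C (s' \<Zsemi> q) p \<Zsemi> h = copair C (s' \<Zsemi> q) p \<Zsemi> k"
        "copair C (t \<Zsemi> p) q \<Zsemi> h = copair C (t \<Zsemi> p) q \<Zsemi> k"
    have hk: "Dom C h = Cod C p" "Dom C k = Cod C p"
      using a(3,4) d' u by simp_all
    show "h = k"
      by (rule is_pushout_eqI[OF P])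
        (use a(1,2,5) hk e d' u in \<open>simp_all add: copair_eq_iff\<close>)
  qed (use d' O u D in simp_all)
  note c = cospan_comp_cospan_arrow[OF this, of "copair C (copair C (s \<Zsemi> inj2 C ?T ?V) (inj1 C ?T ?V)) (a \<Zsemi> inj2 C ?T ?V)"
      "coprod_ar C (Ide C ?S) (copair C t' b')"]
  have "coprod_assoc C ?S ?T (Dom C b') \<Zsemi> copair C (t \<Zsemi> p) (copair C (t' \<Zsemi> q) (b' \<Zsemi> q)) =
      copair C (copair C (t \<Zsemi> p) (t' \<Zsemi> q)) (b' \<Zsemi> q)"
    using d' O u by (simp add: coprod_assoc_def)
  then show ?thesis
    unfolding st_seq_def Cospan_simps f g by (subst c) (use d' O u in simp_all)
qed

text \<open>Renaming the states by \<open>k\<close> and \<open>l\<close> leaves \<open>b\<close> and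
  \<open>a'\<close> alone, so one pushout serves all representatives and the composite is merely
  renamed by \<open>coprod_ar C k l\<close>. Hence all classes in the union of
  \<open>st_comp\<close> coincide.\<close>

lemma st_comp_process:
  assumes d: "process_data s t a b" "process_data s' t' a' b'" and P: "is_pushout C b a' p q"
  shows "st_comp (Cospan C) (process s t a b) (process s' t' a' b') =
    process (copair C (s \<Zsemi> p) (s' \<Zsemi> q)) (copair C (t \<Zsemi> p) (t' \<Zsemi> q)) (a \<Zsemi> p) (b' \<Zsemi> q)" (is "_ = ?R")
    and "process_data (copair C (s \<Zsemi> p) (s' \<Zsemi> q)) (copair C (t \<Zsemi> p) (t' \<Zsemi> q)) (a \<Zsemi> p) (b' \<Zsemi> q)"
proof -
  note u = is_pushout_simps(1-4,6-9)[OF P]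
  have D: "Dom C a' = Dom C b"
    using is_pushout_simps(5)[OF P] .
  note d' = d[unfolded process_data_def]
  show d3: "process_data (copair C (s \<Zsemi> p) (s' \<Zsemi> q)) (copair C (t \<Zsemi> p) (t' \<Zsemi> q)) (a \<Zsemi> p) (b' \<Zsemi> q)"
    unfolding process_data_def using d' u by simp
  let ?cls = "\<lambda>S f T g. st_class (Cospan C) (Dom C a) (Dom C b') (coprod_ob C S T)
    (st_seq (Cospan C) (Dom C a) (Dom C b) (Dom C b') S T f g)"
  let ?K = "process_class (copair C (s \<Zsemi> p) (s' \<Zsemi> q)) (copair C (t \<Zsemi> p) (t' \<Zsemi> q)) (a \<Zsemi> p) (b' \<Zsemi> q)"
  have cls: "?cls S f T g = ?K"
    if X: "(S, f) \<in> process_class s t a b" and Y: "(T, g) \<in> process_class s' t' a' b'" for S f T g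
  proof -
    obtain k where k: "iso C k" "Dom C k = S" "Cod C k = Dom C s"
        "f = cospan_arrow C (copair C (k \<Zsemi> s) a) (copair C (k \<Zsemi> t) b)"
      using X unfolding in_process_class_iff[OF d(1)] by blast
    obtain l where l: "iso C l" "Dom C l = T" "Cod C l = Dom C s'"
        "g = cospan_arrow C (copair C (l \<Zsemi> s') a') (copair C (l \<Zsemi> t') b')"
      using Y unfolding in_process_class_iff[OF d(2)] by blast
    have dk: "process_data (k \<Zsemi> s) (k \<Zsemi> t) a b"
      "process_data (l \<Zsemi> s') (l \<Zsemi> t') a' b'"
      using d' k l by (simp_all add: process_data_def)
    have "?cls S f T g = process_class (copair C (k \<Zsemi> s \<Zsemi> p) (l \<Zsemi> s' \<Zsemi> q)) (copair C (k \<Zsemi> t \<Zsemi> p) (l \<Zsemi> t' \<Zsemi> q)) (a \<Zsemi> p) (b' \<Zsemi> q)"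
      using st_seq_Cospan[OF dk P] d' k l u by simp
    also have "\<dots> = ?K"
    proof -
      have "process (copair C (k \<Zsemi> s \<Zsemi> p) (l \<Zsemi> s' \<Zsemi> q)) (copair C (k \<Zsemi> t \<Zsemi> p) (l \<Zsemi> t' \<Zsemi> q)) (a \<Zsemi> p) (b' \<Zsemi> q) = ?R"
        by (rule process_eqI[where e = "coprod_ar C k l" and v = "Ide C (Cod C p)"])
          (use d' k(1-3) l(1-3) u in \<open>simp_all add: process_data_def\<close>)
      then show ?thesis
        by (simp add: process_def st_arrow_def)
    qed
    finally show ?thesis .
  qed
  have "\<Union> {?cls S f T g | S f T g. (S, f) \<in> process_class s t a b \<and> (T, g) \<in> process_class s' t' a' b'} = ?K"
    using cls process_class_refl[OF d(1)] process_class_refl[OF d(2)] by blast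
  then show "st_comp (Cospan C) (process s t a b) (process s' t' a' b') = ?R"
    using d' u by (simp add: st_comp_def process_def st_arrow_def)
qed

section \<open>The tensor of processes\<close>

definition coprod_middle_swap where
  "coprod_middle_swap A B D E =
     copair C (copair C (inj1 C A D \<Zsemi> inj1 C (coprod_ob C A D) (coprod_ob C B E))
         (inj1 C B E \<Zsemi> inj2 C (coprod_ob C A D) (coprod_ob C B E)))
       (copair C (inj2 C A D \<Zsemi> inj1 C (coprod_ob C A D) (coprod_ob C B E))
         (inj2 C B E \<Zsemi> inj2 C (coprod_ob C A D) (coprod_ob C B E)))"

lemma coprod_middle_swap_simps [simp]:
  assumes "A \<in> Ob C" "B \<in> Ob C" "D \<in> Ob C" "E \<in> Ob C"
  shows "coprod_middle_swap A B D E \<in> Ar C"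
    "Dom C (coprod_middle_swap A B D E) = coprod_ob C (coprod_ob C A B) (coprod_ob C D E)"
    "Cod C (coprod_middle_swap A B D E) = coprod_ob C (coprod_ob C A D) (coprod_ob C B E)"
  using assms by (simp_all add: coprod_middle_swap_def)

lemma inverse_arrows_coprod_middle_swap:
  assumes "A \<in> Ob C" "B \<in> Ob C" "D \<in> Ob C" "E \<in> Ob C"
  shows "inverse_arrows C (coprod_middle_swap A B D E) (coprod_middle_swap A D B E)"
  using assms by (simp add: inverse_arrows_iff coprod_middle_swap_def)

lemma iso_coprod_middle_swap [simp]:
  assumes "A \<in> Ob C" "B \<in> Ob C" "D \<in> Ob C" "E \<in> Ob C"
  shows "iso C (coprod_middle_swap A B D E)"
    "inv_arrow C (coprod_middle_swap A B D E) = coprod_middle_swap A D B E"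
  using isoI[OF inverse_arrows_coprod_middle_swap[OF assms]] inv_arrow_eq[OF inverse_arrows_coprod_middle_swap[OF assms]]
  by simp_all

text \<open>Since \<open>cospan_of\<close> preserves composition and tensor, the composite is
  computed in \<open>C\<close>, where the associators and the swap are explicit copairings.\<close>

lemma middle_swap_Cospan:
  assumes "A \<in> Ob C" "B \<in> Ob C" "D \<in> Ob C" "E \<in> Ob C"
  shows "middle_swap (Cospan C) A B D E = cospan_of C (coprod_middle_swap A B D E)"
proof -
  have "coprod_assoc C A B (coprod_ob C D E) \<Zsemi> (coprod_ar C (Ide C A) (coprod_assoc_inv B D E \<Zsemi>
      (coprod_ar C (copair C (inj2 C D B) (inj1 C D B)) (Ide C E) \<Zsemi> coprod_assoc C D B E)) \<Zsemi>
      coprod_assoc_inv A D (coprod_ob C B E)) = coprod_middle_swap A B D E"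
    using assms by (simp add: coprod_middle_swap_def coprod_assoc_def coprod_assoc_inv_def coprod_ar_def)
  moreover have "coprod_assoc_inv B D E \<in> Ar C"
    "Dom C (coprod_assoc_inv B D E) = coprod_ob C B (coprod_ob C D E)"
    "Cod C (coprod_assoc_inv B D E) = coprod_ob C (coprod_ob C B D) E"
    "coprod_assoc_inv A D (coprod_ob C B E) \<in> Ar C"
    "Dom C (coprod_assoc_inv A D (coprod_ob C B E)) = coprod_ob C A (coprod_ob C D (coprod_ob C B E))"
    using assms by (simp_all add: coprod_assoc_inv_def)
  ultimately show ?thesis
    using assms by (simp add: middle_swap_def inv_coprod_assoc)
qed

text \<open>The interchange maps \<open>(S + S') + (A + A')\<close> to
  \<open>(S + A) + (S' + A')\<close>; precomposing with it turns a sum of copairings into a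
  copairing of sums.\<close>

lemma st_tensor_process:
  assumes d: "process_data s t a b" "process_data s' t' a' b'"
  shows "st_tensor (Cospan C) (process s t a b) (process s' t' a' b') =
    process (coprod_ar C s s') (coprod_ar C t t') (coprod_ar C a a') (coprod_ar C b b')" (is "_ = ?R")
    and "process_data (coprod_ar C s s') (coprod_ar C t t') (coprod_ar C a a') (coprod_ar C b b')"
proof -
  note d' = d[unfolded process_data_def]
  have O: "Dom C a \<in> Ob C" "Dom C b \<in> Ob C" "Dom C a' \<in> Ob C" "Dom C b' \<in> Ob C"
    "Cod C s \<in> Ob C" "Cod C s' \<in> Ob C"
    using d' by auto
  show d3: "process_data (coprod_ar C s s') (coprod_ar C t t') (coprod_ar C a a') (coprod_ar C b b')"
    unfolding process_data_def using d' by simp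
  let ?cls = "\<lambda>S f T g. st_class (Cospan C) (coprod_ob C (Dom C a) (Dom C a')) (coprod_ob C (Dom C b) (Dom C b')) (coprod_ob C S T)
    (cospan_comp C (cospan_comp C (middle_swap (Cospan C) S T (Dom C a) (Dom C a')) (cospan_tensor C f g))
      (middle_swap (Cospan C) S (Dom C b) T (Dom C b')))"
  let ?K = "process_class (coprod_ar C s s') (coprod_ar C t t') (coprod_ar C a a') (coprod_ar C b b')"
  have cls: "?cls S f T g = ?K"
    if X: "(S, f) \<in> process_class s t a b" and Y: "(T, g) \<in> process_class s' t' a' b'" for S f T g
  proof -
    obtain k where k: "iso C k" "Dom C k = S" "Cod C k = Dom C s"
        "f = cospan_arrow C (copair C (k \<Zsemi> s) a) (copair C (k \<Zsemi> t) b)"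
      using X unfolding in_process_class_iff[OF d(1)] by blast
    obtain l where l: "iso C l" "Dom C l = T" "Cod C l = Dom C s'"
        "g = cospan_arrow C (copair C (l \<Zsemi> s') a') (copair C (l \<Zsemi> t') b')"
      using Y unfolding in_process_class_iff[OF d(2)] by blast
    have O': "S \<in> Ob C" "T \<in> Ob C"
      using k(1,2) l(1,2) by auto
    have "coprod_middle_swap S T (Dom C a) (Dom C a') \<Zsemi> coprod_ar C (copair C (k \<Zsemi> s) a) (copair C (l \<Zsemi> s') a') =
        copair C (coprod_ar C (k \<Zsemi> s) (l \<Zsemi> s')) (coprod_ar C a a')"
      "coprod_middle_swap S T (Dom C b) (Dom C b') \<Zsemi> coprod_ar C (copair C (k \<Zsemi> t) b) (copair C (l \<Zsemi> t') b') =
        copair C (coprod_ar C (k \<Zsemi> t) (l \<Zsemi> t')) (coprod_ar C b b')"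
      using d' k(1-3) l(1-3) O O' by (simp_all add: coprod_middle_swap_def coprod_ar_def)
    then have "?cls S f T g = process_class (coprod_ar C (k \<Zsemi> s) (l \<Zsemi> s')) (coprod_ar C (k \<Zsemi> t) (l \<Zsemi> t')) (coprod_ar C a a') (coprod_ar C b b')"
      unfolding k(4) l(4) using d' k(1-3) l(1-3) O O' by (simp add: middle_swap_Cospan)
    also have "\<dots> = ?K"
    proof -
      have "process (coprod_ar C (k \<Zsemi> s) (l \<Zsemi> s')) (coprod_ar C (k \<Zsemi> t) (l \<Zsemi> t')) (coprod_ar C a a') (coprod_ar C b b') = ?R"
        by (rule process_eqI[where e = "coprod_ar C k l" and v = "Ide C (coprod_ob C (Cod C s) (Cod C s'))"])
          (use d' k(1-3) l(1-3) O in \<open>simp_all add: process_data_def coprod_ar_Comp\<close>)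
      then show ?thesis
        by (simp add: process_def st_arrow_def)
    qed
    finally show ?thesis .
  qed
  have "\<Union> {?cls S f T g | S f T g. (S, f) \<in> process_class s t a b \<and> (T, g) \<in> process_class s' t' a' b'} = ?K"
    using cls process_class_refl[OF d(1)] process_class_refl[OF d(2)] by blast
  then show "st_tensor (Cospan C) (process s t a b) (process s' t' a' b') = ?R"
    using d' by (simp add: st_tensor_def process_def st_arrow_def)
qed

section \<open>Stateless processes and the monoidal laws of processes\<close>

definition stateless :: "'b \<Rightarrow> ('a, ('a, 'b) cospan_arrow) st_arrow" where
  "stateless f = process (from_initial C (Cod C f)) (from_initial C (Cod C f)) f (Ide C (Cod C f))"

lemma process_data_stateless [simp]:
  "f \<in> Ar C \<Longrightarrow> process_data (from_initial C (Cod C f)) (from_initial C (Cod C f)) f (Ide C (Cod C f))"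
  by (simp add: process_data_def)

lemma stateless_in_hom: "f \<in> Ar C \<Longrightarrow> stateless f \<in> hom (St (Cospan C)) (Dom C f) (Cod C f)"
  unfolding in_hom_St_Cospan_iff stateless_def
  by (intro exI[of _ "from_initial C (Cod C f)"] exI[of _ f] exI[of _ "Ide C (Cod C f)"]) simp

text \<open>Tensoring with the identity of the unit adds an initial summand to the apex; the left
  unitor absorbs it, which leaves \<open>from_initial\<close> as source and target.\<close>

lemma st_of_cospan_of:
  assumes "f \<in> Ar C"
  shows "st_of (Cospan C) (cospan_of C f) = stateless f"
proof -
  have "cospan_of C (coprod_ar C (Ide C (initial_ob C)) f) =
    cospan_arrow C (copair C (from_initial C (Cod C f)) f) (copair C (from_initial C (Cod C f)) (Ide C (Cod C f)))"
    unfolding cospan_of_def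
    by (rule cospan_arrow_eqI[where h = "copair C (from_initial C (Cod C f)) (Ide C (Cod C f))"]) (use assms in simp_all)
  then show ?thesis
    using assms by (simp add: st_of_def stateless_def process_def)
qed

lemma Ide_St_Cospan: "A \<in> Ob C \<Longrightarrow> Ide (St (Cospan C)) A = stateless (Ide C A)"
  using st_of_cospan_of[of "Ide C A"] by (simp add: st_of_def)

text \<open>The pushout is along an identity, after which the empty state space of the stateless
  factor is removed by the left unitor.\<close>

lemma stateless_comp_process:
  assumes d: "process_data s t a b" and f: "f \<in> Ar C" "Cod C f = Dom C a"
  shows "st_comp (Cospan C) (stateless f) (process s t a b) = process s t (f \<Zsemi> a) b"
proof -
  note d' = d[unfolded process_data_def]
  have P: "is_pushout C (Ide C (Cod C f)) a a (Ide C (Cod C a))"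
    using is_pushout_sym[OF is_pushout_Ide[of a]] d' f by simp
  show ?thesis
    unfolding stateless_def st_comp_process(1)[OF process_data_stateless[OF f(1)] d P]
    by (rule process_eqI[where e = "copair C (from_initial C (Dom C s)) (Ide C (Dom C s))" and v = "Ide C (Cod C s)"])
      (use st_comp_process(2)[OF process_data_stateless[OF f(1)] d P] d' f in \<open>simp_all add: process_data_def\<close>)
qed

text \<open>Invertibility of \<open>k\<close> makes the pushout explicit; the identities and
  coherence maps, for which this is used, are all invertible.\<close>

lemma process_comp_stateless:
  assumes d: "process_data s t a b" and k: "iso C k" "Dom C k = Dom C b"
  shows "st_comp (Cospan C) (process s t a b) (stateless k) = process s t a (inv_arrow C k \<Zsemi> b)"
proof -
  note d' = d[unfolded process_data_def]
  have P: "is_pushout C b k (Ide C (Cod C b)) (inv_arrow C k \<Zsemi> b)"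
    by (rule is_pushout_iso) (use d' k in simp_all)
  note dk = process_data_stateless[OF iso_simps(1)[OF k(1)]]
  show ?thesis
    unfolding stateless_def st_comp_process(1)[OF d dk P]
    by (rule process_eqI[where e = "copair C (Ide C (Dom C s)) (from_initial C (Dom C s))" and v = "Ide C (Cod C s)"])
      (use st_comp_process(2)[OF d dk P] d' k in \<open>simp_all add: process_data_def\<close>)
qed

lemma stateless_comp_stateless:
  assumes "f \<in> Ar C" "g \<in> Ar C" "Cod C f = Dom C g"
  shows "st_comp (Cospan C) (stateless f) (stateless g) = stateless (f \<Zsemi> g)"
  using stateless_comp_process[OF process_data_stateless[OF assms(2)] assms(1,3)] assms
  by (simp add: stateless_def[of g] stateless_def[of "f \<Zsemi> g"])

lemma iso_stateless:
  assumes "iso C f"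
  shows "iso (St (Cospan C)) (stateless f)"
proof -
  let ?g = "inv_arrow C f"
  have D: "Dom (St (Cospan C)) (stateless f) = Dom C f" "Cod (St (Cospan C)) (stateless f) = Cod C f"
    and "stateless f \<in> Ar (St (Cospan C))"
    using stateless_in_hom[of f] assms by (simp_all add: hom_def)
  moreover have "stateless ?g \<in> hom (St (Cospan C)) (Cod C f) (Dom C f)"
    using stateless_in_hom[of ?g] assms by simp
  moreover have "Comp (St (Cospan C)) (stateless f) (stateless ?g) = Ide (St (Cospan C)) (Dom C f)"
    "Comp (St (Cospan C)) (stateless ?g) (stateless f) = Ide (St (Cospan C)) (Cod C f)"
    using assms by (simp_all only: Ide_St_Cospan Dom_Ob Cod_Ob iso_simps St_simps(5) stateless_comp_stateless)
  ultimately have "inverse_arrows (St (Cospan C)) (stateless f) (stateless ?g)"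
    unfolding inverse_arrows_def D by blast
  then show ?thesis
    unfolding iso_def by blast
qed

lemma stateless_tensor_stateless:
  assumes "f \<in> Ar C" "g \<in> Ar C"
  shows "st_tensor (Cospan C) (stateless f) (stateless g) = stateless (coprod_ar C f g)"
proof -
  note d = process_data_stateless[OF assms(1)] process_data_stateless[OF assms(2)]
  let ?I = "initial_ob C" and ?A = "Cod C f" and ?B = "Cod C g"
  \<comment> \<open>The domain of \<open>?s\<close> is a sum of initial objects and not the chosen
    initial object itself, so uniqueness of arrows is applied after moving along the unitor
    \<open>?e\<close>.\<close>
  have "inv_arrow C (copair C (from_initial C ?I) (Ide C ?I)) \<Zsemi> coprod_ar C (from_initial C ?A) (from_initial C ?B) =
      from_initial C (coprod_ob C ?A ?B)" (is "inv_arrow C ?e \<Zsemi> ?s = _")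
    by (rule from_initial_eqI) (use assms in simp_all)
  then have "?e \<Zsemi> (inv_arrow C ?e \<Zsemi> ?s) = ?e \<Zsemi> from_initial C (coprod_ob C ?A ?B)"
    by simp
  then have e: "?s = ?e \<Zsemi> from_initial C (coprod_ob C ?A ?B)"
    using assms by (simp del: copair_Comp)
  show ?thesis
    unfolding stateless_def st_tensor_process(1)[OF d]
    by (rule process_eqI[where e = ?e and v = "Ide C (coprod_ob C ?A ?B)"])
      (use st_tensor_process(2)[OF d] assms e in \<open>simp_all add: process_data_def del: copair_Comp from_initial_Comp\<close>)
qed

text \<open>Common form of the naturality squares of \<open>St\<close>: coherence maps
  \<open>f\<close> and \<open>g\<close> act on the boundary, and the coherence maps of the same kind
  serve as \<open>e\<close> on states and as \<open>v\<close> on apexes.\<close>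

lemma process_natural:
  assumes i: "iso C f" "iso C g" "iso C e" "iso C v" and d: "process_data s t a b" "process_data s' t' a' b'"
    and t: "Dom C f = Dom C a" "Cod C f = Dom C a'" "Dom C g = Dom C b" "Cod C g = Dom C b'"
    "Dom C e = Dom C s" "Cod C e = Dom C s'" "Dom C v = Cod C s" "Cod C v = Cod C s'"
    and eq: "s \<Zsemi> v = e \<Zsemi> s'" "t \<Zsemi> v = e \<Zsemi> t'" "a \<Zsemi> v = f \<Zsemi> a'"
      "b \<Zsemi> v = g \<Zsemi> b'"
  shows "st_comp (Cospan C) (process s t a b) (stateless g) = st_comp (Cospan C) (stateless f) (process s' t' a' b')"
  unfolding process_comp_stateless[OF d(1) i(2) t(3)] stateless_comp_process[OF d(2) iso_simps(1)[OF i(1)] t(2)]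
  by (rule process_eqI[OF i(3,4)]) (use assms in \<open>simp_all add: process_data_def\<close>)

lemma coprod_assoc_copair:
  assumes "f \<in> Ar C" "g \<in> Ar C" "h \<in> Ar C" "Cod C g = Cod C f" "Cod C h = Cod C f"
    "Dom C f = A" "Dom C g = B" "Dom C h = D"
  shows "coprod_assoc C A B D \<Zsemi> copair C f (copair C g h) = copair C (copair C f g) h"
  using assms by (auto simp: coprod_assoc_def)

lemma coprod_middle_swap_copair:
  assumes "f \<in> Ar C" "g \<in> Ar C" "h \<in> Ar C" "k \<in> Ar C" "Cod C f = Cod C g" "Cod C h = Cod C k"
    "Dom C f = A" "Dom C g = B" "Dom C h = D" "Dom C k = E"
  shows "coprod_middle_swap A B D E \<Zsemi> copair C (coprod_ar C f h) (coprod_ar C g k) =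
    coprod_ar C (copair C f g) (copair C h k)"
  using assms by (auto simp: coprod_middle_swap_def coprod_ar_def)

text \<open>Both bracketings use one pasted pushout, as for cospans; the state spaces differ by the
  associator, which is the witness \<open>e\<close>.\<close>

lemma process_comp_assoc:
  assumes d: "process_data s t a b" "process_data s' t' a' b'" "process_data s'' t'' a'' b''"
    and D: "Dom C b = Dom C a'" "Dom C b' = Dom C a''"
  shows "st_comp (Cospan C) (st_comp (Cospan C) (process s t a b) (process s' t' a' b')) (process s'' t'' a'' b'') =
    st_comp (Cospan C) (process s t a b) (st_comp (Cospan C) (process s' t' a' b') (process s'' t'' a'' b''))"
proof -
  note d' = d[unfolded process_data_def]
  obtain p q where P: "is_pushout C b a' p q"
    using ex_pushout[of b a'] d' D by auto
  obtain p' q' where P': "is_pushout C b' a'' p' q'"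
    using ex_pushout[of b' a''] d' D by auto
  note u = is_pushout_simps(1-4,6-9)[OF P] is_pushout_simps(1-4,6-9)[OF P']
  obtain x y where Q: "is_pushout C q p' x y"
    using ex_pushout[of q p'] d' u by auto
  note u = u is_pushout_simps(1-4,6-8)[OF Q]
  have Q': "q \<Zsemi> x = p' \<Zsemi> y"
    using is_pushout_simps(9)[OF Q] .
  note PQ = is_pushout_paste[OF P Q]
  note PQ' = is_pushout_sym[OF is_pushout_paste[OF is_pushout_sym[OF P'] is_pushout_sym[OF Q]]]
  note 1 = st_comp_process[OF d(1,2) P] and 2 = st_comp_process[OF d(2,3) P']
  note 3 = st_comp_process[OF 1(2) d(3) PQ'] and 4 = st_comp_process[OF d(1) 2(2) PQ]
  have Q'': "w \<Zsemi> (q \<Zsemi> x) = w \<Zsemi> (p' \<Zsemi> y)" for w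
    using Q' by simp
  show ?thesis
    unfolding 1(1) 2(1) 3(1) 4(1)
    by (rule process_eqI[where e = "coprod_assoc C (Dom C s) (Dom C s') (Dom C s'')" and v = "Ide C (Cod C x)"])
      (use 3(2) 4(2) d' u Q'' in \<open>simp_all add: coprod_assoc_copair\<close>)
qed

text \<open>The sum of the two pushouts is again a pushout, so the apexes agree. The state spaces
  are \<open>(S + S') + (U + U')\<close> on one side and \<open>(S + U) + (S' + U')\<close> on the
  other, and the interchange between them is the witness \<open>e\<close>.\<close>

lemma process_tensor_comp:
  assumes d: "process_data s t a b" "process_data s' t' a' b'"
    "process_data u v c e" "process_data u' v' c' e'"
    and D: "Dom C b = Dom C a'" "Dom C e = Dom C c'"
  shows "st_tensor (Cospan C) (st_comp (Cospan C) (process s t a b) (process s' t' a' b'))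
      (st_comp (Cospan C) (process u v c e) (process u' v' c' e')) =
    st_comp (Cospan C) (st_tensor (Cospan C) (process s t a b) (process u v c e))
      (st_tensor (Cospan C) (process s' t' a' b') (process u' v' c' e'))"
proof -
  note d' = d[unfolded process_data_def]
  obtain p q where P: "is_pushout C b a' p q"
    using ex_pushout[of b a'] d' D by auto
  obtain p' q' where P': "is_pushout C e c' p' q'"
    using ex_pushout[of e c'] d' D by auto
  note w = is_pushout_simps(1-4,6-9)[OF P] is_pushout_simps(1-4,6-9)[OF P']
  note 1 = st_comp_process[OF d(1,2) P] and 2 = st_comp_process[OF d(3,4) P']
  note 3 = st_tensor_process[OF d(1,3)] and 4 = st_tensor_process[OF d(2,4)]
  note 5 = st_comp_process[OF 3(2) 4(2) is_pushout_coprod[OF P P']] and 6 = st_tensor_process[OF 1(2) 2(2)]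
  have O: "Dom C s \<in> Ob C" "Dom C s' \<in> Ob C" "Dom C u \<in> Ob C" "Dom C u' \<in> Ob C"
    using d' by auto
  show ?thesis
    unfolding 1(1) 2(1) 3(1) 4(1) 5(1) 6(1)
    by (rule process_eqI[where e = "coprod_middle_swap (Dom C s) (Dom C s') (Dom C u) (Dom C u')"
          and v = "Ide C (coprod_ob C (Cod C p) (Cod C p'))"])
      (use 5(2) 6(2) d' w O in \<open>simp_all add: coprod_ar_Comp coprod_middle_swap_copair\<close>)
qed

text \<open>Identities and coherence maps of \<open>St\<close> are stateless processes on
  isomorphisms of \<open>C\<close>, so the coherence equations reduce to those of the coproduct. The
  laws for arbitrary processes are computed on quadruples.\<close>

lemma symmetric_monoidal_St_Cospan: "symmetric_monoidal_category (St (Cospan C))" (is "symmetric_monoidal_category ?P")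
proof
  fix f assume "f \<in> Ar ?P"
  then have "f \<in> hom ?P (Dom ?P f) (Cod ?P f)"
    by (simp add: hom_def)
  then show "Dom ?P f \<in> Ob ?P" "Cod ?P f \<in> Ob ?P"
    unfolding in_hom_St_Cospan_iff by (metis Dom_Ob process_data_def Cospan_simps(1) St_simps(1))+
next
  fix A assume "A \<in> Ob ?P"
  then show "Ide ?P A \<in> hom ?P A A"
    using stateless_in_hom[of "Ide C A"] Ide_St_Cospan[of A] by simp
next
  fix x A B y D
  assume "x \<in> hom ?P A B" "y \<in> hom ?P B D"
  then obtain s t a b s' t' a' b' where d: "process_data s t a b" "process_data s' t' a' b'"
    and x: "Dom C a = A" "Dom C b = B" "x = process s t a b" "Dom C a' = B" "Dom C b' = D"
      "y = process s' t' a' b'"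
    unfolding in_hom_St_Cospan_iff by blast
  note d' = d[unfolded process_data_def]
  obtain p q where P: "is_pushout C b a' p q"
    using ex_pushout[of b a'] d' x by auto
  note c = st_comp_process[OF d P]
  have "Dom C (a \<Zsemi> p) = A" "Dom C (b' \<Zsemi> q) = D"
    using d' x is_pushout_simps(1-4,6-9)[OF P] by simp_all
  then show "Comp ?P x y \<in> hom ?P A D"
    unfolding in_hom_St_Cospan_iff using c x(3,6) by (auto simp: split_paired_Ex)
next
  fix x A B
  assume "x \<in> hom ?P A B"
  then obtain s t a b where d: "process_data s t a b" and x: "Dom C a = A" "Dom C b = B" "x = process s t a b"
    unfolding in_hom_St_Cospan_iff by blast
  note d' = d[unfolded process_data_def]
  have O: "A \<in> Ob C" "B \<in> Ob C"
    using d' x by auto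
  show "Comp ?P (Ide ?P A) x = x" "Comp ?P x (Ide ?P B) = x"
    unfolding Ide_St_Cospan[OF O(1)] Ide_St_Cospan[OF O(2)]
    using stateless_comp_process[OF d, of "Ide C A"] process_comp_stateless[OF d, of "Ide C B"] O d' x by simp_all
  have L: "Comp ?P (TensorAr ?P (Ide ?P (Unit ?P)) x) (LUnit ?P B) =
      st_comp (Cospan C) (st_tensor (Cospan C) (stateless (Ide C (initial_ob C))) x) (stateless (copair C (from_initial C B) (Ide C B)))"
    "Comp ?P (LUnit ?P A) x = st_comp (Cospan C) (stateless (copair C (from_initial C A) (Ide C A))) x"
    "Comp ?P (TensorAr ?P x (Ide ?P (Unit ?P))) (RUnit ?P B) =
      st_comp (Cospan C) (st_tensor (Cospan C) x (stateless (Ide C (initial_ob C)))) (stateless (copair C (Ide C B) (from_initial C B)))"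
    "Comp ?P (RUnit ?P A) x = st_comp (Cospan C) (stateless (copair C (Ide C A) (from_initial C A))) x"
    using Ide_St_Cospan[of "initial_ob C"] O by (simp_all add: st_of_cospan_of)
  \<comment> \<open>The identity of the unit is spelled out as a quadruple so that the formula for
    the tensor applies to it.\<close>
  have dI: "process_data (from_initial C (initial_ob C)) (from_initial C (initial_ob C)) (Ide C (initial_ob C)) (Ide C (initial_ob C))"
    by (simp add: process_data_def)
  have sI: "stateless (Ide C (initial_ob C)) =
      process (from_initial C (initial_ob C)) (from_initial C (initial_ob C)) (Ide C (initial_ob C)) (Ide C (initial_ob C))"
    by (simp add: stateless_def)
  show "Comp ?P (TensorAr ?P (Ide ?P (Unit ?P)) x) (LUnit ?P B) =
    Comp ?P (LUnit ?P A) x"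
    unfolding L unfolding sI x(3) st_tensor_process(1)[OF dI d]
    by (rule process_natural[where e = "copair C (from_initial C (Dom C s)) (Ide C (Dom C s))"
          and v = "copair C (from_initial C (Cod C s)) (Ide C (Cod C s))"])
      (use st_tensor_process(2)[OF dI d] d d' x O in simp_all)
  show "Comp ?P (TensorAr ?P x (Ide ?P (Unit ?P))) (RUnit ?P B) =
    Comp ?P (RUnit ?P A) x"
    unfolding L unfolding sI x(3) st_tensor_process(1)[OF d dI]
    by (rule process_natural[where e = "copair C (Ide C (Dom C s)) (from_initial C (Dom C s))"
          and v = "copair C (Ide C (Cod C s)) (from_initial C (Cod C s))"])
      (use st_tensor_process(2)[OF d dI] d d' x O in simp_all)
next
  fix x y z A B D E
  assume "x \<in> hom ?P A B" "y \<in> hom ?P B D" "z \<in> hom ?P D E"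
  then show "Comp ?P (Comp ?P x y) z = Comp ?P x (Comp ?P y z)"
    unfolding in_hom_St_Cospan_iff by (auto simp: process_comp_assoc)
next
  fix x A B y A' B'
  assume "x \<in> hom ?P A B" "y \<in> hom ?P A' B'"
  then obtain s t a b s' t' a' b' where d: "process_data s t a b" "process_data s' t' a' b'"
    and x: "Dom C a = A" "Dom C b = B" "x = process s t a b" "Dom C a' = A'" "Dom C b' = B'"
      "y = process s' t' a' b'"
    unfolding in_hom_St_Cospan_iff by blast
  note d' = d[unfolded process_data_def]
  have O: "A \<in> Ob C" "B \<in> Ob C" "A' \<in> Ob C" "B' \<in> Ob C" "Dom C s \<in> Ob C"
    "Dom C s' \<in> Ob C" "Cod C s \<in> Ob C" "Cod C s' \<in> Ob C"
    using d' x by auto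
  have "Dom C (coprod_ar C a a') = coprod_ob C A A'" "Dom C (coprod_ar C b b') = coprod_ob C B B'"
    using d' x by simp_all
  then show "TensorAr ?P x y \<in> hom ?P (TensorOb ?P A A') (TensorOb ?P B B')"
    unfolding in_hom_St_Cospan_iff x(3,6) using st_tensor_process[OF d] by auto
  show "Comp ?P (TensorAr ?P x y) (Sym ?P B B') =
    Comp ?P (Sym ?P A A') (TensorAr ?P y x)"
    unfolding x(3,6) St_simps Cospan_simps st_tensor_process(1)[OF d] st_tensor_process(1)[OF d(2,1)]
      st_of_cospan_of[OF iso_simps(1)[OF iso_structure(3)[OF O(1,3)]]] st_of_cospan_of[OF iso_simps(1)[OF iso_structure(3)[OF O(2,4)]]]
    by (rule process_natural[where e = "copair C (inj2 C (Dom C s') (Dom C s)) (inj1 C (Dom C s') (Dom C s))"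
          and v = "copair C (inj2 C (Cod C s') (Cod C s)) (inj1 C (Cod C s') (Cod C s))"])
      (use st_tensor_process(2)[OF d] st_tensor_process(2)[OF d(2,1)] d' x O in simp_all)
next
  fix x y A B D A' B' D' x' y'
  assume "x \<in> hom ?P A B" "y \<in> hom ?P B D" "x' \<in> hom ?P A' B'" "y' \<in> hom ?P B' D'"
  then show "TensorAr ?P (Comp ?P x y) (Comp ?P x' y') =
    Comp ?P (TensorAr ?P x x') (TensorAr ?P y y')"
    unfolding in_hom_St_Cospan_iff by (auto simp: process_tensor_comp)
next
  fix x A A' y B B' z D D'
  assume "x \<in> hom ?P A A'" "y \<in> hom ?P B B'" "z \<in> hom ?P D D'"
  then obtain s t a b s' t' a' b' s'' t'' a'' b'' where
    d: "process_data s t a b" "process_data s' t' a' b'" "process_data s'' t'' a'' b''"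
    and x: "Dom C a = A" "Dom C b = A'" "x = process s t a b" "Dom C a' = B" "Dom C b' = B'"
      "y = process s' t' a' b'"
      "Dom C a'' = D" "Dom C b'' = D'" "z = process s'' t'' a'' b''"
    unfolding in_hom_St_Cospan_iff by blast
  note d' = d[unfolded process_data_def]
  have O: "A \<in> Ob C" "B \<in> Ob C" "D \<in> Ob C" "A' \<in> Ob C" "B' \<in> Ob C" "D' \<in> Ob C"
    using d' x by auto
  note 1 = st_tensor_process[OF d(1,2)] and 2 = st_tensor_process[OF d(2,3)]
  note 3 = st_tensor_process[OF 1(2) d(3)] and 4 = st_tensor_process[OF d(1) 2(2)]
  show "Comp ?P (TensorAr ?P (TensorAr ?P x y) z) (Assoc ?P A' B' D') =
    Comp ?P (Assoc ?P A B D) (TensorAr ?P x (TensorAr ?P y z))"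
    unfolding x(3,6,9) St_simps Cospan_simps 1(1) 2(1) 3(1) 4(1)
      st_of_cospan_of[OF coprod_assoc_simps(1)[OF O(1-3)]] st_of_cospan_of[OF coprod_assoc_simps(1)[OF O(4-6)]]
    by (rule process_natural[where e = "coprod_assoc C (Dom C s) (Dom C s') (Dom C s'')"
          and v = "coprod_assoc C (Cod C s) (Cod C s') (Cod C s'')"])
      (use 3(2) 4(2) d' x O coprod_assoc_natural[of s s' s''] coprod_assoc_natural[of t t' t'']
        coprod_assoc_natural[of a a' a''] coprod_assoc_natural[of b b' b''] in simp_all)
next
  fix A B assume a: "A \<in> Ob ?P" "B \<in> Ob ?P"
  then have O: "A \<in> Ob C" "B \<in> Ob C"
    by simp_all
  show "TensorOb ?P A B \<in> Ob ?P"
    using O by simp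
  show "TensorAr ?P (Ide ?P A) (Ide ?P B) = Ide ?P (TensorOb ?P A B)"
    using Ide_St_Cospan[of A] Ide_St_Cospan[of B] Ide_St_Cospan[of "coprod_ob C A B"] O
    by (simp add: stateless_tensor_stateless)
  show "Sym ?P A B \<in> hom ?P (TensorOb ?P A B) (TensorOb ?P B A)"
    using stateless_in_hom[of "copair C (inj2 C B A) (inj1 C B A)"] O by (simp add: st_of_cospan_of)
  show "Comp ?P (Sym ?P A B) (Sym ?P B A) = Ide ?P (TensorOb ?P A B)"
    using Ide_St_Cospan[of "coprod_ob C A B"] O by (simp add: st_of_cospan_of stateless_comp_stateless)
  show "Comp ?P (Assoc ?P A (Unit ?P) B) (TensorAr ?P (Ide ?P A) (LUnit ?P B)) =
      TensorAr ?P (RUnit ?P A) (Ide ?P B)"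
    using Ide_St_Cospan[of A] Ide_St_Cospan[of B] coprod_triangle[of A B] O
    by (simp add: st_of_cospan_of stateless_comp_stateless stateless_tensor_stateless del: coprod_ar_copair)
next
  fix A B D assume "A \<in> Ob ?P" "B \<in> Ob ?P" "D \<in> Ob ?P"
  then have O: "A \<in> Ob C" "B \<in> Ob C" "D \<in> Ob C"
    by simp_all
  show "Assoc ?P A B D \<in> hom ?P (TensorOb ?P (TensorOb ?P A B) D)
      (TensorOb ?P A (TensorOb ?P B D))"
    using stateless_in_hom[of "coprod_assoc C A B D"] O by (simp add: st_of_cospan_of)
  show "iso ?P (Assoc ?P A B D)"
    using iso_stateless[of "coprod_assoc C A B D"] O by (simp add: st_of_cospan_of)
  show "Comp ?P (Comp ?P (Assoc ?P A B D) (Sym ?P A (TensorOb ?P B D)))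
      (Assoc ?P B D A) =
    Comp ?P (Comp ?P (TensorAr ?P (Sym ?P A B) (Ide ?P D))
      (Assoc ?P B A D)) (TensorAr ?P (Ide ?P B) (Sym ?P A D))"
    using Ide_St_Cospan[of B] Ide_St_Cospan[of D] coprod_hexagon[of A B D] O
    by (simp add: st_of_cospan_of stateless_comp_stateless stateless_tensor_stateless del: copair_Comp coprod_ar_copair)
next
  fix A B D E assume "A \<in> Ob ?P" "B \<in> Ob ?P" "D \<in> Ob ?P" "E \<in> Ob ?P"
  then show "Comp ?P (Comp ?P (TensorAr ?P (Assoc ?P A B D) (Ide ?P E))
      (Assoc ?P A (TensorOb ?P B D) E)) (TensorAr ?P (Ide ?P A) (Assoc ?P B D E)) =
    Comp ?P (Assoc ?P (TensorOb ?P A B) D E) (Assoc ?P A B (TensorOb ?P D E))"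
    using Ide_St_Cospan[of A] Ide_St_Cospan[of E] coprod_pentagon[of A B D E]
    by (simp add: st_of_cospan_of stateless_comp_stateless stateless_tensor_stateless)
next
  fix A assume "A \<in> Ob ?P"
  then have O: "A \<in> Ob C"
    by simp
  show "LUnit ?P A \<in> hom ?P (TensorOb ?P (Unit ?P) A) A"
    "iso ?P (LUnit ?P A)"
    "RUnit ?P A \<in> hom ?P (TensorOb ?P A (Unit ?P)) A"
    "iso ?P (RUnit ?P A)"
    using O stateless_in_hom[of "copair C (from_initial C A) (Ide C A)"] stateless_in_hom[of "copair C (Ide C A) (from_initial C A)"]
      iso_stateless[of "copair C (from_initial C A) (Ide C A)"] iso_stateless[of "copair C (Ide C A) (from_initial C A)"]
    by (simp_all add: st_of_cospan_of)
qed simp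

end

section \<open>The isomorphism\<close>

context internal_graphs
begin

definition open_graph :: "'m \<Rightarrow> 'm \<Rightarrow> 'm \<Rightarrow> 'm \<Rightarrow> ('p, 'n) cospan_arrow" where
  "open_graph s t a b = cospan_arrow G (leg a (gr s t)) (leg b (gr s t))"

text \<open>The renamings that identify processes are the edge and vertex components of a graph
  isomorphism: the equations for \<open>s\<close> and \<open>t\<close> say that it is a morphism,
  those for \<open>a\<close> and \<open>b\<close> that it respects the legs.\<close>

lemma open_graph_eqI:
  assumes e: "iso C e" and v: "iso C v" and d: "C.process_data s t a b" "C.process_data s' t' a' b'" and
    t: "Dom C e = Dom C s" "Cod C e = Dom C s'" "Dom C v = Cod C s" "Cod C v = Cod C s'"
    and eq: "s \<Zsemi> v = e \<Zsemi> s'" "t \<Zsemi> v = e \<Zsemi> t'" "a \<Zsemi> v = a'"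
      "b \<Zsemi> v = b'"
  shows "open_graph s t a b = open_graph s' t' a' b'"
proof -
  note d' = d[unfolded C.process_data_def]
  let ?m = "mor (gr s t) e v (gr s' t')"
  have m: "?m \<in> Ar G" "Dom G ?m = gr s t" "Cod G ?m = gr s' t'" "Em ?m = e" "Vm ?m = v"
    using d' t e v eq by simp_all
  show ?thesis
    unfolding open_graph_def
    by (rule G.cospan_arrow_eqI[where h = ?m]) (use m d' e v eq iso_G_iff[of ?m] in \<open>simp_all add: leg_Comp\<close>)
qed

text \<open>An isomorphism of apex graphs splits into its edge and vertex components, and these
  satisfy the very conditions of \<open>process_eqI\<close>; this gives injectivity on
  hom-sets.\<close>

lemma open_graph_eqE:
  assumes "open_graph s t a b = open_graph s' t' a' b'" and d: "C.process_data s t a b"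
    "C.process_data s' t' a' b'"
  obtains e v where "iso C e" "iso C v" "Dom C e = Dom C s" "Cod C e = Dom C s'" "Dom C v = Cod C s"
    "Cod C v = Cod C s'"
    "s \<Zsemi> v = e \<Zsemi> s'" "t \<Zsemi> v = e \<Zsemi> t'" "a \<Zsemi> v = a'" "b \<Zsemi> v = b'"
proof -
  note d' = d[unfolded C.process_data_def]
  obtain m where m: "iso G m" "Dom G m = Cod G (leg a (gr s t))"
    "leg a' (gr s' t') = leg a (gr s t) \<Zsemi>\<^bsub>G\<^esub> m"
    "leg b' (gr s' t') = leg b (gr s t) \<Zsemi>\<^bsub>G\<^esub> m"
    by (rule G.cospan_arrow_eqE[OF assms(1)[unfolded open_graph_def]]) (use d' in simp_all)
  have mA: "m \<in> Ar G"
    using m(1) by simp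
  have D: "Dom G m = gr s t"
    using m(2) d' by simp
  have "Cod G (leg a' (gr s' t')) = Cod G m"
    unfolding m(3) using D d' mA by simp
  then have Cm: "Cod G m = gr s' t'"
    using d' by simp
  have "a' = Vm (leg a' (gr s' t'))" "b' = Vm (leg b' (gr s' t'))"
    using d' by simp_all
  then have "a \<Zsemi> Vm m = a'" "b \<Zsemi> Vm m = b'"
    unfolding m(3,4) using D d' mA by simp_all
  moreover have "s \<Zsemi> Vm m = Em m \<Zsemi> s'" "t \<Zsemi> Vm m = Em m \<Zsemi> t'"
    using Em_Vm_commute[OF mA] D Cm d' by simp_all
  moreover have "iso C (Em m)" "iso C (Vm m)"
    using m(1) iso_G_iff[OF mA] by simp_all
  ultimately show ?thesis
    using that[of "Em m" "Vm m"] mA D Cm d' by simp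
qed

lemma in_hom_discrete_iff:
  assumes "A \<in> Ob C" "B \<in> Ob C"
  shows "y \<in> hom (full_subcategory (Cospan G) discr) (discrete_graph A) (discrete_graph B) \<longleftrightarrow>
    (\<exists>s t a b. C.process_data s t a b \<and> Dom C a = A \<and> Dom C b = B \<and> y = open_graph s t a b)"
proof
  assume "y \<in> hom (full_subcategory (Cospan G) discr) (discrete_graph A) (discrete_graph B)"
  then obtain l r where lr: "l \<in> Ar G" "r \<in> Ar G" "Cod G l = Cod G r" "Dom G l = discrete_graph A"
    "Dom G r = discrete_graph B" "y = cospan_arrow G l r"
    unfolding hom_full_subcategory_iff G.in_hom_Cospan_iff by blast
  let ?X = "Cod G l"
  have l: "l = leg (Vm l) ?X"
    by (rule leg_eqI[of _ A]) (use lr assms in simp_all)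
  have r: "r = leg (Vm r) ?X"
    by (rule leg_eqI[of _ B]) (use lr assms in simp_all)
  have X: "?X \<in> Ob G"
    using lr by simp
  have "C.process_data (sr ?X) (tg ?X) (Vm l) (Vm r)"
    using lr X by (simp add: C.process_data_def)
  moreover have "Dom C (Vm l) = A" "Dom C (Vm r) = B"
    using lr assms by simp_all
  moreover have "y = open_graph (sr ?X) (tg ?X) (Vm l) (Vm r)"
    unfolding open_graph_def sr_tg_simps(5)[OF X] l[symmetric] r[symmetric] by (rule lr(6))
  ultimately show "\<exists>s t a b. C.process_data s t a b \<and> Dom C a = A \<and> Dom C b = B \<and> y = open_graph s t a b"
    by blast
next
  assume "\<exists>s t a b. C.process_data s t a b \<and> Dom C a = A \<and> Dom C b = B \<and> y = open_graph s t a b"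
  then obtain s t a b where d: "C.process_data s t a b" and x: "Dom C a = A" "Dom C b = B"
    "y = open_graph s t a b"
    by blast
  have "leg a (gr s t) \<in> Ar G" "leg b (gr s t) \<in> Ar G"
    "Cod G (leg a (gr s t)) = Cod G (leg b (gr s t))"
    "Dom G (leg a (gr s t)) = discrete_graph A" "Dom G (leg b (gr s t)) = discrete_graph B"
    using d x by (simp_all add: C.process_data_def)
  then show "y \<in> hom (full_subcategory (Cospan G) discr) (discrete_graph A) (discrete_graph B)"
    unfolding hom_full_subcategory_iff G.in_hom_Cospan_iff x(3) open_graph_def using assms by auto
qed

text \<open>The pushout legs \<open>?i\<close> and \<open>?j\<close> are the coproduct injections on
  edges and \<open>p\<close>, \<open>q\<close> on vertices; the edge half is a pushout because the
  legs of open graphs are \<open>from_initial\<close> there. The result has the shape found in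
  \<open>st_comp_process\<close>.\<close>

lemma open_graph_comp:
  assumes d: "C.process_data s t a b" "C.process_data s' t' a' b'" and P: "is_pushout C b a' p q"
  shows "cospan_comp G (open_graph s t a b) (open_graph s' t' a' b') =
    open_graph (copair C (s \<Zsemi> p) (s' \<Zsemi> q)) (copair C (t \<Zsemi> p) (t' \<Zsemi> q)) (a \<Zsemi> p) (b' \<Zsemi> q)"
proof -
  note d' = d[unfolded C.process_data_def]
  note u = C.is_pushout_simps(1-4,6-9)[OF P]
  have D: "Dom C a' = Dom C b"
    using C.is_pushout_simps(5)[OF P] .
  let ?X = "gr s t" and ?Y = "gr s' t'"
  let ?Z = "gr (copair C (s \<Zsemi> p) (s' \<Zsemi> q)) (copair C (t \<Zsemi> p) (t' \<Zsemi> q))"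
  let ?i = "mor ?X (inj1 C (Dom C s) (Dom C s')) p ?Z" and ?j = "mor ?Y (inj2 C (Dom C s) (Dom C s')) q ?Z"
  have i: "?i \<in> Ar G" "Dom G ?i = ?X" "Cod G ?i = ?Z" "Em ?i = inj1 C (Dom C s) (Dom C s')" "Vm ?i = p"
    "?j \<in> Ar G" "Dom G ?j = ?Y" "Cod G ?j = ?Z" "Em ?j = inj2 C (Dom C s) (Dom C s')" "Vm ?j = q"
    using d' u by simp_all
  have "is_pushout C (from_initial C (Dom C s)) (from_initial C (Dom C s')) (inj1 C (Dom C s) (Dom C s')) (inj2 C (Dom C s) (Dom C s'))"
    by (rule C.is_pushout_from_initial[OF C.is_coproduct_coprod]) (use d' in simp_all)
  then have "is_pushout G (leg b ?X) (leg a' ?Y) ?i ?j"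
    by (intro is_pushout_G) (use P d' i D in simp_all)
  from G.cospan_comp_cospan_arrow[OF this, of "leg a ?X" "leg b' ?Y"] show ?thesis
    using d' i u by (simp add: open_graph_def leg_Comp)
qed

text \<open>The maps \<open>discrete_mu\<close> appear on the boundary because the left side uses
  the chosen coproducts of graphs. The apexes are compared by \<open>?e\<close>, from the chosen
  coproduct of graphs to the explicit one.\<close>

lemma open_graph_tensor:
  assumes d: "C.process_data s t a b" "C.process_data s' t' a' b'"
  shows "cospan_comp G (cospan_tensor G (open_graph s t a b) (open_graph s' t' a' b'))
      (cospan_of G (discrete_mu (Dom C b) (Dom C b'))) =
    cospan_comp G (cospan_of G (discrete_mu (Dom C a) (Dom C a')))
      (open_graph (coprod_ar C s s') (coprod_ar C t t') (coprod_ar C a a') (coprod_ar C b b'))"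
proof -
  note d' = d[unfolded C.process_data_def]
  let ?X = "gr s t" and ?Y = "gr s' t'"
  let ?Z = "gr (coprod_ar C s s') (coprod_ar C t t')"
  have X: "?X \<in> Ob G" "?Y \<in> Ob G" "?Z \<in> Ob G" "graph_coprod ?X ?Y = ?Z"
    using d' by (simp_all add: graph_coprod_def)
  have O: "Dom C a \<in> Ob C" "Dom C a' \<in> Ob C" "Dom C b \<in> Ob C" "Dom C b' \<in> Ob C"
    using d' by simp_all
  let ?e = "copair G (graph_inj1 ?X ?Y) (graph_inj2 ?X ?Y)"
  have e: "?e \<in> Ar G" "Dom G ?e = coprod_ob G ?X ?Y" "Cod G ?e = ?Z"
    using X by simp_all
  have "iso G ?e"
    by (rule G.is_coproduct_unique[OF G.is_coproduct_coprod[OF X(1,2)] is_coproduct_graph_coprod[OF X(1,2)]])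
      (use X e in simp_all)
  have nat: "coprod_ar G (leg c ?X) (leg c' ?Y) \<Zsemi>\<^bsub>G\<^esub> ?e = discrete_mu (Dom C c) (Dom C c') \<Zsemi>\<^bsub>G\<^esub> leg (coprod_ar C c c') ?Z"
    if "c \<in> Ar C" "c' \<in> Ar C" "Cod C c = Cod C s" "Cod C c' = Cod C s'" for c c'
    using that d' X by (simp add: discrete_mu_def leg_Comp)
  show ?thesis
    unfolding open_graph_def
    by (subst G.cospan_tensor_cospan_arrow, (use d' X in simp_all)[6])
      (rule G.cospan_natural[where e = ?e]; use d' X e \<open>iso G ?e\<close> nat O in simp)
qed

lemma open_graph_stateless:
  assumes "f \<in> Ar C"
  shows "open_graph (from_initial C (Cod C f)) (from_initial C (Cod C f)) f (Ide C (Cod C f)) = cospan_of G (discrete_map f)"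
proof -
  have "leg (Ide C (Cod C f)) (discrete_graph (Cod C f)) = Ide G (discrete_graph (Cod C f))"
    using discrete_map_Ide[of "Cod C f"] assms by (simp add: discrete_map_def)
  then show ?thesis
    using assms by (simp add: open_graph_def discrete_map_def cospan_of_def discrete_graph_def[symmetric])
qed

text \<open>A process is an equivalence class, so a quadruple has to be selected;
  \<open>to_open_graph_process\<close> shows that the selection does not matter.\<close>

definition to_open_graph :: "('o, ('o, 'm) cospan_arrow) st_arrow \<Rightarrow> ('p, 'n) cospan_arrow" where
  "to_open_graph x = (SOME y. \<exists>s t a b. C.process_data s t a b \<and> x = C.process s t a b \<and> y = open_graph s t a b)"

text \<open>Two quadruples of the same process differ by renamings (\<open>process_eqE\<close>), and
  these identify their open graphs (\<open>open_graph_eqI\<close>).\<close>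

lemma to_open_graph_process [simp]:
  assumes d: "C.process_data s t a b"
  shows "to_open_graph (C.process s t a b) = open_graph s t a b"
proof -
  have "\<exists>s' t' a' b'. C.process_data s' t' a' b' \<and> C.process s t a b = C.process s' t' a' b' \<and>
      to_open_graph (C.process s t a b) = open_graph s' t' a' b'"
    unfolding to_open_graph_def by (rule someI[of _ "open_graph s t a b"]) (use d in blast)
  then obtain s' t' a' b' where d2: "C.process_data s' t' a' b'" and
    eq: "C.process s t a b = C.process s' t' a' b'" and F: "to_open_graph (C.process s t a b) = open_graph s' t' a' b'"
    by blast
  from C.process_eqE[OF eq d d2] obtain e v where "iso C e" "iso C v" "Dom C e = Dom C s"
    "Cod C e = Dom C s'" "Dom C v = Cod C s" "Cod C v = Cod C s'"
    "s \<Zsemi> v = e \<Zsemi> s'" "t \<Zsemi> v = e \<Zsemi> t'" "a \<Zsemi> v = a'" "b \<Zsemi> v = b'" .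
  then show ?thesis
    unfolding F using open_graph_eqI[OF _ _ d d2] by simp
qed

lemma to_open_graph_stateless [simp]: "f \<in> Ar C \<Longrightarrow> to_open_graph (C.stateless f) = cospan_of G (discrete_map f)"
  by (simp add: C.stateless_def open_graph_stateless)

text \<open>This and the next three equations are the coherence conditions on the functor before
  passing to cospans. They compare copairings, and since \<open>discrete_map\<close> preserves
  composition they reduce to their components.\<close>

lemma discrete_mu_assoc:
  assumes "A \<in> Ob C" "B \<in> Ob C" "E \<in> Ob C"
  shows "coprod_ar G (discrete_mu A B) (Ide G (discrete_graph E)) \<Zsemi>\<^bsub>G\<^esub> (discrete_mu (coprod_ob C A B) E \<Zsemi>\<^bsub>G\<^esub>
      discrete_map (coprod_assoc C A B E)) =
    coprod_assoc G (discrete_graph A) (discrete_graph B) (discrete_graph E) \<Zsemi>\<^bsub>G\<^esub>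
      (coprod_ar G (Ide G (discrete_graph A)) (discrete_mu B E) \<Zsemi>\<^bsub>G\<^esub> discrete_mu A (coprod_ob C B E))"
  using assms by (simp add: discrete_mu_def coprod_assoc_def)

lemma discrete_mu_left_unit:
  assumes "A \<in> Ob C"
  shows "coprod_ar G (from_initial G (discrete_graph (initial_ob C))) (Ide G (discrete_graph A)) \<Zsemi>\<^bsub>G\<^esub>
      (discrete_mu (initial_ob C) A \<Zsemi>\<^bsub>G\<^esub> discrete_map (copair C (from_initial C A) (Ide C A))) =
    copair G (from_initial G (discrete_graph A)) (Ide G (discrete_graph A))"
  using assms by (simp add: discrete_mu_def)

lemma discrete_mu_right_unit:
  assumes "A \<in> Ob C"
  shows "coprod_ar G (Ide G (discrete_graph A)) (from_initial G (discrete_graph (initial_ob C))) \<Zsemi>\<^bsub>G\<^esub>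
      (discrete_mu A (initial_ob C) \<Zsemi>\<^bsub>G\<^esub> discrete_map (copair C (Ide C A) (from_initial C A))) =
    copair G (Ide G (discrete_graph A)) (from_initial G (discrete_graph A))"
  using assms by (simp add: discrete_mu_def)

lemma discrete_mu_swap:
  assumes "A \<in> Ob C" "B \<in> Ob C"
  shows "discrete_mu A B \<Zsemi>\<^bsub>G\<^esub> discrete_map (copair C (inj2 C B A) (inj1 C B A)) =
    copair G (inj2 G (discrete_graph B) (discrete_graph A)) (inj1 G (discrete_graph B) (discrete_graph A)) \<Zsemi>\<^bsub>G\<^esub> discrete_mu B A"
  using assms by (simp add: discrete_mu_def)

text \<open>Injectivity turns an isomorphism of open graphs back into renamings of quadruples;
  surjectivity holds because every cospan between discrete graphs comes from a quadruple.\<close>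

lemma bij_betw_to_open_graph:
  assumes "A \<in> Ob C" "B \<in> Ob C"
  shows "bij_betw to_open_graph (hom (St (Cospan C)) A B)
    (hom (full_subcategory (Cospan G) discr) (discrete_graph A) (discrete_graph B))"
  unfolding bij_betw_def
proof
  show "inj_on to_open_graph (hom (St (Cospan C)) A B)"
  proof (rule inj_onI)
    fix x y
    assume "x \<in> hom (St (Cospan C)) A B"
      "y \<in> hom (St (Cospan C)) A B" and eq: "to_open_graph x = to_open_graph y"
    then obtain s t a b s' t' a' b' where d: "C.process_data s t a b" "C.process_data s' t' a' b'"
      and x: "x = C.process s t a b" "y = C.process s' t' a' b'"
      unfolding C.in_hom_St_Cospan_iff by blast
    then have "open_graph s t a b = open_graph s' t' a' b'"
      using eq by simp
    from open_graph_eqE[OF this d] obtain e v where "iso C e" "iso C v" "Dom C e = Dom C s"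
      "Cod C e = Dom C s'" "Dom C v = Cod C s" "Cod C v = Cod C s'"
      "s \<Zsemi> v = e \<Zsemi> s'" "t \<Zsemi> v = e \<Zsemi> t'" "a \<Zsemi> v = a'" "b \<Zsemi> v = b'" .
    then show "x = y"
      unfolding x using C.process_eqI[OF _ _ d] by simp
  qed
  show "to_open_graph ` hom (St (Cospan C)) A B = hom (full_subcategory (Cospan G) discr) (discrete_graph A) (discrete_graph B)"
  proof (rule set_eqI)
    fix y
    have "y \<in> to_open_graph ` hom (St (Cospan C)) A B \<longleftrightarrow>
      (\<exists>s t a b. C.process_data s t a b \<and> Dom C a = A \<and> Dom C b = B \<and> y = to_open_graph (C.process s t a b))"
      unfolding image_iff Bex_def C.in_hom_St_Cospan_iff by blast
    also have "\<dots> \<longleftrightarrow> (\<exists>s t a b. C.process_data s t a b \<and> Dom C a = A \<and> Dom C b = B \<and> y = open_graph s t a b)"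
      by (metis to_open_graph_process)
    finally show "y \<in> to_open_graph ` hom (St (Cospan C)) A B \<longleftrightarrow>
      y \<in> hom (full_subcategory (Cospan G) discr) (discrete_graph A) (discrete_graph B)"
      unfolding in_hom_discrete_iff[OF assms] .
  qed
qed

lemma bij_betw_discrete_graph:
  "bij_betw discrete_graph (Ob (St (Cospan C))) (Ob (full_subcategory (Cospan G) discr))"
proof (rule bij_betw_byWitness[where f' = "\<lambda>X. Cod C (sr X)"])
  show "\<forall>A\<in>Ob (St (Cospan C)). Cod C (sr (discrete_graph A)) = A"
    by simp
  show "\<forall>X\<in>Ob (full_subcategory (Cospan G) discr). discrete_graph (Cod C (sr X)) = X"
    using discr_iff_discrete_graph by auto
qed auto

lemma iso_discr:
  assumes "iso G m" "discr (Dom G m)" "discr (Cod G m)"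
  shows "iso (full_subcategory (Cospan G) discr) (cospan_of G m)"
  by (rule symmetric_monoidal_category.iso_full_subcategory[OF G.symmetric_monoidal_Cospan G.iso_cospan_of])
    (use assms in simp_all)

lemma cospan_of_in_hom_discr:
  assumes "m \<in> Ar G" "discr (Dom G m)" "discr (Cod G m)"
  shows "cospan_of G m \<in> hom (full_subcategory (Cospan G) discr) (Dom G m) (Cod G m)"
  unfolding hom_full_subcategory_iff using assms by (simp add: hom_def)

theorem isomorphic_St_Cospan: "isomorphic_smcat (St (Cospan C)) (full_subcategory (Cospan G) discr)" (is "isomorphic_smcat ?P ?D")
proof -
  \<comment> \<open>Both structure maps come from isomorphisms of graphs; for
    \<open>?\<epsilon>\<close> this is because the discrete graph on the initial object is itself
    initial.\<close>
  let ?\<mu> = "\<lambda>A B. cospan_of G (discrete_mu A B)" and ?\<epsilon> = "cospan_of G (from_initial G (discrete_graph (initial_ob C)))"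
  have eps: "iso G (from_initial G (discrete_graph (initial_ob C)))"
    by (rule G.iso_from_initial[OF is_initial_discrete])
  have "symmetric_monoidal_isomorphism ?P ?D discrete_graph to_open_graph ?\<mu> ?\<epsilon>"
  proof (intro symmetric_monoidal_isomorphism.intro symmetric_strong_monoidal_functor.intro
      C.symmetric_monoidal_St_Cospan symmetric_monoidal_discrete
      symmetric_strong_monoidal_functor_axioms.intro symmetric_monoidal_isomorphism_axioms.intro)
    fix A assume "A \<in> Ob ?P"
    then have A: "A \<in> Ob C"
      by simp
    show "discrete_graph A \<in> Ob ?D"
      using A by simp
    show "to_open_graph (Ide ?P A) = Ide ?D (discrete_graph A)"
      using A C.Ide_St_Cospan[OF A] by simp
    show "Comp ?D (Comp ?D (TensorAr ?D ?\<epsilon> (Ide ?D (discrete_graph A))) (?\<mu> (Unit ?P) A))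
        (to_open_graph (LUnit ?P A)) = LUnit ?D (discrete_graph A)"
      using A discrete_mu_left_unit[OF A] by (simp add: C.st_of_cospan_of)
    show "Comp ?D (Comp ?D (TensorAr ?D (Ide ?D (discrete_graph A)) ?\<epsilon>) (?\<mu> A (Unit ?P)))
        (to_open_graph (RUnit ?P A)) = RUnit ?D (discrete_graph A)"
      using A discrete_mu_right_unit[OF A] by (simp add: C.st_of_cospan_of)
  next
    fix x A B assume x: "x \<in> hom ?P A B"
    then have "A \<in> Ob C" "B \<in> Ob C"
      unfolding C.in_hom_St_Cospan_iff by (auto simp: C.process_data_def)
    then show "to_open_graph x \<in> hom ?D (discrete_graph A) (discrete_graph B)"
      using bij_betwE[OF bij_betw_to_open_graph] x by blast
  next
    fix x A B y E assume "x \<in> hom ?P A B" "y \<in> hom ?P B E"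
    then obtain s t a b s' t' a' b' where d: "C.process_data s t a b" "C.process_data s' t' a' b'"
      and x: "x = C.process s t a b" "y = C.process s' t' a' b'" "Dom C b = B" "Dom C a' = B"
      unfolding C.in_hom_St_Cospan_iff by blast
    obtain p q where P: "is_pushout C b a' p q"
      using C.ex_pushout[of b a'] d x by (auto simp: C.process_data_def)
    show "to_open_graph (Comp ?P x y) = Comp ?D (to_open_graph x) (to_open_graph y)"
      using C.st_comp_process[OF d P] open_graph_comp[OF d P] d x(1,2) by simp
  next
    fix A B assume "A \<in> Ob ?P" "B \<in> Ob ?P"
    then have O: "A \<in> Ob C" "B \<in> Ob C"
      by simp_all
    show "?\<mu> A B \<in> hom ?D (TensorOb ?D (discrete_graph A) (discrete_graph B)) (discrete_graph (TensorOb ?P A B))"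
      using cospan_of_in_hom_discr[of "discrete_mu A B"] O by (simp add: discr_coprod_ob)
    show "iso ?D (?\<mu> A B)"
      using iso_discr[of "discrete_mu A B"] O by (simp add: discr_coprod_ob)
    show "Comp ?D (?\<mu> A B) (to_open_graph (Sym ?P A B)) = Comp ?D (Sym ?D (discrete_graph A) (discrete_graph B)) (?\<mu> B A)"
      using discrete_mu_swap[OF O] O by (simp add: C.st_of_cospan_of del: G.copair_Comp)
    show "bij_betw to_open_graph (hom ?P A B) (hom ?D (discrete_graph A) (discrete_graph B))"
      by (rule bij_betw_to_open_graph[OF O])
  next
    fix x A A' y B B' assume "x \<in> hom ?P A A'" "y \<in> hom ?P B B'"
    then obtain s t a b s' t' a' b' where d: "C.process_data s t a b" "C.process_data s' t' a' b'"
      and x: "x = C.process s t a b" "y = C.process s' t' a' b'"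
      "Dom C a = A" "Dom C b = A'" "Dom C a' = B" "Dom C b' = B'"
      unfolding C.in_hom_St_Cospan_iff by blast
    show "Comp ?D (TensorAr ?D (to_open_graph x) (to_open_graph y)) (?\<mu> A' B') =
      Comp ?D (?\<mu> A B) (to_open_graph (TensorAr ?P x y))"
      using open_graph_tensor[OF d] C.st_tensor_process[OF d] d x by simp
  next
    show "?\<epsilon> \<in> hom ?D (Unit ?D) (discrete_graph (Unit ?P))"
      using cospan_of_in_hom_discr[of "from_initial G (discrete_graph (initial_ob C))"] by (simp add: discr_initial_ob)
    show "iso ?D ?\<epsilon>"
      using iso_discr[OF eps] by (simp add: discr_initial_ob)
  next
    fix A B E assume "A \<in> Ob ?P" "B \<in> Ob ?P" "E \<in> Ob ?P"
    then have O: "A \<in> Ob C" "B \<in> Ob C" "E \<in> Ob C"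
      by simp_all
    show "Comp ?D (Comp ?D (TensorAr ?D (?\<mu> A B) (Ide ?D (discrete_graph E))) (?\<mu> (TensorOb ?P A B) E))
        (to_open_graph (Assoc ?P A B E)) =
      Comp ?D (Comp ?D (Assoc ?D (discrete_graph A) (discrete_graph B) (discrete_graph E))
        (TensorAr ?D (Ide ?D (discrete_graph A)) (?\<mu> B E))) (?\<mu> A (TensorOb ?P B E))"
      using discrete_mu_assoc[OF O] O by (simp add: C.st_of_cospan_of)
  qed (rule bij_betw_discrete_graph)
  then show ?thesis
    unfolding isomorphic_smcat_def by blast
qed

end

section \<open>Sets and graphs\<close>

text \<open>For sets it is easier to form a quotient of a coproduct: the hypotheses on
  \<open>c\<close> say that it is a coequalizer of \<open>f \<Zsemi> i\<close> and
  \<open>g \<Zsemi> j\<close>.\<close>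

lemma (in category) is_pushout_coequalizer:
  assumes P: "is_coproduct C (Cod C f) (Cod C g) Z i j"
    and fg: "f \<in> Ar C" "g \<in> Ar C" "Dom C g = Dom C f" and c: "c \<in> Ar C" "Dom C c = Z"
    and eq: "(f \<Zsemi> i) \<Zsemi> c = (g \<Zsemi> j) \<Zsemi> c"
    and ex: "\<And>k. \<lbrakk>k \<in> Ar C; Dom C k = Z; (f \<Zsemi> i) \<Zsemi> k = (g \<Zsemi> j) \<Zsemi> k\<rbrakk>
      \<Longrightarrow> \<exists>h. h \<in> Ar C \<and> Dom C h = Cod C c \<and> Cod C h = Cod C k \<and> c \<Zsemi> h = k"
    and epi: "\<And>h k. \<lbrakk>h \<in> Ar C; k \<in> Ar C; Dom C h = Cod C c; Dom C k = Cod C c; Cod C h = Cod C k; c \<Zsemi> h = c \<Zsemi> k\<rbrakk> \<Longrightarrow> h = k"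
  shows "is_pushout C f g (i \<Zsemi> c) (j \<Zsemi> c)"
proof -
  note s = is_coproduct_simps[OF P]
  show ?thesis
  proof (rule is_pushoutI)
    show "f \<Zsemi> (i \<Zsemi> c) = g \<Zsemi> (j \<Zsemi> c)"
      using eq s fg c by simp
  next
    fix u v
    assume a: "u \<in> Ar C" "v \<in> Ar C" "Dom C u = Cod C f" "Dom C v = Cod C g" "Cod C u = Cod C v"
      "f \<Zsemi> u = g \<Zsemi> v"
    then obtain k where k: "k \<in> Ar C" "Dom C k = Z" "Cod C k = Cod C u" "i \<Zsemi> k = u"
      "j \<Zsemi> k = v"
      using is_coproduct_ex1[OF P, of u v] by blast
    have "(f \<Zsemi> i) \<Zsemi> k = (g \<Zsemi> j) \<Zsemi> k"
      using a s fg k by simp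
    then obtain h where "h \<in> Ar C" "Dom C h = Cod C c" "Cod C h = Cod C k" "c \<Zsemi> h = k"
      using ex[OF k(1,2)] by blast
    then show "\<exists>h. h \<in> Ar C \<and> Dom C h = Cod C (i \<Zsemi> c) \<and> Cod C h = Cod C u \<and> (i \<Zsemi> c) \<Zsemi> h = u \<and> (j \<Zsemi> c) \<Zsemi> h = v"
      using s c k by (intro exI[of _ h]) simp
  next
    fix h k
    assume a: "h \<in> Ar C" "k \<in> Ar C" "Dom C h = Cod C (i \<Zsemi> c)"
      "Dom C k = Cod C (i \<Zsemi> c)" "Cod C h = Cod C k"
      "(i \<Zsemi> c) \<Zsemi> h = (i \<Zsemi> c) \<Zsemi> k"
        "(j \<Zsemi> c) \<Zsemi> h = (j \<Zsemi> c) \<Zsemi> k"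
    then have "c \<Zsemi> h = c \<Zsemi> k"
      using is_coproduct_eqI[OF P, of "c \<Zsemi> h" "c \<Zsemi> k"] s c by simp
    then show "h = k"
      using epi a s c by simp
  qed (use s fg c in simp_all)
qed

lemma Set_cat_simps [simp]:
  "Ob (Set_cat U) = U"
  "(A, f, B) \<in> Ar (Set_cat U) \<longleftrightarrow> A \<in> U \<and> B \<in> U \<and> f \<in> A \<rightarrow>\<^sub>E B"
  "Dom (Set_cat U) (A, f, B) = A"
  "Cod (Set_cat U) (A, f, B) = B"
  "Ide (Set_cat U) A = (A, \<lambda>x\<in>A. x, A)"
  "Comp (Set_cat U) (A, f, B) (B', g, D) = (A, compose A g f, D)"
  by (simp_all add: Set_cat_def)

lemma compose_eq_iff: "compose A g f = compose A g' f' \<longleftrightarrow> (\<forall>x\<in>A. g (f x) = g' (f' x))"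
  by (auto simp: compose_def fun_eq_iff restrict_def)

lemma compose_in_PiE: "\<lbrakk>f \<in> A \<rightarrow>\<^sub>E B; g \<in> B \<rightarrow>\<^sub>E D\<rbrakk> \<Longrightarrow> compose A g f \<in> A \<rightarrow>\<^sub>E D"
  by (auto simp: compose_def)

lemma compose_eqI: "\<lbrakk>h \<in> A \<rightarrow>\<^sub>E D; \<And>x. x \<in> A \<Longrightarrow> g (f x) = h x\<rbrakk> \<Longrightarrow> compose A g f = h"
  by (auto simp: compose_def fun_eq_iff restrict_def PiE_def extensional_def)

lemma category_Set_cat: "category (Set_cat U)"
proof
  fix f assume "f \<in> Ar (Set_cat U)"
  then show "Dom (Set_cat U) f \<in> Ob (Set_cat U)" "Cod (Set_cat U) f \<in> Ob (Set_cat U)"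
    by (cases f; simp)+
next
  fix A assume "A \<in> Ob (Set_cat U)"
  then show "Ide (Set_cat U) A \<in> hom (Set_cat U) A A"
    by (simp add: hom_def)
next
  fix f A B g D assume "f \<in> hom (Set_cat U) A B" "g \<in> hom (Set_cat U) B D"
  then show "Comp (Set_cat U) f g \<in> hom (Set_cat U) A D"
    by (cases f; cases g) (clarsimp simp: hom_def, erule (1) compose_in_PiE)
next
  fix f A B assume "f \<in> hom (Set_cat U) A B"
  then show "Comp (Set_cat U) (Ide (Set_cat U) A) f = f" "Comp (Set_cat U) f (Ide (Set_cat U) B) = f"
    by (cases f; auto simp: hom_def intro!: compose_eqI)+
next
  fix f A B g D h E assume "f \<in> hom (Set_cat U) A B" "g \<in> hom (Set_cat U) B D"
    "h \<in> hom (Set_cat U) D E"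
  then show "Comp (Set_cat U) (Comp (Set_cat U) f g) h = Comp (Set_cat U) f (Comp (Set_cat U) g h)"
    by (cases f; cases g; cases h) (auto simp: hom_def compose_def fun_eq_iff)
qed

section \<open>Finite colimits of small sets\<close>

context
  fixes U :: "'a set set"
  assumes U: "set_universe U"
begin

interpretation S: category "Set_cat U"
  by (rule category_Set_cat)

lemma subset_in_universe: "\<lbrakk>X \<in> U; Y \<subseteq> X\<rbrakk> \<Longrightarrow> Y \<in> U"
  using U unfolding set_universe_def by blast

lemma empty_in_universe: "{} \<in> U"
  using U unfolding set_universe_def by blast

text \<open>Only the empty set maps to the empty set, so the initial object is unique as a set, as
  \<open>initial_unique\<close> demands.\<close>

lemma is_initial_Set_cat_iff: "is_initial (Set_cat U) Z \<longleftrightarrow> Z = {}"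
proof
  assume "is_initial (Set_cat U) Z"
  then obtain f where "f \<in> hom (Set_cat U) Z {}"
    using empty_in_universe by (auto simp: is_initial_def)
  then show "Z = {}"
    by (cases f) (auto simp: hom_def)
next
  assume Z: "Z = {}"
  have "\<exists>!f. f \<in> hom (Set_cat U) {} A" if "A \<in> U" for A
  proof (rule ex1I[of _ "({}, \<lambda>x. undefined, A)"])
    show "({}, \<lambda>x. undefined, A) \<in> hom (Set_cat U) {} A"
      using that empty_in_universe by (simp add: hom_def)
  next
    fix f assume "f \<in> hom (Set_cat U) {} A"
    then show "f = ({}, \<lambda>x. undefined, A)"
      by (cases f) (simp add: hom_def)
  qed
  then show "is_initial (Set_cat U) Z"
    using Z empty_in_universe by (simp add: is_initial_def)
qed

text \<open>The disjoint union lives in a sum type; the universe provides a copy \<open>Z\<close> of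
  it among the small sets, and \<open>?\<psi>\<close> decodes the two cases.\<close>

lemma ex_coproduct_Set_cat:
  assumes AB: "A \<in> U" "B \<in> U"
  shows "\<exists>P i j. is_coproduct (Set_cat U) A B P i j" (is "\<exists>P i j. is_coproduct ?S _ _ _ _ _")
proof -
  have "\<exists>Z\<in>U. \<exists>\<phi>. bij_betw \<phi> (A <+> B) Z"
    using U AB by (simp add: set_universe_def)
  then obtain Z \<phi> where Z: "Z \<in> U" and \<phi>: "bij_betw \<phi> (A <+> B) Z"
    by blast
  let ?\<psi> = "inv_into (A <+> B) \<phi>"
  have inv: "?\<psi> (\<phi> (Inl x)) = Inl x" if "x \<in> A" for x
    using bij_betw_inv_into_left[OF \<phi> InlI[OF that]] .
  have inv': "?\<psi> (\<phi> (Inr y)) = Inr y" if "y \<in> B" for y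
    using bij_betw_inv_into_left[OF \<phi> InrI[OF that]] .
  have mem: "\<phi> w \<in> Z" if "w \<in> A <+> B" for w
    using bij_betwE[OF \<phi>] that by blast
  have surj: "(\<exists>a\<in>A. z = \<phi> (Inl a)) \<or> (\<exists>b\<in>B. z = \<phi> (Inr b))" if "z \<in> Z" for z
    using bij_betw_imp_surj_on[OF \<phi>] that by auto
  let ?i = "(A, \<lambda>a\<in>A. \<phi> (Inl a), Z)" and ?j = "(B, \<lambda>b\<in>B. \<phi> (Inr b), Z)"
  have "is_coproduct ?S A B Z ?i ?j"
  proof (rule S.is_coproductI)
    fix f g
    assume a: "f \<in> Ar ?S" "g \<in> Ar ?S" "Dom ?S f = A" "Dom ?S g = B" "Cod ?S f = Cod ?S g"
    obtain f' X where f: "f = (A, f', X)"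
      using a(3) by (cases f) auto
    obtain g' where g: "g = (B, g', X)"
      using a(4,5) f by (cases g) auto
    let ?h = "\<lambda>z\<in>Z. case ?\<psi> z of Inl a \<Rightarrow> f' a | Inr b \<Rightarrow> g' b"
    have "?h \<in> Z \<rightarrow>\<^sub>E X"
    proof (rule restrict_PiE_iff[THEN iffD2, rule_format])
      fix z assume "z \<in> Z"
      then show "(case ?\<psi> z of Inl a \<Rightarrow> f' a | Inr b \<Rightarrow> g' b) \<in> X"
        using surj[of z] a(1,2) f g by (auto simp: inv inv')
    qed
    moreover have "compose A ?h (\<lambda>a\<in>A. \<phi> (Inl a)) = f'"
      "compose B ?h (\<lambda>b\<in>B. \<phi> (Inr b)) = g'"
      using a(1,2) f g by (auto simp: inv inv' mem InlI InrI intro!: compose_eqI)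
    ultimately show "\<exists>h. h \<in> Ar ?S \<and> Dom ?S h = Z \<and> Cod ?S h = Cod ?S f \<and>
        Comp ?S ?i h = f \<and> Comp ?S ?j h = g"
      using a(1) f g Z by (intro exI[of _ "(Z, ?h, X)"]) simp
  next
    fix h k
    assume a: "h \<in> Ar ?S" "k \<in> Ar ?S" "Dom ?S h = Z" "Dom ?S k = Z"
      "Cod ?S h = Cod ?S k" "Comp ?S ?i h = Comp ?S ?i k" "Comp ?S ?j h = Comp ?S ?j k"
    obtain h' X where h: "h = (Z, h', X)"
      using a(3) by (cases h) auto
    obtain k' where k: "k = (Z, k', X)"
      using a(4,5) h by (cases k) auto
    have "h' z = k' z" if "z \<in> Z" for z
      using surj[OF that] a(6,7) h k by (auto simp: compose_eq_iff)
    then have "h' = k'"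
      using a(1,2) h k by (intro PiE_ext[of h' Z "\<lambda>_. X" k']) auto
    then show "h = k"
      using h k by simp
  qed (use AB Z mem in auto)
  then show ?thesis
    by blast
qed

lemma ex_pushout_Set_cat:
  assumes fg: "f \<in> Ar (Set_cat U)" "g \<in> Ar (Set_cat U)" "Dom (Set_cat U) f = Dom (Set_cat U) g"
  shows "\<exists>p q. is_pushout (Set_cat U) f g p q" (is "\<exists>p q. is_pushout ?S _ _ _ _")
proof -
  obtain Z i j where P: "is_coproduct ?S (Cod ?S f) (Cod ?S g) Z i j"
    using ex_coproduct_Set_cat S.Cod_Ob[OF fg(1)] S.Cod_Ob[OF fg(2)] by fastforce
  note s = S.is_coproduct_simps[OF P]
  obtain A f' where f': "Comp ?S f i = (A, f', Z)"
    using S.Comp_simps(3)[OF fg(1) s(1)] s by (cases "Comp ?S f i") auto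
  have "Dom ?S (Comp ?S g j) = A"
    using S.Comp_simps(2)[OF fg(1) s(1)] S.Comp_simps(2)[OF fg(2) s(4)] s fg f' by simp
  then obtain g' where g': "Comp ?S g j = (A, g', Z)"
    using S.Comp_simps(3)[OF fg(2) s(4)] s by (cases "Comp ?S g j") auto
  have "Comp ?S f i \<in> Ar ?S" "Comp ?S g j \<in> Ar ?S"
    using fg s by simp_all
  then have fA: "A \<in> U" "Z \<in> U" "f' \<in> A \<rightarrow>\<^sub>E Z"
    "g' \<in> A \<rightarrow>\<^sub>E Z"
    unfolding f' g' by simp_all
  \<comment> \<open>Two points are identified when no map out of \<open>Z\<close> that coequalizes \<open>f'\<close> and \<open>g'\<close> separates them.\<close>
  define R where "R z w \<longleftrightarrow> w \<in> Z \<and> (\<forall>X k. X \<in> U \<and> k \<in> Z \<rightarrow>\<^sub>E X \<and> (\<forall>a\<in>A. k (f' a) = k (g' a)) \<longrightarrow> k z = k w)" for z w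
  \<comment> \<open>A quotient by \<open>R\<close> would consist of sets of points. Picking one
    representative per class keeps the quotient a subset of \<open>Z\<close>, hence in
    \<open>U\<close>.\<close>
  define c where "c z = (SOME w. R z w)" for z
  have "R z z" if "z \<in> Z" for z
    using that by (simp add: R_def)
  then have Rc: "R z (c z)" if "z \<in> Z" for z
    unfolding c_def by (rule someI) (rule that)
  then have cZ: "c ` Z \<subseteq> Z"
    by (auto simp: R_def)
  then have cU: "c ` Z \<in> U"
    using subset_in_universe fA by blast
  \<comment> \<open>Equal predicates, so the choice operator returns the same representative for
    \<open>f' a\<close> and \<open>g' a\<close>.\<close>
  have "R (f' a) = R (g' a)" if "a \<in> A" for a
    using that by (auto simp: R_def fun_eq_iff)
  then have cfg: "c (f' a) = c (g' a)" if "a \<in> A" for a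
    using that by (simp add: c_def)
  let ?c = "(Z, \<lambda>z\<in>Z. c z, c ` Z)"
  have "is_pushout ?S f g (Comp ?S i ?c) (Comp ?S j ?c)"
  proof (rule S.is_pushout_coequalizer[OF P fg(1,2) fg(3)[symmetric]])
    show "?c \<in> Ar ?S"
      using fA cU by simp
    show "Comp ?S (Comp ?S f i) ?c = Comp ?S (Comp ?S g j) ?c"
      unfolding f' g' using fA cfg by (auto simp: compose_eq_iff)
  next
    fix k
    assume k: "k \<in> Ar ?S" "Dom ?S k = Z"
      "Comp ?S (Comp ?S f i) k = Comp ?S (Comp ?S g j) k"
    obtain k' X where k': "k = (Z, k', X)"
      using k(2) by (cases k) auto
    have k2: "X \<in> U" "k' \<in> Z \<rightarrow>\<^sub>E X" "\<forall>a\<in>A. k' (f' a) = k' (g' a)"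
      using k(1,3) unfolding f' g' k' by (auto simp: compose_eq_iff)
    \<comment> \<open>\<open>k'\<close> is among the maps over which \<open>R\<close> quantifies, so
      it takes the same value at \<open>z\<close> and at its representative.\<close>
    have "k' (c z) = k' z" if "z \<in> Z" for z
      using Rc[OF that] k2 unfolding R_def by metis
    then have "compose Z (\<lambda>z\<in>c ` Z. k' z) (\<lambda>z\<in>Z. c z) = k'"
      using k2(2) by (intro compose_eqI) auto
    moreover have "(\<lambda>z\<in>c ` Z. k' z) \<in> c ` Z \<rightarrow>\<^sub>E X"
      using k2(2) cZ by auto
    ultimately show "\<exists>h. h \<in> Ar ?S \<and> Dom ?S h = Cod ?S ?c \<and> Cod ?S h = Cod ?S k \<and>
        Comp ?S ?c h = k"
      using k2(1) cU k' by (intro exI[of _ "(c ` Z, \<lambda>z\<in>c ` Z. k' z, X)"]) simp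
  next
    fix h k
    assume a: "h \<in> Ar ?S" "k \<in> Ar ?S" "Dom ?S h = Cod ?S ?c" "Dom ?S k = Cod ?S ?c"
      "Cod ?S h = Cod ?S k" "Comp ?S ?c h = Comp ?S ?c k"
    obtain h' X where h: "h = (c ` Z, h', X)"
      using a(3) by (cases h) auto
    obtain k' where k: "k = (c ` Z, k', X)"
      using a(4,5) h by (cases k) auto
    have "h' z = k' z" if "z \<in> c ` Z" for z
      using a(6) h k that by (auto simp: compose_eq_iff)
    then have "h' = k'"
      using a(1,2) h k by (intro PiE_ext[of h' "c ` Z" "\<lambda>_. X" k']) auto
    then show "h = k"
      using h k by simp
  qed simp
  then show ?thesis
    by blast
qed

lemma finitely_cocomplete_Set_cat: "finitely_cocomplete (Set_cat U)"
proof
  show "\<exists>Z. is_initial (Set_cat U) Z"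
    using is_initial_Set_cat_iff by blast
qed (use ex_coproduct_Set_cat ex_pushout_Set_cat in auto)

end

section \<open>Graphs as internal graphs in sets\<close>

lemma Graph_cat_simps [simp]:
  "Ob (Graph_cat U) = graphs U"
  "(G, m, H) \<in> Ar (Graph_cat U) \<longleftrightarrow> G \<in> graphs U \<and> H \<in> graphs U \<and> m \<in> graph_morphisms G H"
  "Dom (Graph_cat U) (G, m, H) = G"
  "Cod (Graph_cat U) (G, m, H) = H"
  "Ide (Graph_cat U) G = (G, (\<lambda>x\<in>edges G. x, \<lambda>x\<in>verts G. x), G)"
  "Comp (Graph_cat U) (G, (e, v), H) (H', (e', v'), K) = (G, (compose (edges G) e' e, compose (verts G) v' v), K)"
  by (simp_all add: Graph_cat_def)

lemma in_graphs_iff: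
  "G \<in> graphs U \<longleftrightarrow> edges G \<in> U \<and> verts G \<in> U \<and> src G \<in> edges G \<rightarrow>\<^sub>E verts G \<and> tgt G \<in> edges G \<rightarrow>\<^sub>E verts G"
  by (simp add: graphs_def)

lemma in_graph_morphisms_iff:
  "(e, v) \<in> graph_morphisms G H \<longleftrightarrow> e \<in> edges G \<rightarrow>\<^sub>E edges H \<and> v \<in> verts G \<rightarrow>\<^sub>E verts H \<and>
     (\<forall>x\<in>edges G. src H (e x) = v (src G x) \<and> tgt H (e x) = v (tgt G x))"
  by (simp add: graph_morphisms_def)

lemma graph_morphisms_compose:
  assumes "G \<in> graphs U" "(e, v) \<in> graph_morphisms G H" "(e', v') \<in> graph_morphisms H K"
  shows "(compose (edges G) e' e, compose (verts G) v' v) \<in> graph_morphisms G K"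
  unfolding in_graph_morphisms_iff
proof (intro conjI ballI)
  fix x assume x: "x \<in> edges G"
  then have "e x \<in> edges H" "src G x \<in> verts G" "tgt G x \<in> verts G"
    using assms(1,2) unfolding in_graphs_iff in_graph_morphisms_iff by (auto intro: PiE_mem)
  then show "src K (compose (edges G) e' e x) = compose (verts G) v' v (src G x)"
    "tgt K (compose (edges G) e' e x) = compose (verts G) v' v (tgt G x)"
    using assms(2,3) x by (simp_all add: in_graph_morphisms_iff compose_eq)
qed (rule compose_in_PiE; use assms(2,3) in \<open>unfold in_graph_morphisms_iff, blast\<close>)+

lemma category_Graph_cat: "category (Graph_cat U)"
proof
  fix f assume "f \<in> Ar (Graph_cat U)"
  then show "Dom (Graph_cat U) f \<in> Ob (Graph_cat U)" "Cod (Graph_cat U) f \<in> Ob (Graph_cat U)"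
    by (cases f; simp)+
next
  fix A assume "A \<in> Ob (Graph_cat U)"
  then show "Ide (Graph_cat U) A \<in> hom (Graph_cat U) A A"
    by (auto simp: hom_def in_graph_morphisms_iff in_graphs_iff)
next
  fix f A B g D assume "f \<in> hom (Graph_cat U) A B" "g \<in> hom (Graph_cat U) B D"
  then show "Comp (Graph_cat U) f g \<in> hom (Graph_cat U) A D"
    by (cases f; cases g) (auto simp: hom_def graph_morphisms_compose)
next
  fix f A B assume "f \<in> hom (Graph_cat U) A B"
  then show "Comp (Graph_cat U) (Ide (Graph_cat U) A) f = f" "Comp (Graph_cat U) f (Ide (Graph_cat U) B) = f"
    by (cases f; auto simp: hom_def in_graph_morphisms_iff intro!: compose_eqI)+
next
  fix f A B g D h E assume "f \<in> hom (Graph_cat U) A B" "g \<in> hom (Graph_cat U) B D"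
    "h \<in> hom (Graph_cat U) D E"
  then show "Comp (Graph_cat U) (Comp (Graph_cat U) f g) h = Comp (Graph_cat U) f (Comp (Graph_cat U) g h)"
    by (cases f; cases g; cases h) (auto simp: hom_def in_graph_morphisms_iff compose_def fun_eq_iff)
qed

text \<open>Arrows of \<open>Set_cat\<close> carry their domain and codomain, which a graph record
  stores once as edges and vertices; the parameters translate between the two formats.
  Extensionality of the functions makes the translation exact.\<close>

lemma internal_graphs_Graph_cat:
  fixes U :: "'a set set"
  assumes U: "set_universe U"
  shows "internal_graphs (Set_cat U) (Graph_cat U)
    (\<lambda>s t. \<lparr>edges = fst s, verts = snd (snd s), src = fst (snd s), tgt = fst (snd t)\<rparr>)
    (\<lambda>X. (edges X, src X, verts X)) (\<lambda>X. (edges X, tgt X, verts X))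
    (\<lambda>X e v Y. (X, (fst (snd e), fst (snd v)), Y))
    (\<lambda>m. (edges (fst m), fst (fst (snd m)), edges (snd (snd m))))
    (\<lambda>m. (verts (fst m), snd (fst (snd m)), verts (snd (snd m))))
    discrete"
proof -
  interpret S: finitely_cocomplete "Set_cat U"
    by (rule finitely_cocomplete_Set_cat[OF U])
  interpret G: category "Graph_cat U"
    by (rule category_Graph_cat)
  have I: "initial_ob (Set_cat U) = {}"
    using S.is_initial_initial_ob is_initial_Set_cat_iff[OF U] by blast
  show ?thesis
  proof (unfold_locales, goal_cases)
    case (1 Z)
    then show ?case
      using is_initial_Set_cat_iff[OF U] I by simp
  next
    case (2 s t)
    then show ?case
      by (cases s; cases t) (auto simp: in_graphs_iff)
  next
    case (3 X)
    then show ?case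
      by (auto simp: in_graphs_iff)
  next
    case (4 m)
    then show ?case
      by (cases m) (auto simp: in_graphs_iff in_graph_morphisms_iff compose_eq_iff)
  next
    case (5 X Y e v)
    then show ?case
      by (cases e; cases v) (auto simp: in_graphs_iff in_graph_morphisms_iff compose_eq_iff hom_def)
  next
    case (6 X)
    then show ?case
      by simp
  next
    case (7 m n)
    then show ?case
      by (cases m; cases n) auto
  next
    case (8 X)
    then show ?case
      by (simp add: discrete_def I)
  qed
qed

theorem corollary4p19:
  fixes U :: "'a set set"
  assumes "set_universe U"
  shows "isomorphic_smcat
           (St (Cospan (Set_cat U)))
           (full_subcategory (Cospan (Graph_cat U)) discrete)"
  by (rule internal_graphs.isomorphic_St_Cospan[OF internal_graphs_Graph_cat[OF assms]])

end
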